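(* Let $\mu_1$ be the Gauss measure on $(0,1)$. For every integer $N\ge 0$ there exists a probability measure $P_N$ on $(1,\infty)\times \mathbb{N}_+^N$ such that for all $a,b>1$ and all $c_0,\dots,c_{N-1}\in\mathbb{N}_+$, $$\lim_{R\to\infty}\mu_1\left\{\alpha\in(0,1)\setminus\mathbb{Q} \,:\, a<\frac{q_{n_R(\alpha)}(\alpha)}{R}<b,\ \ a_{n_R(\alpha)-k}(\alpha)=c_k \text{ for all } 0\le k<N\right\}=P_N\big((a,b)\times\{c_0\}\times\cdots\times\{c_{N-1}\}\big).$$ That is, the ratio $q_{n_R}/R$ and the entries $a_{n_R-k}$, $0\le k<N$, have a joint limiting distribution with respect to $\mu_1$ as $R\to\infty$.
   Context: $\mathbb{N}_+=\{1,2,3,\dots\}$, $\mathbb{N}=\{0,1,2,\dots\}$. For irrational $\alpha\in(0,1)$, write its continued fraction expansion as $\alpha=[a_1,a_2,\dots]=\cfrac{1}{a_1+\cfrac{1}{a_2+\cdots}}$ with entries $a_n=a_n(\alpha)\in\mathbb{N}_+$, and let $p_n/q_n=[a_1,\dots,a_n]$ with $\gcd(p_n,q_n)=1$ be its convergents; thus $q_n=q_n(\alpha)$ satisfies $q_{-1}=0$, $q_0=1$, $q_{k+1}=a_{k+1}q_k+q_{k-1}$ for $k\ge 0$. For $R>0$ set $n_R=n_R(\alpha)=\min\{n\in\mathbb{N} : q_n>R\}$. The condition $a_{n_R-k}=c_k$ is considered not satisfied if $n_R-k<1$. The Gauss measure $\mu_1$ is the probability measure on $(0,1)$ with density $\frac{d\mu_1}{d\alpha}=\frac{1}{(\ln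 2)(1+\alpha)}$. *)

theory Defs
  imports "HOL-Probability.Probability"
begin

definition gauss_map :: "real \<Rightarrow> real"
  where "gauss_map x = frac (1 / x)"

text \<open>The entry \<open>a\<^sub>n(\<alpha>)\<close> for \<open>n \<ge> 1\<close>; the value at \<open>n = 0\<close> is meaningless.\<close>
definition cf_entry :: "real \<Rightarrow> nat \<Rightarrow> nat"
  where "cf_entry \<alpha> n = nat \<lfloor>1 / (gauss_map ^^ (n - 1)) \<alpha>\<rfloor>"

text \<open>
  Numerators and denominators of the convergents. The second equations are the recursion
  with \<open>p\<^sub>-\<^sub>1 = 1\<close> and \<open>q\<^sub>-\<^sub>1 = 0\<close> inserted.
\<close>
fun cf_p :: "real \<Rightarrow> nat \<Rightarrow> nat" where
  "cf_p \<alpha> 0 = 0"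
| "cf_p \<alpha> (Suc 0) = 1"
| "cf_p \<alpha> (Suc (Suc k)) = cf_entry \<alpha> (Suc (Suc k)) * cf_p \<alpha> (Suc k) + cf_p \<alpha> k"

fun cf_q :: "real \<Rightarrow> nat \<Rightarrow> nat" where
  "cf_q \<alpha> 0 = 1"
| "cf_q \<alpha> (Suc 0) = cf_entry \<alpha> 1"
| "cf_q \<alpha> (Suc (Suc k)) = cf_entry \<alpha> (Suc (Suc k)) * cf_q \<alpha> (Suc k) + cf_q \<alpha> k"

text \<open>The set of such \<open>n\<close> is nonempty for irrational \<open>\<alpha>\<close>, by \<open>cf_q_ge\<close> below.\<close>
definition cf_n :: "real \<Rightarrow> real \<Rightarrow> nat"
  where "cf_n R \<alpha> = (LEAST n. real (cf_q \<alpha> n) > R)"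

definition gauss_measure :: "real measure"
  where "gauss_measure =
    density (restrict_space lborel {0<..<1}) (\<lambda>\<alpha>. ennreal (1 / (ln 2 * (1 + \<alpha>))))"

text \<open>
  The \<open>N\<close>-tuples of positive integers are the extensional functions on \<open>{..<N}\<close>, that is,
  the elements of \<open>PiE {..<N} (\<lambda>_. {1..})\<close>.
\<close>
definition ratio_entries_space :: "nat \<Rightarrow> (real \<times> (nat \<Rightarrow> nat)) measure"
  where "ratio_entries_space N =
    restrict_space borel {1<..} \<Otimes>\<^sub>M (\<Pi>\<^sub>M k\<in>{..<N}. count_space {1..})"


text \<open>
  The definitions above compute the continued fraction expansion: \<open>cf_eval [a\<^sub>1, \<dots>, a\<^sub>n] 0\<close> is the
  finite continued fraction \<open>[a\<^sub>1, \<dots>, a\<^sub>n]\<close>, which equals \<open>p\<^sub>n / q\<^sub>n\<close> in lowest terms and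
  converges to \<open>\<alpha>\<close>.
\<close>

definition cf_eval :: "nat list \<Rightarrow> real \<Rightarrow> real"
  where "cf_eval as t = foldr (\<lambda>a r. 1 / (real a + r)) as t"

lemma gauss_map_irrational:
  assumes "x \<notin> \<rat>"
  shows "gauss_map x \<notin> \<rat>" "0 < gauss_map x" "gauss_map x < 1"
proof -
  have inv: "1 / x \<notin> \<rat>"
    using assms Rats_inverse[of "1 / x"] by (auto simp: inverse_eq_divide)
  show irr: "gauss_map x \<notin> \<rat>"
  proof
    assume "gauss_map x \<in> \<rat>"
    then have "gauss_map x + of_int \<lfloor>1 / x\<rfloor> \<in> \<rat>" by (intro Rats_add Rats_of_int)
    then show False using inv by (simp add: gauss_map_def frac_def)
  qed
  have "gauss_map x \<noteq> 0" using irr by auto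
  moreover have "0 \<le> gauss_map x" by (simp add: gauss_map_def)
  ultimately show "0 < gauss_map x" by simp
  show "gauss_map x < 1" by (simp add: gauss_map_def frac_lt_1)
qed

lemma gauss_map_iterate:
  assumes "\<alpha> \<in> {0<..<1}" "\<alpha> \<notin> \<rat>"
  shows "(gauss_map ^^ n) \<alpha> \<notin> \<rat> \<and> 0 < (gauss_map ^^ n) \<alpha> \<and> (gauss_map ^^ n) \<alpha> < 1"
  using assms by (induction n) (auto simp: gauss_map_irrational)

lemma cf_entry_ge_1:
  assumes "\<alpha> \<in> {0<..<1}" "\<alpha> \<notin> \<rat>"
  shows "1 \<le> cf_entry \<alpha> n"
proof -
  have "1 \<le> 1 / (gauss_map ^^ (n - 1)) \<alpha>"
    using gauss_map_iterate[OF assms, of "n - 1"] by simp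
  then have "1 \<le> \<lfloor>1 / (gauss_map ^^ (n - 1)) \<alpha>\<rfloor>" by (simp add: le_floor_iff)
  then show ?thesis unfolding cf_entry_def by linarith
qed

lemma cf_q_ge:
  assumes "\<alpha> \<in> {0<..<1}" "\<alpha> \<notin> \<rat>"
  shows "1 \<le> cf_q \<alpha> n \<and> n \<le> cf_q \<alpha> n"
proof (induction n rule: less_induct)
  case (less n)
  consider "n = 0" | "n = 1" | k where "n = Suc (Suc k)"
    by (metis One_nat_def not0_implies_Suc)
  then show ?case
  proof cases
    case 3
    have "1 * cf_q \<alpha> (Suc k) \<le> cf_entry \<alpha> n * cf_q \<alpha> (Suc k)"
      using cf_entry_ge_1[OF assms] by (intro mult_le_mono) simp_all
    moreover have "1 \<le> cf_q \<alpha> k" "Suc k \<le> cf_q \<alpha> (Suc k)"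
      using less[of k] less[of "Suc k"] 3 by auto
    ultimately show ?thesis unfolding 3 cf_q.simps by linarith
  qed (use cf_entry_ge_1[OF assms] in auto)
qed

lemma cf_eval_convergents:
  fixes t :: real
  assumes "\<alpha> \<in> {0<..<1}" "\<alpha> \<notin> \<rat>" "0 \<le> t"
  shows "cf_eval (map (cf_entry \<alpha>) [1..<Suc (Suc n)]) t =
    (cf_p \<alpha> (Suc n) + t * cf_p \<alpha> n) / (cf_q \<alpha> (Suc n) + t * cf_q \<alpha> n)"
  using assms(3)
proof (induction n arbitrary: t)
  case 0
  then show ?case by (simp add: cf_eval_def)
next
  case (Suc n)
  define a where "a = real (cf_entry \<alpha> (Suc (Suc n)))"
  have a: "a + t > 0" 
    using cf_entry_ge_1[OF assms(1,2), of "Suc (Suc n)"] Suc.prems by (simp add: a_def)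
  have "cf_eval (map (cf_entry \<alpha>) [1..<Suc (Suc (Suc n))]) t =
      cf_eval (map (cf_entry \<alpha>) [1..<Suc (Suc n)]) (1 / (a + t))"
    by (simp add: cf_eval_def a_def)
  also have "\<dots> = (cf_p \<alpha> (Suc n) + 1 / (a + t) * cf_p \<alpha> n) /
      (cf_q \<alpha> (Suc n) + 1 / (a + t) * cf_q \<alpha> n)"
    using a by (intro Suc.IH) simp
  also have "\<dots> = ((a + t) * (cf_p \<alpha> (Suc n) + 1 / (a + t) * cf_p \<alpha> n)) /
      ((a + t) * (cf_q \<alpha> (Suc n) + 1 / (a + t) * cf_q \<alpha> n))"
    using a by simp
  also have "\<dots> = ((a + t) * cf_p \<alpha> (Suc n) + cf_p \<alpha> n) / ((a + t) * cf_q \<alpha> (Suc n) + cf_q \<alpha> n)"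
    using a by (simp add: distrib_left)
  finally show ?case by (simp add: a_def algebra_simps)
qed

lemma cf_eval_eq_convergent:
  assumes "\<alpha> \<in> {0<..<1}" "\<alpha> \<notin> \<rat>"
  shows "cf_eval (map (cf_entry \<alpha>) [1..<Suc n]) 0 = cf_p \<alpha> n / cf_q \<alpha> n"
  using cf_eval_convergents[OF assms, of 0 "n - 1"] by (cases n) (simp_all add: cf_eval_def)

lemma cf_det: "int (cf_p \<alpha> (Suc n)) * int (cf_q \<alpha> n) - int (cf_p \<alpha> n) * int (cf_q \<alpha> (Suc n)) = (-1) ^ n"
  by (induction n) (simp_all add: algebra_simps)

lemma coprime_cf_p_cf_q: "coprime (cf_p \<alpha> n) (cf_q \<alpha> n)"
proof -
  have "is_unit d" if "d dvd int (cf_p \<alpha> n)" "d dvd int (cf_q \<alpha> n)" for d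
  proof -
    have "d dvd int (cf_p \<alpha> (Suc n)) * int (cf_q \<alpha> n) - int (cf_p \<alpha> n) * int (cf_q \<alpha> (Suc n))"
      using that by (intro dvd_diff) auto
    then have "d dvd (-1) ^ n" by (simp only: cf_det)
    then show ?thesis by (cases "even n") auto
  qed
  then have "coprime (int (cf_p \<alpha> n)) (int (cf_q \<alpha> n))" by (rule coprimeI)
  then show ?thesis by simp
qed

lemma cf_eval_tail:
  assumes "\<alpha> \<in> {0<..<1}" "\<alpha> \<notin> \<rat>"
  shows "cf_eval (map (cf_entry \<alpha>) [1..<Suc n]) ((gauss_map ^^ n) \<alpha>) = \<alpha>"
proof (induction n)
  case 0
  then show ?case by (simp add: cf_eval_def)
next
  case (Suc n)
  define x where "x = (gauss_map ^^ n) \<alpha>"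
  have x: "0 < x" using gauss_map_iterate[OF assms, of n] by (simp add: x_def)
  have "real (cf_entry \<alpha> (Suc n)) + gauss_map x = 1 / x"
    using x by (simp add: cf_entry_def gauss_map_def frac_def x_def[symmetric])
  then have "1 / (real (cf_entry \<alpha> (Suc n)) + gauss_map x) = x" by simp
  then show ?case using Suc by (simp add: cf_eval_def x_def)
qed

lemma cf_eval_tendsto:
  assumes "\<alpha> \<in> {0<..<1}" "\<alpha> \<notin> \<rat>"
  shows "(\<lambda>n. cf_eval (map (cf_entry \<alpha>) [1..<Suc n]) 0) \<longlonglongrightarrow> \<alpha>"
proof -
  have bound: "\<bar>cf_eval (map (cf_entry \<alpha>) [1..<Suc (Suc n)]) 0 - \<alpha>\<bar> \<le> 1 / real (Suc n)" for n
  proof -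
    define t where "t = (gauss_map ^^ Suc n) \<alpha>"
    define p p' q q' where "p = real (cf_p \<alpha> n)" and "p' = real (cf_p \<alpha> (Suc n))"
      and "q = real (cf_q \<alpha> n)" and "q' = real (cf_q \<alpha> (Suc n))"
    have t: "0 < t" "t < 1" using gauss_map_iterate[OF assms, of "Suc n"] by (auto simp: t_def)
    have q: "1 \<le> q" "1 \<le> q'" "real (Suc n) \<le> q'"
      using cf_q_ge[OF assms, of n] cf_q_ge[OF assms, of "Suc n"]
      by (auto simp: q_def q'_def simp del: cf_q.simps)
    have "\<alpha> = (p' + t * p) / (q' + t * q)"
      using cf_eval_tail[OF assms, of "Suc n"] cf_eval_convergents[OF assms, of t n] t
      by (simp add: t_def p_def p'_def q_def q'_def del: upt_Suc)
    moreover have pos: "q' + t * q > 0" "q' > 0" using t q by (auto intro: add_pos_pos)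
    ultimately have "p' / q' - \<alpha> = p' / q' - (p' + t * p) / (q' + t * q)" by simp
    also have "\<dots> = (p' * (q' + t * q) - (p' + t * p) * q') / (q' * (q' + t * q))"
      using pos by (subst diff_frac_eq) auto
    also have "p' * (q' + t * q) - (p' + t * p) * q' = t * (p' * q - p * q')"
      by (simp add: algebra_simps)
    also have "p' * q - p * q' = (-1) ^ n"
      using arg_cong[OF cf_det[of \<alpha> n], of real_of_int] by (simp add: p_def p'_def q_def q'_def)
    finally have "\<bar>p' / q' - \<alpha>\<bar> = t / (q' * (q' + t * q))"
      using t pos by (simp add: abs_mult)
    also have "\<dots> \<le> 1 / (real (Suc n) * 1)"
      using t q pos by (intro frac_le mult_mono) (auto intro: add_increasing2)
    finally show ?thesis
      using cf_eval_eq_convergent[OF assms, of "Suc n"]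
      by (simp add: p'_def q'_def del: upt_Suc)
  qed
  have "(\<lambda>n. cf_eval (map (cf_entry \<alpha>) [1..<Suc (Suc n)]) 0 - \<alpha>) \<longlonglongrightarrow> 0"
    by (rule Lim_null_comparison[OF _ LIMSEQ_Suc[OF lim_1_over_n]]) (use bound in auto)
  then have "(\<lambda>n. cf_eval (map (cf_entry \<alpha>) [1..<Suc (Suc n)]) 0) \<longlonglongrightarrow> \<alpha>"
    by (simp only: LIM_zero_iff)
  then show ?thesis by (rule LIMSEQ_imp_Suc)
qed

text \<open>The event in the limit theorem is measurable, and the Gauss measure is a probability measure.\<close>

lemma gauss_map_measurable [measurable]: "gauss_map \<in> borel_measurable borel"
  unfolding gauss_map_def frac_def by measurable

lemma gauss_map_iterate_measurable [measurable]: "(gauss_map ^^ n) \<in> borel_measurable borel"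
  by (induction n) (auto intro: measurable_comp[OF _ gauss_map_measurable] simp: id_def)

lemma cf_entry_measurable [measurable]: "(\<lambda>\<alpha>. cf_entry \<alpha> n) \<in> measurable borel (count_space UNIV)"
  unfolding cf_entry_def by measurable

lemma cf_q_measurable [measurable]: "(\<lambda>\<alpha>. cf_q \<alpha> n) \<in> measurable borel (count_space UNIV)"
proof (induction n rule: less_induct)
  case (less n)
  consider "n = 0" | "n = 1" | k where "n = Suc (Suc k)"
    by (metis One_nat_def not0_implies_Suc)
  then show ?case
  proof cases
    case 3
    have [measurable]: "(\<lambda>\<alpha>. cf_q \<alpha> k) \<in> measurable borel (count_space UNIV)"
      "(\<lambda>\<alpha>. cf_q \<alpha> (Suc k)) \<in> measurable borel (count_space UNIV)"
      using less 3 by auto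
    show ?thesis unfolding 3 cf_q.simps by measurable
  qed simp_all
qed

lemma cf_n_measurable [measurable]: "(\<lambda>\<alpha>. cf_n R \<alpha>) \<in> measurable borel (count_space UNIV)"
  unfolding cf_n_def by measurable

lemma sets_gauss_measure: "A \<in> sets borel \<Longrightarrow> A \<subseteq> {0<..<1} \<Longrightarrow> A \<in> sets gauss_measure"
  by (auto simp: gauss_measure_def sets_restrict_space_iff)

lemma ratio_entries_event_measurable:
  fixes a b R :: real
  shows "{\<alpha> \<in> {0<..<1} - \<rat>. a < cf_q \<alpha> (cf_n R \<alpha>) / R \<and> cf_q \<alpha> (cf_n R \<alpha>) / R < b \<and>
    (\<forall>k<N. k < cf_n R \<alpha> \<and> cf_entry \<alpha> (cf_n R \<alpha> - k) = c k)} \<in> sets gauss_measure"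
proof -
  have [measurable]: "(\<rat> :: real set) \<in> sets borel"
    by (rule sets.countable[OF _ countable_rat]) simp
  have [measurable]: "(\<lambda>\<alpha>. cf_q \<alpha> (cf_n R \<alpha>)) \<in> measurable borel (count_space UNIV)"
    by (rule measurable_compose_countable[where f = "\<lambda>m \<alpha>. cf_q \<alpha> m" and g = "cf_n R"]) measurable
  have [measurable]: "(\<lambda>\<alpha>. cf_entry \<alpha> (cf_n R \<alpha> - k)) \<in> measurable borel (count_space UNIV)" for k
    by (rule measurable_compose_countable[where f = "\<lambda>m \<alpha>. cf_entry \<alpha> (m - k)" and g = "cf_n R"]) measurable
  show ?thesis
    by (rule sets_gauss_measure) (measurable, auto)
qed

lemma prob_space_gauss_measure: "prob_space gauss_measure"
proof
  have "emeasure gauss_measure (space gauss_measure) =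
      (\<integral>\<^sup>+ x. ennreal (1 / (ln 2 * (1 + x))) * indicator {0<..<1} x \<partial>lborel)"
  proof -
    have m: "(\<lambda>x. ennreal (1 / (ln 2 * (1 + x)))) \<in> borel_measurable (restrict_space lborel {0<..<1})"
      by (intro measurable_restrict_space1) measurable
    have "emeasure gauss_measure (space gauss_measure) =
        (\<integral>\<^sup>+ x. ennreal (1 / (ln 2 * (1 + x))) \<partial>restrict_space lborel {0<..<1})"
      unfolding gauss_measure_def
      by (subst emeasure_density[OF m])
         (auto simp: space_density space_restrict_space sets_restrict_space_iff
            intro!: nn_integral_cong)
    also have "\<dots> = (\<integral>\<^sup>+ x. ennreal (1 / (ln 2 * (1 + x))) * indicator {0<..<1} x \<partial>lborel)"
      by (rule nn_integral_restrict_space) simp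
    finally show ?thesis .
  qed
  also have "\<dots> = (\<integral>\<^sup>+ x. ennreal (1 / (ln 2 * (1 + x))) * indicator {0..1} x \<partial>lborel)"
    by (rule nn_integral_cong_AE)
       (use AE_lborel_singleton[of 0] AE_lborel_singleton[of 1] in eventually_elim, auto split: split_indicator)
  also have "\<dots> = ennreal (ln (1 + 1) / ln 2 - ln (1 + 0) / ln 2)"
  proof (rule nn_integral_FTC_Icc[where F = "\<lambda>x. ln (1 + x) / ln 2"])
    fix x :: real assume x: "x \<in> {0..1}"
    have "((\<lambda>x. ln (1 + x)) has_real_derivative 1 / (1 + x)) (at x)"
      using x by (auto intro!: derivative_eq_intros)
    then show "((\<lambda>x. ln (1 + x) / ln 2) has_real_derivative 1 / (ln 2 * (1 + x))) (at x)"
      using DERIV_cdivide[of "\<lambda>x. ln (1 + x)" "1 / (1 + x)" x UNIV "ln 2"] by (simp add: mult.commute)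
  qed auto
  also have "\<dots> = 1" by simp
  finally show "emeasure gauss_measure (space gauss_measure) = 1" .
qed

end

(*
If n = n_R and (d, c) = (q_{n-1}, q_n), then d <= R < c and d/c = [a_n, ..., a_1], so the event
prescribes c/R and, up to endpoints, an interval J for d/c.  For coprime d < c, the numbers alpha
with these two consecutive denominators form two intervals of length 1/(c(c+d)) that end at
+-p/c mod 1, where dp = 1 mod c.  Hence the probability is, up to O(1/R^2), a sum over c of
  (1/c^2) sum_{d in J c, d <= R, dp = 1 mod c} g(p/c) / (1 + d/c),   g(x) = rho(x) + rho(1 - x),
with rho the Gauss density.  On average over c the pairs (d/c, p/c) equidistribute in the unit
square: Kloosterman's fourth-moment estimate bounds the relevant exponential sums, and Weierstrass'
theorem and sandwiching pass from trigonometric polynomials to g and J.  The mean value of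
totient(c)/c then turns the sum over c into a Riemann sum, and the limit is an integral against the
density K/(x(1+y)) on x > 1, 0 < y < 1/x.  It has total mass 1 because P(q_n >= b R) = O(1/b)
uniformly in R, and P_N is its image under mapping y to its first N entries.
*)
theory Submission
  imports Defs "HOL-Number_Theory.Number_Theory" "HOL-Real_Asymp.Real_Asymp"
begin

section \<open>Means of arithmetic functions\<close>

text \<open>For an individual c both the number of admissible d and the position of their inverses
  fluctuate, so everything is stated in the mean over c: errors in absolute mean
  (\<open>mean_null\<close>), the main term through the mean value of totient(c)/c
  (\<open>has_mean\<close>). A saving of any fixed power of c in the exponential sums is then
  enough, as it competes only with the divisor function, whose mean is logarithmic; the elementary
  fourth moment yields such a saving. The weight g is symmetric about 1/2 and (d, p) may be
  exchanged for (c - d, c - p), so the approximation uses cosines alone. The bound d <= R reads y <=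
  R/c and moves with c; all quantities are monotone in it, so it is frozen on short ranges of c/R.
  As d/c is a reversed continued fraction, a_{n-k} becomes entry number k + 1 of the limit variable
  y. The ratio d/c is rational and may hit an endpoint of J, hence each event is squeezed between
  the open and the closed interval. The mean of totient(c)/c is obtained from a Cauchy argument
  without its value, so the total mass is taken from the tail bound and not from evaluating an
  integral.\<close>

definition mean_null :: "(nat \<Rightarrow> real) \<Rightarrow> bool"
  where "mean_null s \<longleftrightarrow> (\<lambda>n. (\<Sum>c=1..n. \<bar>s c\<bar>) / real n) \<longlonglongrightarrow> 0"

definition has_mean :: "(nat \<Rightarrow> real) \<Rightarrow> real \<Rightarrow> bool"
  where "has_mean s L \<longleftrightarrow> (\<lambda>n. (\<Sum>c=1..n. s c) / real n) \<longlonglongrightarrow> L"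

text \<open>An error of e per term costs at most e in the average. The majorant t may change with e,
  so approximations of growing quality can be used without any uniformity in their own
  decay.\<close>

lemma mean_null_approx:
  assumes "\<And>e. e > 0 \<Longrightarrow> \<exists>t. mean_null t \<and> (\<forall>c\<ge>1. \<bar>s c\<bar> \<le> \<bar>t c\<bar> + e)"
  shows "mean_null s"
  unfolding mean_null_def
proof (rule tendstoI)
  fix e :: real assume "e > 0"
  then obtain t where t: "mean_null t" "\<And>c. c \<ge> 1 \<Longrightarrow> \<bar>s c\<bar> \<le> \<bar>t c\<bar> + e / 2"
    using assms[of "e / 2"] by auto
  have "\<forall>\<^sub>F n in sequentially. (\<Sum>c=1..n. \<bar>t c\<bar>) / real n < e / 2"
    using t(1) \<open>e > 0\<close> unfolding mean_null_def by (intro order_tendstoD(2)) auto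
  then show "\<forall>\<^sub>F n in sequentially. dist ((\<Sum>c=1..n. \<bar>s c\<bar>) / real n) 0 < e"
    using eventually_gt_at_top[of 0]
  proof eventually_elim
    case (elim n)
    have "(\<Sum>c=1..n. \<bar>s c\<bar>) \<le> (\<Sum>c=1..n. \<bar>t c\<bar> + e / 2)"
      by (intro sum_mono t) auto
    also have "\<dots> = (\<Sum>c=1..n. \<bar>t c\<bar>) + real n * (e / 2)"
      by (simp add: sum.distrib)
    finally have "(\<Sum>c=1..n. \<bar>s c\<bar>) / real n \<le> (\<Sum>c=1..n. \<bar>t c\<bar>) / real n + e / 2"
      using elim by (simp add: field_simps)
    moreover have "0 \<le> (\<Sum>c=1..n. \<bar>s c\<bar>) / real n" by (intro divide_nonneg_nonneg sum_nonneg) auto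
    ultimately show ?case using elim unfolding dist_real_def by linarith
  qed
qed

lemma mean_null_mono:
  assumes "mean_null t" "\<And>c. c \<ge> 1 \<Longrightarrow> \<bar>s c\<bar> \<le> \<bar>t c\<bar>"
  shows "mean_null s"
  by (rule mean_null_approx) (use assms in \<open>force intro!: exI[of _ t]\<close>)

lemma mean_null_add:
  assumes "mean_null s" "mean_null t"
  shows "mean_null (\<lambda>c. s c + t c)"
proof -
  have "(\<lambda>n. (\<Sum>c=1..n. \<bar>s c\<bar>) / real n + (\<Sum>c=1..n. \<bar>t c\<bar>) / real n) \<longlonglongrightarrow> 0 + 0"
    using assms unfolding mean_null_def by (rule tendsto_add)
  then have "mean_null (\<lambda>c. \<bar>s c\<bar> + \<bar>t c\<bar>)"
    by (simp add: mean_null_def add_divide_distrib sum.distrib)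
  then show ?thesis by (rule mean_null_mono) auto
qed

lemma mean_null_cmult:
  assumes "mean_null s"
  shows "mean_null (\<lambda>c. k * s c)"
  using tendsto_mult_left[OF assms[unfolded mean_null_def], of "\<bar>k\<bar>"]
  by (simp add: mean_null_def abs_mult flip: sum_distrib_left)

lemma mean_null_tendsto_0:
  assumes "s \<longlonglongrightarrow> 0"
  shows "mean_null s"
proof (rule mean_null_approx)
  fix e :: real assume "e > 0"
  then have "\<forall>\<^sub>F c in sequentially. \<bar>s c\<bar> < e"
    using assms by (auto simp: tendsto_iff)
  then obtain N where N: "\<And>c. c \<ge> N \<Longrightarrow> \<bar>s c\<bar> < e" by (auto simp: eventually_sequentially)
  define t where "t c = (if c < N then s c else 0)" for c
  have "mean_null t"
    unfolding mean_null_def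
  proof (rule tendsto_sandwich[OF _ _ tendsto_const])
    show "\<forall>\<^sub>F n in sequentially. (\<Sum>c=1..n. \<bar>t c\<bar>) / real n \<le> (\<Sum>c<N. \<bar>s c\<bar>) * (1 / real n)"
    proof (rule always_eventually, rule allI)
      fix n
      have "(\<Sum>c=1..n. \<bar>t c\<bar>) = (\<Sum>c\<in>{1..n} \<inter> {..<N}. \<bar>t c\<bar>)"
        by (intro sum.mono_neutral_right) (auto simp: t_def)
      also have "\<dots> = (\<Sum>c\<in>{1..n} \<inter> {..<N}. \<bar>s c\<bar>)"
        by (intro sum.cong) (auto simp: t_def)
      also have "\<dots> \<le> (\<Sum>c<N. \<bar>s c\<bar>)" by (intro sum_mono2) auto
      finally show "(\<Sum>c=1..n. \<bar>t c\<bar>) / real n \<le> (\<Sum>c<N. \<bar>s c\<bar>) * (1 / real n)"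
        by (simp add: divide_right_mono)
    qed
    show "(\<lambda>n. (\<Sum>c<N. \<bar>s c\<bar>) * (1 / real n)) \<longlonglongrightarrow> 0"
      using tendsto_mult_left[OF lim_1_over_n] by simp
  qed (auto intro!: always_eventually divide_nonneg_nonneg sum_nonneg)
  moreover have "\<bar>s c\<bar> \<le> \<bar>t c\<bar> + e" for c
    using N[of c] \<open>e > 0\<close> by (auto simp: t_def)
  ultimately show "\<exists>t. mean_null t \<and> (\<forall>c\<ge>1. \<bar>s c\<bar> \<le> \<bar>t c\<bar> + e)" by blast
qed

lemma has_mean_mean_null:
  assumes "has_mean t L" "mean_null (\<lambda>c. s c - t c)"
  shows "has_mean s L"
proof -
  have "(\<lambda>n. (\<Sum>c=1..n. s c - t c) / real n) \<longlonglongrightarrow> 0"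
    by (rule Lim_null_comparison[OF _ assms(2)[unfolded mean_null_def]])
       (auto intro!: always_eventually divide_right_mono simp: abs_divide)
  then have "(\<lambda>n. (\<Sum>c=1..n. s c - t c) / real n + (\<Sum>c=1..n. t c) / real n) \<longlonglongrightarrow> 0 + L"
    using assms(1) unfolding has_mean_def by (rule tendsto_add)
  then show ?thesis
    by (simp add: has_mean_def sum_subtractf flip: add_divide_distrib)
qed

lemma has_mean_cmult:
  assumes "has_mean s L"
  shows "has_mean (\<lambda>c. k * s c) (k * L)"
  using tendsto_mult_left[OF assms[unfolded has_mean_def], of k]
  by (simp add: has_mean_def flip: sum_distrib_left)

text \<open>The means L of the approximants are not assumed to converge. The averages of s stay
  close to convergent ones and are therefore Cauchy, which gives existence without a formula for the
  value.\<close>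

lemma has_mean_approx:
  assumes "\<And>e. e > 0 \<Longrightarrow> \<exists>t L. has_mean t L \<and>
      (\<forall>n\<ge>1. \<bar>(\<Sum>c=1..n. s c) - (\<Sum>c=1..n. t c)\<bar> \<le> e * real n)"
  shows "\<exists>L. has_mean s L"
proof -
  define S where "S n = (\<Sum>c=1..n. s c) / real n" for n
  have "Cauchy S"
  proof (rule CauchyI)
    fix e :: real assume e: "e > 0"
    then obtain t L where t: "has_mean t L"
      "\<And>n. n \<ge> 1 \<Longrightarrow> \<bar>(\<Sum>c=1..n. s c) - (\<Sum>c=1..n. t c)\<bar> \<le> (e / 4) * real n"
      using assms[of "e / 4"] by auto
    have "\<forall>\<^sub>F n in sequentially. dist ((\<Sum>c=1..n. t c) / real n) L < e / 4"
      using t(1) e unfolding has_mean_def by (intro tendstoD) auto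
    then obtain N where N: "\<And>n. n \<ge> N \<Longrightarrow> dist ((\<Sum>c=1..n. t c) / real n) L < e / 4"
      by (auto simp: eventually_sequentially)
    have near: "\<bar>S n - L\<bar> < e / 2" if "n \<ge> max N 1" for n
    proof -
      have "\<bar>S n - (\<Sum>c=1..n. t c) / real n\<bar> = \<bar>(\<Sum>c=1..n. s c) - (\<Sum>c=1..n. t c)\<bar> / real n"
        by (simp add: S_def flip: diff_divide_distrib)
      also have "\<dots> \<le> e / 4" using t(2)[of n] that by (simp add: field_simps)
      finally show ?thesis using N[of n] that unfolding dist_real_def by linarith
    qed
    have "norm (S m - S n) < e" if "m \<ge> max N 1" "n \<ge> max N 1" for m n
      using near[OF that(1)] near[OF that(2)] unfolding real_norm_def by linarith
    then show "\<exists>M. \<forall>m\<ge>M. \<forall>n\<ge>M. norm (S m - S n) < e" by blast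
  qed
  then obtain L where "S \<longlonglongrightarrow> L" using Cauchy_convergent convergent_def by blast
  then show ?thesis unfolding has_mean_def S_def by blast
qed

text \<open>Subtracting the linear trend from the partial sums leaves a function of period y, hence
  a bounded one, which disappears after division by n.\<close>

lemma has_mean_periodic:
  fixes f :: "nat \<Rightarrow> real"
  assumes per: "\<And>n. f (n + y) = f n" and y: "y > 0" and bd: "\<And>n. \<bar>f n\<bar> \<le> 1"
  shows "has_mean f ((\<Sum>c=1..y. f c) / real y)"
proof -
  define A where "A = (\<Sum>c=1..y. f c)"
  define E where "E n = (\<Sum>c=1..n. f c) - real n * (A / real y)" for n
  have shift: "(\<Sum>c=1..n+y. f c) = (\<Sum>c=1..n. f c) + A" for n
  proof (induction n)
    case (Suc n)
    have "(\<Sum>c=1..Suc n + y. f c) = (\<Sum>c=1..n + y. f c) + f (Suc n + y)" by simp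
    then show ?case using Suc per[of "Suc n"] by simp
  qed (simp add: A_def)
  have Eper: "E (n + y) = E n" for n
    using shift[of n] y by (simp add: E_def field_simps)
  have Emod: "E n = E (n mod y)" for n
  proof -
    have "E (m + k * y) = E m" for m k
    proof (induction k)
      case (Suc k)
      show ?case using Eper[of "m + k * y"] Suc by (simp add: algebra_simps)
    qed simp
    from this[of "n mod y" "n div y"] show ?thesis by simp
  qed
  define B where "B = Max ((\<lambda>n. \<bar>E n\<bar>) ` {..<y})"
  have B: "\<bar>E n\<bar> \<le> B" for n
    unfolding Emod[of n] B_def using y by (intro Max_ge) auto
  have "(\<lambda>n. E n / real n) \<longlonglongrightarrow> 0"
  proof (rule Lim_null_comparison)
    show "\<forall>\<^sub>F n in sequentially. norm (E n / real n) \<le> B * (1 / real n)"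
      using B by (auto intro!: always_eventually divide_right_mono simp: abs_divide)
    show "(\<lambda>n. B * (1 / real n)) \<longlonglongrightarrow> 0"
      using tendsto_mult_left[OF lim_1_over_n] by simp
  qed
  then have "(\<lambda>n. E n / real n + A / real y) \<longlonglongrightarrow> 0 + A / real y" by (intro tendsto_intros)
  moreover have "\<forall>\<^sub>F n in sequentially. E n / real n + A / real y = (\<Sum>c=1..n. f c) / real n"
    using eventually_gt_at_top[of 0] by eventually_elim (simp add: E_def field_simps)
  ultimately show ?thesis unfolding has_mean_def A_def[symmetric]
    using Lim_transform_eventually by fastforce
qed

lemma card_multiples_le:
  assumes "e > 0"
  shows "real (card {c. c \<in> {1..n} \<and> e dvd c}) \<le> real n / real e"
proof -
  have "{c. c \<in> {1..n} \<and> e dvd c} \<subseteq> (\<lambda>k. e * k) ` {1..n div e}"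
  proof
    fix c assume "c \<in> {c. c \<in> {1..n} \<and> e dvd c}"
    then obtain k where k: "c = e * k" "1 \<le> c" "c \<le> n" by auto
    then have "k \<in> {1..n div e}" using assms
      by (auto simp: less_eq_div_iff_mult_less_eq mult.commute intro!: Suc_leI)
    then show "c \<in> (\<lambda>k. e * k) ` {1..n div e}" using k by auto
  qed
  then have "card {c. c \<in> {1..n} \<and> e dvd c} \<le> n div e"
    using surj_card_le[of "{1..n div e}"] by fastforce
  then show ?thesis
    using of_nat_div_le_of_nat[where ?'a = real, of n e] by linarith
qed

text \<open>Telescoping: 1/(n + 1)^2 is at most 1/n - 1/(n + 1).\<close>

lemma sum_inverse_squares_le:
  assumes "y \<ge> 1"
  shows "(\<Sum>p=Suc y..n. 1 / real p ^ 2) \<le> 1 / real y"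
proof -
  have "(\<Sum>p=Suc y..n. 1 / real p ^ 2) \<le> 1 / real y - 1 / real n" if "n \<ge> y"
    using that
  proof (induction n rule: dec_induct)
    case (step n)
    have "1 / real (Suc n) ^ 2 \<le> 1 / (real n * real (Suc n))"
      using step assms by (intro divide_left_mono) (auto simp: power2_eq_square)
    also have "\<dots> = 1 / real n - 1 / real (Suc n)"
      using step assms by (simp add: field_simps)
    finally show ?case using step by simp
  qed simp
  then show ?thesis
    by (cases "n \<ge> y") (use assms in \<open>force simp: not_le intro: order_trans\<close>)+
qed

text \<open>
  Truncating the Euler product of \<open>\<phi>(c)/c\<close> at the primes up to \<open>y\<close> gives a function of period
  \<open>y!\<close> that is close to \<open>\<phi>(c)/c\<close> in the mean.
\<close>
lemma totient_ratio_has_mean: "\<exists>L. has_mean (\<lambda>c. real (totient c) / real c) L"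
proof (rule has_mean_approx)
  fix e :: real assume e: "e > 0"
  obtain y :: nat where y: "y \<ge> 1" "1 / real y \<le> e"
  proof -
    obtain y :: nat where "y > 0" "inverse (real y) < e"
      using ex_inverse_of_nat_less[OF e] by blast
    then show ?thesis using that[of y] by (auto simp: inverse_eq_divide)
  qed
  define t where "t c = (\<Prod>p | prime p \<and> p \<le> y \<and> p dvd c. 1 - 1 / real p)" for c :: nat
  define r where "r c = (\<Sum>p | prime p \<and> y < p \<and> p \<le> c \<and> p dvd c. 1 / real p)" for c :: nat
  have fac01: "0 \<le> 1 - 1 / real p \<and> 1 - 1 / real p \<le> 1" for p by (cases p) auto
  have mean: "has_mean t ((\<Sum>c=1..fact y. t c) / real (fact y))"
  proof (rule has_mean_periodic)
    fix n
    have "{p. prime p \<and> p \<le> y \<and> p dvd n + fact y} = {p. prime p \<and> p \<le> y \<and> p dvd n}"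
      using prime_gt_0_nat by (auto simp: dvd_add_left_iff dvd_fact Suc_le_eq)
    then show "t (n + fact y) = t n" by (simp add: t_def)
    show "\<bar>t n\<bar> \<le> 1" using fac01 unfolding t_def
      by (subst abs_of_nonneg) (auto intro!: prod_nonneg prod_le_1)
  qed simp
  \<comment> \<open>The primes above y contribute a factor between 1 - r c and 1, by Weierstrass'
    product inequality. Since t c is at most 1, dropping this factor changes the value by at most r
    c.\<close>
  have diff: "real (totient c) / real c \<le> t c \<and> t c \<le> real (totient c) / real c + r c" if c: "c \<ge> 1" for c
  proof -
    define A where "A = {p. prime p \<and> p \<le> y \<and> p dvd c}"
    define B where "B = {p. prime p \<and> y < p \<and> p \<le> c \<and> p dvd c}"
    have fin: "finite A" "finite B" by (auto simp: A_def B_def)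
    have AB: "prime_factors c = A \<union> B" "A \<inter> B = {}"
      using c by (auto simp: A_def B_def prime_factors_dvd dest: dvd_imp_le)
    have tot: "real (totient c) / real c = (\<Prod>p\<in>prime_factors c. 1 - 1 / real p)"
      using c totient_formula2[of c] by simp
    also have "\<dots> = t c * (\<Prod>p\<in>B. 1 - 1 / real p)"
      unfolding AB(1) using fin AB(2) by (simp add: prod.union_disjoint t_def A_def)
    finally have eq: "real (totient c) / real c = t c * (\<Prod>p\<in>B. 1 - 1 / real p)" .
    have t01: "0 \<le> t c" "t c \<le> 1" using fac01 unfolding t_def by (auto intro!: prod_nonneg prod_le_1)
    have P1: "(\<Prod>p\<in>B. 1 - 1 / real p) \<le> 1" using fac01 by (intro prod_le_1) auto
    have P2: "1 - (\<Sum>p\<in>B. 1 / real p) \<le> (\<Prod>p\<in>B. 1 - 1 / real p)"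
      using Weierstrass_prod_ineq[of B "\<lambda>p. 1 / real p"] by (auto simp: field_simps prime_gt_0_nat B_def Suc_le_eq)
    have rB: "r c = (\<Sum>p\<in>B. 1 / real p)" "0 \<le> r c" by (auto simp: r_def B_def intro!: sum_nonneg)
    have "t c * (1 - r c) \<le> t c * (\<Prod>p\<in>B. 1 - 1 / real p)"
      using P2 t01 rB by (intro mult_left_mono) auto
    moreover have "t c * r c \<le> r c" using t01 rB by (intro mult_left_le_one_le) auto
    moreover have "t c * (\<Prod>p\<in>B. 1 - 1 / real p) \<le> t c" using P1 t01 by (intro mult_left_le) auto
    ultimately show ?thesis unfolding eq by (auto simp: algebra_simps)
  qed
  have "\<bar>(\<Sum>c=1..n. real (totient c) / real c) - (\<Sum>c=1..n. t c)\<bar> \<le> e * real n" for n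
  proof -
    have "(\<Sum>c=1..n. real (totient c) / real c) \<le> (\<Sum>c=1..n. t c)"
      using diff by (intro sum_mono) auto
    moreover have "(\<Sum>c=1..n. t c) \<le> (\<Sum>c=1..n. real (totient c) / real c) + (\<Sum>c=1..n. r c)"
      unfolding sum.distrib[symmetric] using diff by (intro sum_mono) auto
    \<comment> \<open>A prime p divides at most n/p of the c and so contributes at most n/p^2; the
      sum of these over p > y is at most n/y.\<close>
    moreover have "(\<Sum>c=1..n. r c) \<le> e * real n"
    proof -
      have "(\<Sum>c=1..n. r c) \<le> (\<Sum>c=1..n. \<Sum>p | p \<in> {Suc y..n} \<and> p dvd c. 1 / real p)"
        unfolding r_def by (intro sum_mono sum_mono2) auto
      also have "\<dots> = (\<Sum>p=Suc y..n. \<Sum>c | c \<in> {1..n} \<and> p dvd c. 1 / real p)"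
        by (rule sum.swap_restrict) auto
      also have "\<dots> \<le> (\<Sum>p=Suc y..n. real n * (1 / real p ^ 2))"
      proof (rule sum_mono)
        fix p assume p: "p \<in> {Suc y..n}"
        from p have "real (card {c. c \<in> {1..n} \<and> p dvd c}) \<le> real n / real p"
          by (intro card_multiples_le) simp
        then have "real (card {c. c \<in> {1..n} \<and> p dvd c}) * (1 / real p) \<le> real n / real p * (1 / real p)"
          by (intro mult_right_mono) auto
        then show "(\<Sum>c | c \<in> {1..n} \<and> p dvd c. 1 / real p) \<le> real n * (1 / real p ^ 2)"
          by (simp add: power2_eq_square)
      qed
      also have "\<dots> = real n * (\<Sum>p=Suc y..n. 1 / real p ^ 2)" by (simp add: sum_distrib_left)
      also have "\<dots> \<le> real n * e"
        using sum_inverse_squares_le[OF y(1), of n] y(2) by (intro mult_left_mono) auto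
      finally show ?thesis by (simp add: mult.commute)
    qed
    ultimately show ?thesis by auto
  qed
  with mean show "\<exists>t L. has_mean t L \<and>
      (\<forall>n\<ge>1. \<bar>(\<Sum>c=1..n. real (totient c) / real c) - (\<Sum>c=1..n. t c)\<bar> \<le> e * real n)" by blast
qed

section \<open>Kloosterman sums\<close>

text \<open>A unit is stored together with its inverse: the two coordinates play symmetric roles
  below, and no inversion function modulo c has to be chosen.\<close>

definition unit_pairs :: "nat \<Rightarrow> (int \<times> int) set"
  where "unit_pairs c = {(d, p). d \<in> {0..<int c} \<and> p \<in> {0..<int c} \<and> [d * p = 1] (mod int c)}"

lemma finite_unit_pairs [simp]: "finite (unit_pairs c)"
  by (rule finite_subset[of _ "{0..<int c} \<times> {0..<int c}"]) (auto simp: unit_pairs_def)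

lemma unit_pairs_swap: "(d, p) \<in> unit_pairs c \<longleftrightarrow> (p, d) \<in> unit_pairs c"
  by (auto simp: unit_pairs_def mult.commute)

lemma unit_pairs_unique:
  assumes "(d, p) \<in> unit_pairs c" "(d, p') \<in> unit_pairs c"
  shows "p = p'"
proof -
  have "[p * (d * p') = p * 1] (mod int c)" "[p' * (d * p) = p' * 1] (mod int c)"
    using assms by (intro cong_mult cong_refl; simp add: unit_pairs_def)+
  then have "[p = p'] (mod int c)"
    by (metis cong_sym cong_trans mult.commute mult.left_commute mult.right_neutral)
  then show ?thesis using assms by (intro cong_less_imp_eq_int[of p "int c" p']) (auto simp: unit_pairs_def)
qed

lemma card_unit_pairs:
  assumes "c \<ge> 2"
  shows "card (unit_pairs c) = totient c"
proof -
  have "bij_betw (\<lambda>z. nat (fst z)) (unit_pairs c) (totatives c)"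
  proof (rule bij_betwI')
    fix z w assume "z \<in> unit_pairs c" "w \<in> unit_pairs c"
    then show "(nat (fst z) = nat (fst w)) = (z = w)"
      using unit_pairs_unique by (cases z; cases w) (auto simp: unit_pairs_def nat_eq_iff)
  next
    fix z assume z: "z \<in> unit_pairs c"
    obtain d p where [simp]: "z = (d, p)" by (cases z)
    have dp: "0 \<le> d" "d < int c" "[d * p = 1] (mod int c)" using z by (auto simp: unit_pairs_def)
    then have "coprime d (int c)" by (auto simp: coprime_iff_invertible_int)
    moreover from this have "d \<noteq> 0" using assms by auto
    ultimately show "nat (fst z) \<in> totatives c"
      using dp by (auto simp: in_totatives_iff nat_le_iff)
        (metis coprime_int_iff nat_0_le)
  next
    fix d assume "d \<in> totatives c"
    then have d: "0 < d" "d < c" "coprime (int d) (int c)"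
      using assms totatives_less[of d c] by (auto simp: in_totatives_iff)
    then obtain p where p: "[int d * p = 1] (mod int c)" by (auto simp: coprime_iff_invertible_int)
    then have "[int d * (p mod int c) = 1] (mod int c)"
      by (simp add: cong_def mod_mult_right_eq)
    then have "(int d, p mod int c) \<in> unit_pairs c"
      using d assms by (auto simp: unit_pairs_def)
    then show "\<exists>z\<in>unit_pairs c. d = nat (fst z)" by force
  qed
  then show ?thesis by (simp add: bij_betw_same_card totient_def)
qed

text \<open>The additive character usually written e(x).\<close>

definition cis2pi :: "real \<Rightarrow> complex" where "cis2pi x = cis (2 * pi * x)"

lemma cis2pi_add: "cis2pi (x + y) = cis2pi x * cis2pi y"
  by (simp add: cis2pi_def cis_mult distrib_left)

lemma cis2pi_int: "cis2pi (of_int n) = 1"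
  by (simp add: cis2pi_def complex_eq_iff)

lemma cis2pi_eq_1_imp: 
  assumes "cis2pi x = 1" obtains n :: int where "x = of_int n"
proof -
  have "cos (2 * pi * x) = 1" using assms by (simp add: cis2pi_def complex_eq_iff)
  then obtain n :: int where "2 * pi * x = of_int n * 2 * pi" by (auto simp: cos_one_2pi_int)
  then have "x = of_int n" by simp
  then show ?thesis by (rule that)
qed

lemma cnj_cis2pi: "cnj (cis2pi x) = cis2pi (- x)"
  by (simp add: cis2pi_def cis_cnj)

lemma norm_cis2pi [simp]: "norm (cis2pi x) = 1"
  by (simp add: cis2pi_def)

lemma cis2pi_cong:
  assumes "[a = b] (mod int c)" "c > 0"
  shows "cis2pi (of_int a / real c) = cis2pi (of_int b / real c)"
proof -
  obtain k where k: "a = b + int c * k" using cong_sym[OF assms(1)] unfolding cong_iff_lin by blast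
  have "of_int a / real c = of_int b / real c + of_int k" using assms(2) by (simp add: k field_simps)
  then show ?thesis by (simp add: cis2pi_add cis2pi_int)
qed

text \<open>Orthogonality of additive characters: the terms are the powers of a c-th root of unity,
  which is 1 exactly when c divides a.\<close>

lemma sum_cis2pi:
  assumes "c > 0"
  shows "(\<Sum>m\<in>{0..<int c}. cis2pi (of_int (m * a) / real c)) = (if int c dvd a then of_nat c else 0)"
proof -
  define z where "z = cis2pi (of_int a / real c)"
  have z: "cis2pi (of_int (int m * a) / real c) = z ^ m" for m
  proof (induction m)
    case (Suc m)
    have "of_int (int (Suc m) * a) / real c = of_int a / real c + of_int (int m * a) / real c"
      by (simp add: distrib_right distrib_left add_divide_distrib)
    then show ?case using Suc by (simp add: cis2pi_add z_def)
  qed (simp add: cis2pi_def)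
  have zc: "z ^ c = 1"
    using assms cis2pi_int[of a] by (simp flip: z)
  have "(\<Sum>m\<in>{0..<int c}. cis2pi (of_int (m * a) / real c)) = (\<Sum>m<c. z ^ m)"
    unfolding z[symmetric]
    by (rule sum.reindex_bij_witness[of _ int nat]) auto
  also have "\<dots> = (if int c dvd a then of_nat c else 0)"
  proof (cases "int c dvd a")
    case True
    then obtain k where "a = int c * k" by auto
    then have "z = 1" using assms cis2pi_int[of k] by (simp add: z_def)
    then show ?thesis using True by simp
  next
    case False
    have "z \<noteq> 1"
    proof
      assume "z = 1"
      then obtain k :: int where "of_int a / real c = of_int k"
        unfolding z_def by (rule cis2pi_eq_1_imp)
      then have "real_of_int a = real_of_int (int c * k)" using assms by (simp add: field_simps)
      then have "a = int c * k" by linarith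
      then show False using False by simp
    qed
    then show ?thesis using False zc by (simp add: geometric_sum)
  qed
  finally show ?thesis .
qed

definition kloosterman :: "int \<Rightarrow> int \<Rightarrow> nat \<Rightarrow> complex"
  where "kloosterman h k c = (\<Sum>z\<in>unit_pairs c. cis2pi (of_int (h * fst z + k * snd z) / real c))"

lemma kloosterman_swap: "kloosterman h k c = kloosterman k h c"
  unfolding kloosterman_def
  by (rule sum.reindex_bij_witness[of _ prod.swap prod.swap])
     (auto simp: unit_pairs_swap add.commute)

lemma kloosterman_cong:
  assumes "[h = h'] (mod int c)" "[k = k'] (mod int c)" "c > 0"
  shows "kloosterman h k c = kloosterman h' k' c"
  unfolding kloosterman_def
  by (intro sum.cong refl cis2pi_cong cong_add cong_mult assms) auto

text \<open>Because u v = 1 modulo c, multiplying the coordinates by u and by v permutes the unit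
  pairs. This supplies the many equal values of the sum that make a moment bound useful for a single
  one.\<close>

lemma kloosterman_mult:
  assumes "(u, v) \<in> unit_pairs c" "c > 0"
  shows "kloosterman h k c = kloosterman (h * u) (k * v) c"
proof -
  have uv: "[u * v = 1] (mod int c)" using assms by (simp add: unit_pairs_def)
  have mem: "((a * d) mod int c, (b * p) mod int c) \<in> unit_pairs c"
    if "(d, p) \<in> unit_pairs c" "[a * b = 1] (mod int c)" for a b d p
  proof -
    have "[(a * b) * (d * p) = 1 * 1] (mod int c)"
      using that by (intro cong_mult) (auto simp: unit_pairs_def)
    then have "[(a * d) * (b * p) = 1] (mod int c)" by (simp add: mult_ac)
    then show ?thesis using assms by (simp add: unit_pairs_def cong_def mod_mult_eq)
  qed
  have inv: "(a * ((b * d) mod int c)) mod int c = d"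
    if "[a * b = 1] (mod int c)" "0 \<le> d" "d < int c" for a b d
  proof -
    have "[(a * b) * d = 1 * d] (mod int c)" using that by (intro cong_mult) auto
    then show ?thesis using that by (simp add: mod_mult_right_eq cong_def mult.assoc)
  qed
  have vu: "[v * u = 1] (mod int c)" using uv by (simp add: mult.commute)
  show ?thesis
    unfolding kloosterman_def
  proof (rule sum.reindex_bij_witness[of _
      "\<lambda>z. ((u * fst z) mod int c, (v * snd z) mod int c)" "\<lambda>z. ((v * fst z) mod int c, (u * snd z) mod int c)"])
    fix z assume z: "z \<in> unit_pairs c"
    then have zr: "0 \<le> fst z" "fst z < int c" "0 \<le> snd z" "snd z < int c" "(fst z, snd z) \<in> unit_pairs c"
      by (auto simp: unit_pairs_def)
    show "((u * fst ((v * fst z) mod int c, (u * snd z) mod int c)) mod int c,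
        (v * snd ((v * fst z) mod int c, (u * snd z) mod int c)) mod int c) = z"
      using inv[OF uv] inv[OF vu] zr by (auto simp: prod_eq_iff)
    show "((v * fst z) mod int c, (u * snd z) mod int c) \<in> unit_pairs c" using mem[OF zr(5) vu] .
    show "((v * fst ((u * fst z) mod int c, (v * snd z) mod int c)) mod int c,
        (u * snd ((u * fst z) mod int c, (v * snd z) mod int c)) mod int c) = z"
      using inv[OF uv] inv[OF vu] zr by (auto simp: prod_eq_iff)
    show "((u * fst z) mod int c, (v * snd z) mod int c) \<in> unit_pairs c" using mem[OF zr(5) uv] .
    have "[h * u * (v * fst z) + k * v * (u * snd z) = h * (1 * fst z) + k * (1 * snd z)] (mod int c)"
    proof (rule cong_add)
      have "[h * ((u * v) * fst z) = h * (1 * fst z)] (mod int c)"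
        by (intro cong_mult cong_refl uv)
      then show "[h * u * (v * fst z) = h * (1 * fst z)] (mod int c)" by (simp add: mult_ac)
      have "[k * ((u * v) * snd z) = k * (1 * snd z)] (mod int c)"
        by (intro cong_mult cong_refl uv)
      then show "[k * v * (u * snd z) = k * (1 * snd z)] (mod int c)" by (simp add: mult_ac)
    qed
    then have "[h * u * ((v * fst z) mod int c) + k * v * ((u * snd z) mod int c) = h * fst z + k * snd z] (mod int c)"
      by (simp add: cong_def) (metis (no_types, opaque_lifting) mod_add_eq mod_mult_right_eq)
    then show "cis2pi (of_int (h * u * fst ((v * fst z) mod int c, (u * snd z) mod int c) +
        k * v * snd ((v * fst z) mod int c, (u * snd z) mod int c)) / real c) =
        cis2pi (of_int (h * fst z + k * snd z) / real c)"
      unfolding fst_conv snd_conv using assms(2) by (rule cis2pi_cong)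
  qed
qed

type_synonym int_pair = "int \<times> int"

text \<open>The solutions of z1 + z2 = w1 + w2 modulo c in both coordinates: these are the terms of
  |K|^4 that survive the summation over all frequencies.\<close>

definition kloosterman_quads :: "nat \<Rightarrow> (int_pair \<times> int_pair \<times> int_pair \<times> int_pair) set" where
  "kloosterman_quads c = {(z1, z2, w1, w2). z1 \<in> unit_pairs c \<and> z2 \<in> unit_pairs c \<and> w1 \<in> unit_pairs c \<and> w2 \<in> unit_pairs c \<and>
     int c dvd fst z1 + fst z2 - fst w1 - fst w2 \<and> int c dvd snd z1 + snd z2 - snd w1 - snd w2}"

lemma sum_times_sum:
  fixes f g :: "_ \<Rightarrow> 'a :: semiring_0"
  shows "sum f A * sum g B = (\<Sum>p\<in>A \<times> B. f (fst p) * g (snd p))"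
  by (simp add: sum_product sum.cartesian_product case_prod_unfold)

text \<open>Expand |K|^4 as two copies of K times two copies of its conjugate. The sums over m and n
  then detect one congruence each, with weight c.\<close>

lemma kloosterman_fourth_moment:
  assumes c: "c > 0"
  shows "(\<Sum>m\<in>{0..<int c}. \<Sum>n\<in>{0..<int c}. cmod (kloosterman m n c) ^ 4) = real c ^ 2 * real (card (kloosterman_quads c))"
proof -
  define U where "U = unit_pairs c"
  define Q where "Q = U \<times> U \<times> U \<times> U"
  define A where "A = (\<lambda>(z1 :: int_pair, z2 :: int_pair, w1 :: int_pair, w2 :: int_pair). fst z1 + fst z2 - fst w1 - fst w2)"
  define B where "B = (\<lambda>(z1 :: int_pair, z2 :: int_pair, w1 :: int_pair, w2 :: int_pair). snd z1 + snd z2 - snd w1 - snd w2)"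
  have finQ: "finite Q" by (simp add: Q_def U_def)
  have K4: "of_real (cmod (kloosterman m n c) ^ 4) =
      (\<Sum>q\<in>Q. cis2pi (of_int (m * A q) / real c) * cis2pi (of_int (n * B q) / real c))" for m n
  proof -
    define f where "f z = cis2pi (of_int (m * fst z + n * snd z) / real c)" for z :: int_pair
    define g where "g z = cis2pi (- (of_int (m * fst z + n * snd z) / real c))" for z :: int_pair
    have K: "kloosterman m n c = (\<Sum>z\<in>U. f z)" "cnj (kloosterman m n c) = (\<Sum>z\<in>U. g z)"
      by (simp_all add: kloosterman_def U_def f_def g_def cnj_cis2pi)
    have "complex_of_real (cmod (kloosterman m n c) ^ 4) = (of_real ((cmod (kloosterman m n c))\<^sup>2))\<^sup>2"
      by (simp flip: power_mult)
    also have "\<dots> = kloosterman m n c * (kloosterman m n c * (cnj (kloosterman m n c) * cnj (kloosterman m n c)))"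
      unfolding complex_norm_square by (simp add: power2_eq_square mult_ac)
    also have "\<dots> = (\<Sum>(z1, z2, w1, w2)\<in>Q. f z1 * (f z2 * (g w1 * g w2)))"
      unfolding K(2) unfolding K(1) Q_def
      by (simp only: sum_times_sum case_prod_unfold fst_conv snd_conv)
    also have "\<dots> = (\<Sum>q\<in>Q. cis2pi (of_int (m * A q) / real c) * cis2pi (of_int (n * B q) / real c))"
    proof (intro sum.cong refl)
      fix q assume "q \<in> Q"
      obtain z1 z2 w1 w2 where [simp]: "q = (z1, z2, w1, w2)" by (metis prod_cases4)
      show "(case q of (z1, z2, w1, w2) \<Rightarrow> f z1 * (f z2 * (g w1 * g w2))) =
          cis2pi (of_int (m * A q) / real c) * cis2pi (of_int (n * B q) / real c)"
        unfolding f_def g_def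
        by (simp add: A_def B_def flip: cis2pi_add)
           (rule arg_cong[of _ _ cis2pi], simp add: field_simps c)
    qed
    finally show ?thesis .
  qed
  have "complex_of_real (\<Sum>m\<in>{0..<int c}. \<Sum>n\<in>{0..<int c}. cmod (kloosterman m n c) ^ 4) =
      (\<Sum>m\<in>{0..<int c}. \<Sum>n\<in>{0..<int c}. \<Sum>q\<in>Q. cis2pi (of_int (m * A q) / real c) * cis2pi (of_int (n * B q) / real c))"
    unfolding of_real_sum by (intro sum.cong refl) (rule K4)
  also have "\<dots> = (\<Sum>m\<in>{0..<int c}. \<Sum>q\<in>Q. \<Sum>n\<in>{0..<int c}. cis2pi (of_int (m * A q) / real c) * cis2pi (of_int (n * B q) / real c))"
    by (intro sum.cong refl sum.swap)
  also have "\<dots> = (\<Sum>q\<in>Q. \<Sum>m\<in>{0..<int c}. \<Sum>n\<in>{0..<int c}. cis2pi (of_int (m * A q) / real c) * cis2pi (of_int (n * B q) / real c))"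
    by (rule sum.swap)
  also have "\<dots> = (\<Sum>q\<in>Q. (if int c dvd A q then of_nat c else 0) * (if int c dvd B q then of_nat c else 0))"
    by (intro sum.cong refl) (simp only: sum_cis2pi[OF c] sum_product[symmetric])
  also have "\<dots> = (\<Sum>q\<in>Q. if int c dvd A q \<and> int c dvd B q then of_nat c ^ 2 else 0)"
    by (intro sum.cong refl) (auto simp: power2_eq_square)
  also have "\<dots> = (\<Sum>q\<in>{q\<in>Q. int c dvd A q \<and> int c dvd B q}. of_nat c ^ 2)"
    by (rule sum.inter_filter[OF finQ, symmetric])
  also have "{q\<in>Q. int c dvd A q \<and> int c dvd B q} = kloosterman_quads c"
    by (auto simp: Q_def U_def A_def B_def kloosterman_quads_def)
  finally have "complex_of_real (\<Sum>m\<in>{0..<int c}. \<Sum>n\<in>{0..<int c}. cmod (kloosterman m n c) ^ 4) =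
      complex_of_real (real c ^ 2 * real (card (kloosterman_quads c)))" by (simp add: mult.commute)
  then show ?thesis by (simp only: of_real_eq_iff)
qed

lemma finite_int_filter: "finite {y\<in>{0..<N :: int}. P y}"
  by (rule finite_subset[of _ "{0..<N}"]) auto

lemma card_cong_le:
  fixes s c :: int and e :: nat
  assumes "c > 0"
  shows "card {y\<in>{0..<int e * c}. [y = s] (mod c)} \<le> e"
proof -
  have inj: "inj_on (\<lambda>y. y div c) {y\<in>{0..<int e * c}. [y = s] (mod c)}"
    by (rule inj_onI) (auto simp: cong_def, metis mult_div_mod_eq)
  have "(\<lambda>y. y div c) ` {y\<in>{0..<int e * c}. [y = s] (mod c)} \<subseteq> {0..<int e}"
  proof (rule image_subsetI)
    fix y assume "y \<in> {y\<in>{0..<int e * c}. [y = s] (mod c)}"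
    then have y: "0 \<le> y" "y < int e * c" by auto
    have "y div c * c \<le> y" using minus_mod_eq_div_mult[of y c] pos_mod_sign[OF assms, of y] by linarith
    then have "y div c * c < int e * c" using y by linarith
    then have "y div c < int e" using assms by simp
    then show "y div c \<in> {0..<int e}" using y assms by (simp add: pos_imp_zdiv_nonneg_iff)
  qed
  then have "card ((\<lambda>y. y div c) ` {y\<in>{0..<int e * c}. [y = s] (mod c)}) \<le> card {0..<int e}"
    by (intro card_mono) auto
  then show ?thesis unfolding card_image[OF inj] by simp
qed

text \<open>With e = gcd(m, c), the condition means that c/e divides 2x - s. As 2 may fail to be
  invertible modulo c/e, the values y = 2x are counted instead, in a range of 2e periods; hence the
  factor 2.\<close>

lemma card_double_cong_le:
  fixes s m :: int
  assumes c: "c > 0"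
  shows "card {x\<in>{0..<int c}. int c dvd (2 * x - s) * m} \<le> 2 * nat (gcd m (int c))"
proof -
  define e where "e = gcd m (int c)"
  have e: "e > 0" "e dvd int c" "e dvd m" using c by (auto simp: e_def)
  define c' where "c' = int c div e"
  have c': "int c = e * c'" "c' > 0" using e c by (auto simp: c'_def pos_imp_zdiv_pos_iff zdvd_imp_le)
  have "card {x\<in>{0..<int c}. int c dvd (2 * x - s) * m} =
      card ((\<lambda>x. 2 * x) ` {x\<in>{0..<int c}. int c dvd (2 * x - s) * m})"
    by (intro card_image[symmetric] inj_onI) auto
  also have "\<dots> \<le> card {y\<in>{0..<int (2 * nat e) * c'}. [y = s] (mod c')}"
  proof (intro card_mono image_subsetI)
    fix x assume "x \<in> {x\<in>{0..<int c}. int c dvd (2 * x - s) * m}"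
    then have x: "0 \<le> x" "x < int c" "int c dvd (2 * x - s) * m" by auto
    obtain m' where m': "m = e * m'" using e by auto
    have cop: "coprime m' c'"
    proof -
      have "m' = m div e" using m' e by simp
      then show ?thesis unfolding c'_def e_def using c by (simp add: div_gcd_coprime)
    qed
    have "e * c' dvd e * ((2 * x - s) * m')" using x(3) c' m' by (simp add: mult_ac)
    then have "c' dvd (2 * x - s) * m'" using e by simp
    then have "c' dvd 2 * x - s" using cop by (simp add: coprime_commute coprime_dvd_mult_left_iff)
    then show "2 * x \<in> {y\<in>{0..<int (2 * nat e) * c'}. [y = s] (mod c')}"
      using x c' e by (auto simp: cong_iff_dvd_diff)
  qed (rule finite_int_filter)
  also have "\<dots> \<le> 2 * nat e" by (rule card_cong_le[OF c'(2)])
  finally show ?thesis by (simp add: e_def)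
qed

text \<open>Write t = y1 + y2, which is x1 + x2 modulo c. Multiplying the congruence of the inverses
  by x1 x2 y1 y2 gives t (y1 y2 - x1 x2) = 0, and (x1 - y1) (x1 - y2) = x1^2 - t x1 + y1 y2 = y1 y2
  - x1 x2. The proof spells this out as an integer combination of the six hypotheses.\<close>

lemma kloosterman_quads_dvd:
  fixes x1 x2 y1 y2 X1 X2 Y1 Y2 c :: int
  assumes "c dvd x1 * X1 - 1" "c dvd x2 * X2 - 1" "c dvd y1 * Y1 - 1" "c dvd y2 * Y2 - 1"
    and t: "c dvd x1 + x2 - y1 - y2" and T: "c dvd X1 + X2 - Y1 - Y2"
  shows "c dvd (y1 + y2) * ((x1 - y1) * (x1 - y2))"
proof -
  have "(y1 + y2) * ((x1 - y1) * (x1 - y2)) =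
      (X1 + X2 - Y1 - Y2) * (x1 * x2 * y1 * y2) - (x1 * X1 - 1) * (x2 * y1 * y2) - (x2 * X2 - 1) * (x1 * y1 * y2)
      + (y1 * Y1 - 1) * (x1 * x2 * y2) + (y2 * Y2 - 1) * (x1 * x2 * y1)
      - (x1 + x2 - y1 - y2) * (y1 * y2) + (x1 + x2 - y1 - y2) * ((y1 + y2) * x1)"
    by (simp add: algebra_simps)
  also have "c dvd \<dots>" by (intro dvd_add dvd_diff dvd_mult2 assms)
  finally show ?thesis .
qed

text \<open>Record a quadruple by r = x1 - y1, s = x1 - y2 and x1. These fix y1 and y2, then x2 by
  the first congruence, and each unit fixes its inverse. Since y1 + y2 = 2 x1 - (r + s),
  \<open>kloosterman_quads_dvd\<close> leaves at most 2 gcd(r s, c) values of x1 for given r and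
  s.\<close>

lemma card_kloosterman_quads:
  assumes c: "c > 0"
  shows "card (kloosterman_quads c) \<le> 2 * (\<Sum>r\<in>{0..<int c}. nat (gcd r (int c))) ^ 2"
proof -
  let ?I = "{0..<int c}"
  define X where "X = (\<lambda>(r, q). {x\<in>?I. int c dvd (2 * x - (r + q)) * (r * q)})"
  define S where "S = Sigma (?I \<times> ?I) X"
  define \<phi> where "\<phi> = (\<lambda>(z1 :: int_pair, z2 :: int_pair, w1 :: int_pair, w2 :: int_pair).
    (((fst z1 - fst w1) mod int c, (fst z1 - fst w2) mod int c), fst z1))"
  have finX: "finite (X rq)" for rq unfolding X_def case_prod_unfold by (rule finite_int_filter)
  have finS: "finite S" unfolding S_def by (intro finite_SigmaI) (auto simp: finX)
  have "\<phi> ` kloosterman_quads c \<subseteq> S"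
  proof (rule image_subsetI)
    fix q assume q: "q \<in> kloosterman_quads c"
    obtain x1 X1 x2 X2 y1 Y1 y2 Y2 where [simp]: "q = ((x1, X1), (x2, X2), (y1, Y1), (y2, Y2))"
      by (metis prod_cases4 surj_pair)
    have h: "int c dvd x1 * X1 - 1" "int c dvd x2 * X2 - 1" "int c dvd y1 * Y1 - 1" "int c dvd y2 * Y2 - 1"
      "int c dvd x1 + x2 - y1 - y2" "int c dvd X1 + X2 - Y1 - Y2" "x1 \<in> ?I"
      using q by (auto simp: kloosterman_quads_def unit_pairs_def cong_iff_dvd_diff)
    define r where "r = (x1 - y1) mod int c"
    define s where "s = (x1 - y2) mod int c"
    have rs: "[r = x1 - y1] (mod int c)" "[s = x1 - y2] (mod int c)" "r \<in> ?I" "s \<in> ?I"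
      using c by (auto simp: r_def s_def)
    have "[(2 * x1 - (r + s)) * (r * s) = (2 * x1 - ((x1 - y1) + (x1 - y2))) * ((x1 - y1) * (x1 - y2))] (mod int c)"
      by (intro cong_mult cong_diff cong_add cong_refl rs)
    moreover have "2 * x1 - ((x1 - y1) + (x1 - y2)) = y1 + y2" by simp
    ultimately have "[(2 * x1 - (r + s)) * (r * s) = (y1 + y2) * ((x1 - y1) * (x1 - y2))] (mod int c)" by simp
    then have "int c dvd (2 * x1 - (r + s)) * (r * s)"
      using kloosterman_quads_dvd[OF h(1-6)] cong_dvd_iff by blast
    then show "\<phi> q \<in> S" using rs h(7) by (simp add: \<phi>_def S_def X_def r_def s_def)
  qed
  moreover have "inj_on \<phi> (kloosterman_quads c)"
  proof (rule inj_onI)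
    fix q q' assume q: "q \<in> kloosterman_quads c" and q': "q' \<in> kloosterman_quads c" and eq: "\<phi> q = \<phi> q'"
    obtain z1 z2 w1 w2 where Q: "q = (z1, z2, w1, w2)" by (metis prod_cases4)
    obtain z1' z2' w1' w2' where Q': "q' = (z1', z2', w1', w2')" by (metis prod_cases4)
    have U: "z1 \<in> unit_pairs c" "z2 \<in> unit_pairs c" "w1 \<in> unit_pairs c" "w2 \<in> unit_pairs c"
      "z1' \<in> unit_pairs c" "z2' \<in> unit_pairs c" "w1' \<in> unit_pairs c" "w2' \<in> unit_pairs c"
      using q q' Q Q' by (auto simp: kloosterman_quads_def)
    have eqI: "z = w" if "z \<in> unit_pairs c" "w \<in> unit_pairs c" "[fst z = fst w] (mod int c)" for z w
    proof -
      have "fst z = fst w"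
        using that by (intro cong_less_imp_eq_int[of _ "int c"]) (auto simp: unit_pairs_def)
      then show ?thesis using that unit_pairs_unique by (metis prod.collapse)
    qed
    have f1: "fst z1 = fst z1'" using eq by (simp add: \<phi>_def Q Q')
    then have 1: "z1 = z1'" using U by (intro eqI) auto
    have "[fst z1 - fst w1 = fst z1 - fst w1'] (mod int c)" "[fst z1 - fst w2 = fst z1 - fst w2'] (mod int c)"
      using eq f1 by (simp_all add: \<phi>_def Q Q' cong_def)
    from this[THEN cong_diff[OF cong_refl[of "fst z1"]]]
    have 2: "w1 = w1'" "w2 = w2'" using U by (auto intro!: eqI)
    have "int c dvd (fst z1 + fst z2 - fst w1 - fst w2) - (fst z1' + fst z2' - fst w1' - fst w2')"
      using q q' unfolding Q Q' kloosterman_quads_def by (auto intro: dvd_diff simp del: fst_conv snd_conv)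
    then have "int c dvd fst z2 - fst z2'" by (simp add: 1 2)
    then have "z2 = z2'" using U by (intro eqI) (auto simp: cong_iff_dvd_diff)
    then show "q = q'" by (simp add: Q Q' 1 2)
  qed
  ultimately have "card (kloosterman_quads c) \<le> card S" using finS by (metis card_inj_on_le)
  also have "card S = (\<Sum>rq\<in>?I \<times> ?I. card (X rq))"
    unfolding S_def by (intro card_SigmaI) (auto simp: finX)
  also have "\<dots> \<le> (\<Sum>rq\<in>?I \<times> ?I. 2 * (nat (gcd (fst rq) (int c)) * nat (gcd (snd rq) (int c))))"
  proof (rule sum_mono)
    fix rq assume "rq \<in> ?I \<times> ?I"
    obtain r q where [simp]: "rq = (r, q)" by (cases rq)
    \<comment> \<open>The product of two Bezout relations writes the product of the gcds as a
      combination of r q and c. This separates the double sum into a square.\<close>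
    have "gcd (r * q) (int c) dvd gcd r (int c) * gcd q (int c)"
    proof -
      obtain a b a' b' where ab: "a * r + b * int c = gcd r (int c)" "a' * q + b' * int c = gcd q (int c)"
        using bezout_int by metis
      have "gcd r (int c) * gcd q (int c) = (r * q) * (a * a') + int c * (a * r * b' + b * a' * q + b * b' * int c)"
        unfolding ab[symmetric] by (simp add: algebra_simps)
      then show ?thesis by (metis dvd_add dvd_mult2 gcd_dvd1 gcd_dvd2)
    qed
    then have "gcd (r * q) (int c) \<le> gcd r (int c) * gcd q (int c)"
      using c by (intro zdvd_imp_le) auto
    then have "nat (gcd (r * q) (int c)) \<le> nat (gcd r (int c)) * nat (gcd q (int c))"
      by (simp add: nat_mult_distrib[symmetric] nat_mono)
    moreover have "card (X rq) \<le> 2 * nat (gcd (r * q) (int c))"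
      unfolding X_def using card_double_cong_le[OF c, of "r + q" "r * q"] by simp
    ultimately show "card (X rq) \<le> 2 * (nat (gcd (fst rq) (int c)) * nat (gcd (snd rq) (int c)))"
      by simp
  qed
  also have "\<dots> = 2 * (\<Sum>r\<in>?I. nat (gcd r (int c))) ^ 2"
    by (simp only: power2_eq_square sum_times_sum) (simp only: sum_distrib_left)
  finally show ?thesis .
qed

definition divisor_count :: "nat \<Rightarrow> nat" where "divisor_count c = card {e. e dvd c}"

text \<open>Bound gcd(r, c) by the sum of all common divisors of r and c: each divisor e of c occurs
  for c/e residues r and so contributes c.\<close>

lemma sum_gcd_le:
  assumes c: "c > 0"
  shows "(\<Sum>r\<in>{0..<int c}. nat (gcd r (int c))) \<le> c * divisor_count c"
proof -
  have "(\<Sum>r\<in>{0..<int c}. nat (gcd r (int c))) = (\<Sum>r<c. gcd r c)"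
    by (rule sum.reindex_bij_witness[of _ int nat]) (auto simp: gcd_int_def)
  also have "\<dots> \<le> (\<Sum>r<c. \<Sum>e | e \<in> {e. e dvd c} \<and> e dvd r. e)"
  proof (rule sum_mono)
    fix r assume "r \<in> {..<c}"
    have "gcd r c = (\<Sum>e\<in>{gcd r c}. e)" by simp
    also have "\<dots> \<le> (\<Sum>e | e \<in> {e. e dvd c} \<and> e dvd r. e)"
      using c by (intro sum_mono2) auto
    finally show "gcd r c \<le> (\<Sum>e | e \<in> {e. e dvd c} \<and> e dvd r. e)" .
  qed
  also have "\<dots> = (\<Sum>e | e dvd c. \<Sum>r | r \<in> {..<c} \<and> e dvd r. e)"
    using sum.swap_restrict[of "{..<c}" "{e. e dvd c}" "\<lambda>r e. e" "\<lambda>r e. e dvd r"] c by simp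
  also have "\<dots> \<le> (\<Sum>e | e dvd c. c)"
  proof (rule sum_mono)
    fix e assume "e \<in> {e. e dvd c}"
    then obtain k where k: "c = e * k" by auto
    have e: "e > 0" using c k by (cases e) auto
    have "{r. r \<in> {..<c} \<and> e dvd r} \<subseteq> (\<lambda>j. e * j) ` {..<k}"
      using e k by (auto simp: image_iff)
    then have "card {r. r \<in> {..<c} \<and> e dvd r} \<le> k"
      using surj_card_le[of "{..<k}"] by fastforce
    then show "(\<Sum>r | r \<in> {..<c} \<and> e dvd r. e) \<le> c" by (simp add: k mult.commute)
  qed
  also have "\<dots> = c * divisor_count c" by (simp add: divisor_count_def mult.commute)
  finally show ?thesis .
qed

text \<open>In the divisor sum c = sum of \<open>totient d\<close> every term is at most
  \<open>totient c\<close>. It turns the factor \<open>totient c\<close> in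
  \<open>kloosterman_bound\<close> into a power of c.\<close>

lemma le_totient_divisor_count:
  assumes "c > 0"
  shows "c \<le> totient c * divisor_count c"
proof -
  have "c = (\<Sum>d | d dvd c. totient d)" by (simp add: totient_divisor_sum)
  also have "\<dots> \<le> (\<Sum>d | d dvd c. totient c)"
    using assms by (intro sum_mono dvd_imp_le totient_dvd) auto
  finally show ?thesis by (simp add: divisor_count_def mult.commute)
qed

text \<open>Count the multiples of each e. The harmonic number minus the logarithm decreases from
  its value 1 at n = 1.\<close>

lemma sum_divisor_count_le: "n > 0 \<Longrightarrow> (\<Sum>c=1..n. real (divisor_count c)) \<le> real n * (1 + ln (real n))"
proof -
  assume n: "n > 0"
  have "(\<Sum>c=1..n. real (divisor_count c)) \<le> (\<Sum>c=1..n. \<Sum>e | e \<in> {1..n} \<and> e dvd c. 1)"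
  proof (rule sum_mono)
    fix c assume "c \<in> {1..n}"
    then have "{e. e dvd c} = {e. e \<in> {1..n} \<and> e dvd c}"
      by (auto dest: dvd_imp_le intro: Suc_leI)
    then show "real (divisor_count c) \<le> (\<Sum>e | e \<in> {1..n} \<and> e dvd c. 1)" by (simp add: divisor_count_def)
  qed
  also have "\<dots> = (\<Sum>e=1..n. \<Sum>c | c \<in> {1..n} \<and> e dvd c. 1)"
    by (rule sum.swap_restrict) auto
  also have "\<dots> \<le> (\<Sum>e=1..n. real n * inverse (real e))"
  proof (rule sum_mono)
    fix e assume e: "e \<in> {1..n}"
    from e have "real (card {c. c \<in> {1..n} \<and> e dvd c}) \<le> real n / real e"
      by (intro card_multiples_le) simp
    then show "(\<Sum>c | c \<in> {1..n} \<and> e dvd c. 1) \<le> real n * inverse (real e)"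
      by (simp add: divide_inverse)
  qed
  also have "\<dots> = real n * harm n" by (simp add: harm_def sum_distrib_left)
  also have "\<dots> \<le> real n * (1 + ln (real n))"
  proof (rule mult_left_mono)
    have "harm (Suc (n - 1)) - ln (real (Suc (n - 1))) \<le> harm (Suc 0) - ln (real (Suc 0))"
      using decseqD[OF decseq_harm_diff_ln, of 0 "n - 1"] by simp
    then show "harm n \<le> 1 + ln (real n)" using n by (simp add: harm_def)
  qed simp
  finally show ?thesis .
qed

text \<open>
  Since \<open>K(h, k) = K(hu, ku\<^sup>-\<^sup>1)\<close> for every unit \<open>u\<close>, the fourth moment contains
  \<open>|K(h, k)|\<^sup>4\<close> at least \<open>\<phi>(c)/|h|\<close> times.
\<close>
lemma kloosterman_bound:
  assumes c: "c \<ge> 2" and h: "h \<noteq> 0"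
  shows "real (totient c) * cmod (kloosterman h k c) ^ 4 \<le> real_of_int \<bar>h\<bar> * (real c ^ 2 * (2 * (real c * real (divisor_count c)) ^ 2))"
proof -
  have c0: "c > 0" using c by simp
  let ?I = "{0..<int c}"
  define F where "F = (\<lambda>(m, n). cmod (kloosterman m n c) ^ 4)"
  define \<phi> where "\<phi> z = ((h * fst z) mod int c, (k * snd z) mod int c)" for z :: int_pair
  have "real (totient c) * cmod (kloosterman h k c) ^ 4 = (\<Sum>z\<in>unit_pairs c. cmod (kloosterman h k c) ^ 4)"
    using card_unit_pairs[OF c] by simp
  also have "\<dots> = (\<Sum>z\<in>unit_pairs c. F (\<phi> z))"
  proof (intro sum.cong refl)
    fix z assume "z \<in> unit_pairs c"
    then have "kloosterman h k c = kloosterman (h * fst z) (k * snd z) c" using c0 by (intro kloosterman_mult) auto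
    also have "\<dots> = kloosterman ((h * fst z) mod int c) ((k * snd z) mod int c) c"
      using c0 by (intro kloosterman_cong) auto
    finally show "cmod (kloosterman h k c) ^ 4 = F (\<phi> z)" by (simp add: F_def \<phi>_def)
  qed
  also have "\<dots> = (\<Sum>y\<in>\<phi> ` unit_pairs c. \<Sum>z | z \<in> unit_pairs c \<and> \<phi> z = y. F (\<phi> z))"
    by (rule sum.image_gen) simp
  also have "\<dots> = (\<Sum>y\<in>\<phi> ` unit_pairs c. real (card {z. z \<in> unit_pairs c \<and> \<phi> z = y}) * F y)"
    by (intro sum.cong refl) simp
  also have "\<dots> \<le> (\<Sum>y\<in>\<phi> ` unit_pairs c. real_of_int \<bar>h\<bar> * F y)"
  proof (intro sum_mono mult_right_mono)
    fix y assume "y \<in> \<phi> ` unit_pairs c"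
    \<comment> \<open>A fibre of \<phi> consists of solutions d of h d = fst y modulo c, where h may
      share factors with c. Multiplication by |h| embeds the fibre into one residue class of [0, |h|
      c), which has at most |h| elements.\<close>
    define f where "f z = \<bar>h\<bar> * fst z" for z :: int_pair
    have "inj_on f {z. z \<in> unit_pairs c \<and> \<phi> z = y}"
    proof (rule inj_onI)
      fix z w assume "z \<in> {z. z \<in> unit_pairs c \<and> \<phi> z = y}" "w \<in> {z. z \<in> unit_pairs c \<and> \<phi> z = y}" "f z = f w"
      then have "z \<in> unit_pairs c" "w \<in> unit_pairs c" "fst z = fst w" using h by (auto simp: f_def)
      then show "z = w" using unit_pairs_unique by (metis prod.collapse)
    qed
    moreover have "f ` {z. z \<in> unit_pairs c \<and> \<phi> z = y} \<subseteq> {x\<in>{0..<int (nat \<bar>h\<bar>) * int c}. [x = sgn h * fst y] (mod int c)}"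
    proof (rule image_subsetI)
      fix z assume z: "z \<in> {z. z \<in> unit_pairs c \<and> \<phi> z = y}"
      then have "[h * fst z = fst y] (mod int c)" by (auto simp: \<phi>_def)
      then have "[sgn h * (h * fst z) = sgn h * fst y] (mod int c)" by (intro cong_mult cong_refl)
      moreover have "sgn h * (h * fst z) = \<bar>h\<bar> * fst z" by (simp add: abs_sgn mult_ac)
      moreover have "0 \<le> fst z" "fst z < int c" using z by (auto simp: unit_pairs_def)
      ultimately show "f z \<in> {x\<in>{0..<int (nat \<bar>h\<bar>) * int c}. [x = sgn h * fst y] (mod int c)}"
        using h by (auto simp: f_def)
    qed
    ultimately have "card {z. z \<in> unit_pairs c \<and> \<phi> z = y} \<le> card {x\<in>{0..<int (nat \<bar>h\<bar>) * int c}. [x = sgn h * fst y] (mod int c)}"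
      by (rule card_inj_on_le) (rule finite_int_filter)
    also have "\<dots> \<le> nat \<bar>h\<bar>" using c0 by (intro card_cong_le) simp
    finally show "real (card {z. z \<in> unit_pairs c \<and> \<phi> z = y}) \<le> real_of_int \<bar>h\<bar>" by linarith
    show "0 \<le> F y" by (simp add: F_def case_prod_unfold)
  qed
  also have "\<dots> \<le> (\<Sum>y\<in>?I \<times> ?I. real_of_int \<bar>h\<bar> * F y)"
    using c0 by (intro sum_mono2) (auto simp: \<phi>_def F_def)
  also have "\<dots> = real_of_int \<bar>h\<bar> * (\<Sum>m\<in>?I. \<Sum>n\<in>?I. cmod (kloosterman m n c) ^ 4)"
    by (simp add: F_def sum.cartesian_product sum_distrib_left case_prod_unfold)
  also have "\<dots> = real_of_int \<bar>h\<bar> * (real c ^ 2 * real (card (kloosterman_quads c)))"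
    by (simp add: kloosterman_fourth_moment[OF c0])
  also have "\<dots> \<le> real_of_int \<bar>h\<bar> * (real c ^ 2 * (2 * (real c * real (divisor_count c)) ^ 2))"
  proof (intro mult_left_mono)
    have "card (kloosterman_quads c) \<le> 2 * (c * divisor_count c) ^ 2"
      using card_kloosterman_quads[OF c0] power_mono[OF sum_gcd_le[OF c0], of 2] by linarith
    then have "real (card (kloosterman_quads c)) \<le> real (2 * (c * divisor_count c) ^ 2)" by (rule of_nat_mono)
    then show "real (card (kloosterman_quads c)) \<le> 2 * (real c * real (divisor_count c)) ^ 2" by simp
  qed auto
  finally show ?thesis .
qed

lemma norm_kloosterman_le: "c \<ge> 2 \<Longrightarrow> cmod (kloosterman h k c) \<le> real c"
proof -
  assume c: "c \<ge> 2"
  have "cmod (kloosterman h k c) \<le> (\<Sum>z\<in>unit_pairs c. 1)"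
    unfolding kloosterman_def by (rule order_trans[OF norm_sum]) simp
  also have "\<dots> \<le> real c" using card_unit_pairs[OF c] totient_le[of c] by simp
  finally show ?thesis .
qed

text \<open>With x = |K|/c and D the number of divisors of c, \<open>kloosterman_bound\<close> and c
  <= totient(c) D give c x^4 <= 2 |h| D^3. The right side is enlarged to (2 |h| D)^4 so that the
  root is linear in D and can be averaged by \<open>sum_divisor_count_le\<close>.\<close>

lemma kloosterman_normalized_le:
  assumes c: "c \<ge> 2" and h: "h \<noteq> 0"
  shows "cmod (kloosterman h k c) / real c \<le> 2 * real_of_int \<bar>h\<bar> * real (divisor_count c) * real c powr (-1/4)"
proof -
  define x where "x = cmod (kloosterman h k c) / real c"
  define H where "H = real_of_int \<bar>h\<bar>"
  define D where "D = real (divisor_count c)"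
  have H: "H \<ge> 1" using h by (simp add: H_def)
  have D: "D \<ge> 1"
  proof -
    have "{1} \<subseteq> {e. e dvd c}" by simp
    then have "card {1 :: nat} \<le> card {e. e dvd c}" using c by (intro card_mono) auto
    then show ?thesis by (simp add: D_def divisor_count_def)
  qed
  have c0: "real c > 0" using c by simp
  have "real c \<le> real (totient c) * D"
    using le_totient_divisor_count[of c] c unfolding D_def of_nat_mult[symmetric] by (intro of_nat_mono) auto
  then have "real c * (real c * x) ^ 4 \<le> real (totient c) * D * (real c * x) ^ 4"
    by (intro mult_right_mono) auto
  also have "\<dots> = D * (real (totient c) * cmod (kloosterman h k c) ^ 4)"
    using c0 by (simp add: x_def)
  also have "\<dots> \<le> D * (H * (real c ^ 2 * (2 * (real c * D) ^ 2)))"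
    using kloosterman_bound[OF c h, of k] D by (intro mult_left_mono) (auto simp: H_def D_def)
  finally have "real c ^ 4 * (real c * x ^ 4) \<le> real c ^ 4 * (2 * H * D ^ 3)"
    by (simp add: power_mult_distrib algebra_simps power2_eq_square power3_eq_cube power4_eq_xxxx)
  then have "real c * x ^ 4 \<le> 2 * H * D ^ 3" using c0 by simp
  also have "\<dots> \<le> (2 * H * D) ^ 4"
  proof -
    have "2 * H * D ^ 3 = (2 * H) ^ 1 * D ^ 3" by simp
    also have "\<dots> \<le> (2 * H) ^ 4 * D ^ 4"
      using H D by (intro mult_mono power_increasing) auto
    finally show ?thesis by (simp add: power_mult_distrib)
  qed
  finally have "x ^ 4 \<le> (2 * H * D) ^ 4 * (1 / real c)" using c0 by (simp add: field_simps)
  also have "1 / real c = (real c powr (-1/4)) ^ 4"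
  proof -
    have "(real c powr (-1/4)) ^ 4 = real c powr (real 4 * (-1/4))"
      by (rule powr_power) (use c0 in auto)
    also have "\<dots> = 1 / real c" using c0 by (simp add: powr_minus_divide)
    finally show ?thesis by simp
  qed
  finally have "x ^ 4 \<le> (2 * H * D * real c powr (-1/4)) ^ 4" by (simp add: power_mult_distrib)
  then show ?thesis unfolding x_def[symmetric] H_def[symmetric] D_def[symmetric]
    using H D by (subst (asm) power_mono_iff) (auto simp: x_def)
qed

text \<open>Up to sqrt n the terms are bounded trivially and number at most sqrt n. Beyond it, c
  powr (-1/4) is at most n powr (-1/8), which beats the logarithmic mean of the divisor
  function.\<close>

lemma kloosterman_mean_null_left:
  assumes h: "h \<noteq> 0"
  shows "mean_null (\<lambda>c. cmod (kloosterman h k c) / real c)"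
proof -
  define x where "x c = cmod (kloosterman h k c) / real c" for c
  define H where "H = real_of_int \<bar>h\<bar>"
  have H: "H \<ge> 0" by (simp add: H_def)
  have x0: "x c \<ge> 0" for c by (simp add: x_def)
  \<comment> \<open>For c >= 2 the bound is 1. Adding \<open>x 1\<close> covers c = 1, and
    \<open>x 0\<close> is 0 as a division by zero.\<close>
  have x1: "x c \<le> 1 + x 1" for c
  proof (cases "c \<ge> 2")
    case True
    then have "x c \<le> 1" using norm_kloosterman_le[of c h k] by (simp add: x_def)
    then show ?thesis using x0[of 1] by linarith
  next
    case False
    then have "c = 0 \<or> c = 1" by auto
    then show ?thesis using x0[of 1] by (auto simp: x_def)
  qed
  have bound: "(\<Sum>c=1..n. \<bar>x c\<bar>) / real n \<le>
      ((1 + x 1) * sqrt n + 2 * H * sqrt n powr (-1/4) * (real n * (1 + ln (real n)))) / real n" if n: "n \<ge> 2" for n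
  proof (rule divide_right_mono)
    define A where "A = {c\<in>{1..n}. real c \<le> sqrt n}"
    define B where "B = {c\<in>{1..n}. real c > sqrt n}"
    have AB: "{1..n} = A \<union> B" "A \<inter> B = {}" "finite A" "finite B" by (auto simp: A_def B_def)
    have "(\<Sum>c=1..n. \<bar>x c\<bar>) = (\<Sum>c=1..n. x c)" using x0 by simp
    also have "\<dots> = (\<Sum>c\<in>A. x c) + (\<Sum>c\<in>B. x c)"
      unfolding AB(1) using AB(2-4) by (intro sum.union_disjoint)
    also have "(\<Sum>c\<in>A. x c) \<le> (1 + x 1) * sqrt n"
    proof -
      have "A \<subseteq> {1..nat \<lfloor>sqrt n\<rfloor>}" by (auto simp: A_def le_nat_iff le_floor_iff)
      then have "card A \<le> nat \<lfloor>sqrt n\<rfloor>" using card_mono[of "{1..nat \<lfloor>sqrt n\<rfloor>}" A] by simp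
      also have "real (nat \<lfloor>sqrt n\<rfloor>) \<le> sqrt n" by simp
      finally have "real (card A) \<le> sqrt n" by simp
      moreover have "(\<Sum>c\<in>A. x c) \<le> real (card A) * (1 + x 1)" by (rule sum_bounded_above) (rule x1)
      moreover have "real (card A) * (1 + x 1) \<le> sqrt n * (1 + x 1)"
        using calculation(1) x0[of 1] by (intro mult_right_mono) auto
      ultimately show ?thesis by (simp add: mult.commute)
    qed
    also have "(\<Sum>c\<in>B. x c) \<le> (\<Sum>c\<in>B. 2 * H * sqrt n powr (-1/4) * real (divisor_count c))"
    proof (rule sum_mono)
      fix c assume c: "c \<in> B"
      have s1: "sqrt n > 1" using n by simp
      moreover have "real c > sqrt n" using c by (simp add: B_def)
      ultimately have "real c > 1" by linarith
      then have "c \<ge> 2" by simp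
      then have "x c \<le> 2 * H * real (divisor_count c) * real c powr (-1/4)"
        using kloosterman_normalized_le[OF _ h] by (simp add: x_def H_def)
      also have "\<dots> \<le> 2 * H * real (divisor_count c) * sqrt n powr (-1/4)"
        using c s1 H by (intro mult_left_mono powr_mono2') (auto simp: B_def)
      finally show "x c \<le> 2 * H * sqrt n powr (-1/4) * real (divisor_count c)" by (simp add: mult_ac)
    qed
    also have "\<dots> \<le> (\<Sum>c=1..n. 2 * H * sqrt n powr (-1/4) * real (divisor_count c))"
      using H by (intro sum_mono2) (auto simp: B_def)
    also have "\<dots> = 2 * H * sqrt n powr (-1/4) * (\<Sum>c=1..n. real (divisor_count c))" by (simp add: sum_distrib_left)
    also have "\<dots> \<le> 2 * H * sqrt n powr (-1/4) * (real n * (1 + ln (real n)))"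
      using H n by (intro mult_left_mono sum_divisor_count_le) auto
    finally show "(\<Sum>c=1..n. \<bar>x c\<bar>) \<le>
        (1 + x 1) * sqrt n + 2 * H * sqrt n powr (-1/4) * (real n * (1 + ln (real n)))" by simp
  qed simp
  show ?thesis unfolding mean_null_def x_def[symmetric]
  proof (rule tendsto_sandwich[OF _ _ tendsto_const])
    show "\<forall>\<^sub>F n in sequentially. (\<Sum>c=1..n. \<bar>x c\<bar>) / real n \<le>
      ((1 + x 1) * sqrt n + 2 * H * sqrt n powr (-1/4) * (real n * (1 + ln (real n)))) / real n"
      using eventually_ge_at_top[of 2] by eventually_elim (rule bound)
    have 1: "(\<lambda>n. sqrt (real n) / real n) \<longlonglongrightarrow> 0" by real_asymp
    have 2: "(\<lambda>n. sqrt (real n) powr (-1/4) * (real n * (1 + ln (real n))) / real n) \<longlonglongrightarrow> 0" by real_asymp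
    have "(\<lambda>n. (1 + x 1) * (sqrt (real n) / real n) + 2 * H * (sqrt (real n) powr (-1/4) * (real n * (1 + ln (real n))) / real n))
        \<longlonglongrightarrow> (1 + x 1) * 0 + 2 * H * 0"
      by (intro tendsto_intros 1 2)
    then show "(\<lambda>n. ((1 + x 1) * sqrt n + 2 * H * sqrt n powr (-1/4) * (real n * (1 + ln (real n)))) / real n) \<longlonglongrightarrow> 0"
      by (simp only: add_divide_distrib times_divide_eq_right mult.assoc mult_zero_right add_0_left)
  qed (auto intro!: always_eventually divide_nonneg_nonneg sum_nonneg)
qed

lemma kloosterman_mean_null:
  assumes "h \<noteq> 0 \<or> k \<noteq> 0"
  shows "mean_null (\<lambda>c. cmod (kloosterman h k c) / real c)"
  using assms kloosterman_mean_null_left[of h k] kloosterman_mean_null_left[of k h] by (auto simp: kloosterman_swap[of k h])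

section \<open>Equidistribution of inverses modulo c\<close>

definition pair_mean :: "(real \<Rightarrow> real) \<Rightarrow> (real \<Rightarrow> real) \<Rightarrow> nat \<Rightarrow> real" where
  "pair_mean f g c = (\<Sum>z\<in>unit_pairs c. f (of_int (fst z) / real c) * g (of_int (snd z) / real c)) / real c"

text \<open>\<open>pair_mean\<close> divides by c and not by the number of unit pairs, so the
  expected value carries the factor totient(c)/c. The approximation is asked for in absolute mean
  over c, not for every c.\<close>

definition equidistributed :: "(real \<Rightarrow> real) \<Rightarrow> (real \<Rightarrow> real) \<Rightarrow> bool" where
  "equidistributed f g \<longleftrightarrow> mean_null (\<lambda>c. pair_mean f g c -
     real (totient c) / real c * (integral {0..1} f * integral {0..1} g))"

lemma card_unit_pairs_le: "card (unit_pairs c) \<le> c"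
proof (cases "c \<ge> 2")
  case True
  then show ?thesis by (simp add: card_unit_pairs totient_le)
next
  case False
  then consider "c = 0" | "c = 1" by linarith
  then show ?thesis
  proof cases
    case 2
    have "unit_pairs c \<subseteq> {(0, 0)}" by (auto simp: unit_pairs_def 2)
    then have "card (unit_pairs c) \<le> card {(0 :: int, 0 :: int)}" by (intro card_mono) auto
    then show ?thesis by (simp add: 2)
  qed (simp add: unit_pairs_def)
qed

lemma unit_pairs_frac:
  assumes "z \<in> unit_pairs c"
  shows "of_int (fst z) / real c \<in> {0..1}" "of_int (snd z) / real c \<in> {0..1}"
  using assms by (auto simp: unit_pairs_def divide_le_eq_1)

lemma pair_mean_swap: "pair_mean f g c = pair_mean g f c"
  unfolding pair_mean_def
  by (rule arg_cong[of _ _ "\<lambda>x. x / real c"],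
      rule sum.reindex_bij_witness[of _ prod.swap prod.swap])
     (auto simp: unit_pairs_swap mult.commute)

lemma equidistributed_swap: "equidistributed f g \<longleftrightarrow> equidistributed g f"
  unfolding equidistributed_def pair_mean_swap[of f g] by (simp add: mult.commute)

lemma equidistributed_add:
  assumes "equidistributed f1 g" "equidistributed f2 g" "f1 integrable_on {0..1}" "f2 integrable_on {0..1}"
  shows "equidistributed (\<lambda>x. f1 x + f2 x) g"
  using mean_null_add[OF assms(1,2)[unfolded equidistributed_def]]
  by (simp add: equidistributed_def pair_mean_def Henstock_Kurzweil_Integration.integral_add[OF assms(3,4)]
      sum.distrib add_divide_distrib algebra_simps)

lemma equidistributed_cmult:
  assumes "equidistributed f g"
  shows "equidistributed (\<lambda>x. a * f x) g"
proof -
  have "pair_mean (\<lambda>x. a * f x) g c = a * pair_mean f g c" for c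
    by (simp add: pair_mean_def sum_distrib_left mult.assoc)
  then show ?thesis
    using mean_null_cmult[OF assms[unfolded equidistributed_def], of a]
    by (simp add: equidistributed_def algebra_simps)
qed

lemma integral_cos_eq_0:
  assumes "h > 0"
  shows "integral {0..1} (\<lambda>x. cos (2 * pi * (real h * x))) = 0"
proof (rule integral_unique)
  let ?F = "\<lambda>x. sin (2 * pi * (real h * x)) / (2 * pi * real h)"
  have "((\<lambda>x. cos (2 * pi * (real h * x))) has_integral ?F 1 - ?F 0) {0..1}"
  proof (rule fundamental_theorem_of_calculus)
    fix x :: real
    have "(?F has_real_derivative cos (2 * pi * (real h * x))) (at x within {0..1})"
      using assms by (auto intro!: derivative_eq_intros)
    then show "(?F has_vector_derivative cos (2 * pi * (real h * x))) (at x within {0..1})"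
      by (simp add: has_real_derivative_iff_has_vector_derivative)
  qed simp
  moreover have "sin (2 * pi * (real h * 1)) = 0"
    using sin_int_2pin[of "int h"] by (simp add: mult_ac)
  ultimately show "((\<lambda>x. cos (2 * pi * (real h * x))) has_integral 0) {0..1}" by simp
qed

text \<open>A product of two cosines is half the sum of the cosines at the frequencies (h, k) and
  (h, -k), so the sum over unit pairs is the real part of two Kloosterman sums. Frequency (0, 0)
  gives the main term, exactly for c >= 2.\<close>

lemma equidistributed_cos: "equidistributed (\<lambda>x. cos (2 * pi * (real h * x))) (\<lambda>x. cos (2 * pi * (real k * x)))"
proof (cases "h = 0 \<and> k = 0")
  case True
  have "\<forall>\<^sub>F c in sequentially. pair_mean (\<lambda>_. 1) (\<lambda>_. 1) c - real (totient c) / real c * (1 * 1) = 0"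
    using eventually_ge_at_top[of 2] by eventually_elim (simp add: pair_mean_def card_unit_pairs)
  then have "mean_null (\<lambda>c. pair_mean (\<lambda>_. 1) (\<lambda>_. 1) c - real (totient c) / real c * (1 * 1))"
    by (intro mean_null_tendsto_0 tendsto_eventually)
  then show ?thesis using True by (simp add: equidistributed_def)
next
  case False
  define f where "f x = cos (2 * pi * (real h * x))" for x
  define g where "g x = cos (2 * pi * (real k * x))" for x
  have int: "integral {0..1} f * integral {0..1} g = 0"
    using False integral_cos_eq_0[of h] integral_cos_eq_0[of k] unfolding f_def g_def by auto
  have 1: "mean_null (\<lambda>c. cmod (kloosterman (int h) (int k) c) / real c + cmod (kloosterman (int h) (- int k) c) / real c)"
    using False by (intro mean_null_add kloosterman_mean_null) auto
  have "mean_null (pair_mean f g)"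
  proof (rule mean_null_mono[OF 1])
    fix c :: nat assume "c \<ge> 1"
    have "(\<Sum>z\<in>unit_pairs c. f (of_int (fst z) / real c) * g (of_int (snd z) / real c)) =
        (\<Sum>z\<in>unit_pairs c. Re ((cis2pi (of_int (int h * fst z + int k * snd z) / real c) +
            cis2pi (of_int (int h * fst z + (- int k) * snd z) / real c)) / 2))"
      by (intro sum.cong refl)
        (simp add: f_def g_def cos_times_cos cis2pi_def add_divide_distrib diff_divide_distrib algebra_simps)
    also have "\<dots> = Re ((kloosterman (int h) (int k) c + kloosterman (int h) (- int k) c) / 2)"
      unfolding Re_sum[symmetric] by (simp add: kloosterman_def sum.distrib flip: sum_divide_distrib)
    finally have eq: "(\<Sum>z\<in>unit_pairs c. f (of_int (fst z) / real c) * g (of_int (snd z) / real c)) =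
        Re ((kloosterman (int h) (int k) c + kloosterman (int h) (- int k) c) / 2)" .
    have "\<bar>Re ((kloosterman (int h) (int k) c + kloosterman (int h) (- int k) c) / 2)\<bar> \<le>
        cmod ((kloosterman (int h) (int k) c + kloosterman (int h) (- int k) c) / 2)" by (rule abs_Re_le_cmod)
    also have "\<dots> \<le> (cmod (kloosterman (int h) (int k) c) + cmod (kloosterman (int h) (- int k) c)) / 2"
      using norm_triangle_ineq[of "kloosterman (int h) (int k) c" "kloosterman (int h) (- int k) c"] by (simp add: norm_divide)
    also have "\<dots> \<le> cmod (kloosterman (int h) (int k) c) + cmod (kloosterman (int h) (- int k) c)" by simp
    finally have "\<bar>pair_mean f g c\<bar> \<le> (cmod (kloosterman (int h) (int k) c) + cmod (kloosterman (int h) (- int k) c)) / real c"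
      unfolding pair_mean_def eq abs_divide abs_of_nat by (rule divide_right_mono) simp
    then show "\<bar>pair_mean f g c\<bar> \<le> \<bar>cmod (kloosterman (int h) (int k) c) / real c + cmod (kloosterman (int h) (- int k) c) / real c\<bar>"
      by (simp add: add_divide_distrib)
  qed
  then show ?thesis unfolding equidistributed_def f_def[symmetric] g_def[symmetric] int by simp
qed

section \<open>Cosine polynomials, continuous weights and intervals\<close>

inductive cospoly :: "(real \<Rightarrow> real) \<Rightarrow> bool" where
  cos: "cospoly (\<lambda>x. cos (2 * pi * (real k * x)))"
| add: "cospoly f \<Longrightarrow> cospoly g \<Longrightarrow> cospoly (\<lambda>x. f x + g x)"
| cmult: "cospoly f \<Longrightarrow> cospoly (\<lambda>x. a * f x)"

lemma cospoly_continuous: "cospoly f \<Longrightarrow> continuous_on S f"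
  by (induction rule: cospoly.induct) (auto intro!: continuous_intros)

lemma cospoly_integrable: "cospoly f \<Longrightarrow> f integrable_on {0..1}"
  by (intro integrable_continuous_real cospoly_continuous)

lemma equidistributed_cospoly:
  assumes "cospoly f" "cospoly g"
  shows "equidistributed f g"
proof -
  have 1: "equidistributed f (\<lambda>x. cos (2 * pi * (real k * x)))" for k
    using assms(1)
    by (induction rule: cospoly.induct) (auto intro!: equidistributed_cos equidistributed_add equidistributed_cmult cospoly_integrable)
  have "equidistributed g f"
    using assms(2) 
  proof (induction rule: cospoly.induct)
    case (cos k)
    show ?case using 1[of k] by (simp add: equidistributed_swap)
  qed (auto intro!: equidistributed_add equidistributed_cmult cospoly_integrable)
  then show ?thesis by (simp add: equidistributed_swap)
qed

text \<open>Product-to-sum. Iterated, it shows that the polynomials in cos(2 pi x) delivered by the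
  Weierstrass theorem are cosine sums.\<close>

lemma cospoly_mult_cos:
  assumes "cospoly f"
  shows "cospoly (\<lambda>x. cos (2 * pi * x) * f x)"
  using assms
proof (induction rule: cospoly.induct)
  case (cos k)
  show ?case
  proof (cases k)
    case 0
    then show ?thesis using cospoly.cos[of 1] by simp
  next
    case (Suc j)
    have "cospoly (\<lambda>x. 1/2 * cos (2 * pi * (real (Suc k) * x)) + 1/2 * cos (2 * pi * (real j * x)))"
      by (intro cospoly.add cospoly.cmult cospoly.cos)
    moreover have "1/2 * cos (2 * pi * (real (Suc k) * x)) + 1/2 * cos (2 * pi * (real j * x)) =
        cos (2 * pi * x) * cos (2 * pi * (real k * x))" for x
    proof -
      have "cos (2 * pi * (real k * x)) * cos (2 * pi * x) =
          (cos (2 * pi * (real k * x) - 2 * pi * x) + cos (2 * pi * (real k * x) + 2 * pi * x)) / 2"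
        by (rule cos_times_cos)
      moreover have "2 * pi * (real k * x) - 2 * pi * x = 2 * pi * (real j * x)"
        "2 * pi * (real k * x) + 2 * pi * x = 2 * pi * (real (Suc k) * x)"
        by (simp_all add: Suc algebra_simps)
      ultimately show ?thesis by (simp add: mult.commute)
    qed
    ultimately show ?thesis by simp
  qed
next
  case (add f g)
  then show ?case using cospoly.add by (simp add: distrib_left)
next
  case (cmult f a)
  then have "cospoly (\<lambda>x. a * (cos (2 * pi * x) * f x))" by (intro cospoly.cmult)
  then show ?case by (simp add: mult.left_commute)
qed

lemma cospoly_power: "cospoly (\<lambda>x. cos (2 * pi * x) ^ n)"
proof (induction n)
  case 0
  then show ?case using cospoly.cos[of 0] by simp
next
  case (Suc n)
  then show ?case using cospoly_mult_cos by simp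
qed

lemma cospoly_poly: "cospoly (\<lambda>x. \<Sum>i\<le>n. a i * cos (2 * pi * x) ^ i)"
proof (induction n)
  case 0
  then show ?case using cospoly.cmult[OF cospoly_power[of 0], of "a 0"] by simp
next
  case (Suc n)
  then show ?case
    using cospoly.add[OF Suc cospoly.cmult[OF cospoly_power[of "Suc n"], of "a (Suc n)"]] by (simp del: power_Suc)
qed

text \<open>
  A function on \<open>[0, 1]\<close> that is symmetric about \<open>1/2\<close> is a function of \<open>cos (2\<pi>x)\<close>,
  so that Weierstrass's theorem on \<open>[-1, 1]\<close> applies.
\<close>
lemma cospoly_approx:
  assumes f: "continuous_on {0..1} f" and sym: "\<And>x. x \<in> {0..1} \<Longrightarrow> f (1 - x) = f x" and e: "e > 0"
  obtains p where "cospoly p" "\<And>x. x \<in> {0..1} \<Longrightarrow> \<bar>f x - p x\<bar> < e"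
proof -
  define G where "G t = f (arccos t / (2 * pi))" for t
  have "continuous_on {-1..1} G"
    unfolding G_def
  proof (rule continuous_on_compose2[OF f])
    show "continuous_on {-1..1} (\<lambda>x. arccos x / (2 * pi))"
      by (intro continuous_intros continuous_on_arccos) auto
    show "(\<lambda>x. arccos x / (2 * pi)) ` {-1..1} \<subseteq> {0..1}"
    proof (rule image_subsetI)
      fix t :: real assume "t \<in> {-1..1}"
      then have "0 \<le> arccos t" "arccos t \<le> pi" by (auto intro: arccos_lbound arccos_ubound)
      then show "arccos t / (2 * pi) \<in> {0..1}" using pi_gt_zero by (auto simp: divide_le_eq_1)
    qed
  qed
  then obtain q where q: "real_polynomial_function q" "\<And>t. t \<in> {-1..1} \<Longrightarrow> \<bar>G t - q t\<bar> < e"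
    using Stone_Weierstrass_real_polynomial_function[of "{-1..1}" G e] e by auto
  then obtain a n where an: "q = (\<lambda>t. \<Sum>i\<le>n. a i * t ^ i)"
    by (auto simp: real_polynomial_function_iff_sum)
  have G: "G (cos (2 * pi * x)) = f x" if "x \<in> {0..1/2}" for x
    using that pi_gt_zero by (simp add: G_def arccos_cos field_simps)
  have G': "G (cos (2 * pi * x)) = f x" if "x \<in> {0..1}" for x
  proof (cases "x \<le> 1/2")
    case True
    then show ?thesis using G that by simp
  next
    case False
    have "cos (2 * pi * (1 - x)) = cos (2 * pi * x)" by (simp add: right_diff_distrib cos_diff)
    then show ?thesis using G[of "1 - x"] False that sym[of x] by simp
  qed
  show ?thesis
  proof (rule that[of "\<lambda>x. q (cos (2 * pi * x))"])
    show "cospoly (\<lambda>x. q (cos (2 * pi * x)))" unfolding an by (rule cospoly_poly)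
    show "\<bar>f x - q (cos (2 * pi * x))\<bar> < e" if "x \<in> {0..1}" for x
      using q(2)[of "cos (2 * pi * x)"] G'[OF that] by simp
  qed
qed

lemma totient_ratio_01: "0 \<le> real (totient c) / real c" "real (totient c) / real c \<le> 1"
  using totient_le[of c] by (cases "c = 0"; simp add: divide_le_eq_1)+

lemma abs_mult_diff_le:
  fixes a b a' b' :: real
  assumes "\<bar>a\<bar> \<le> B" "\<bar>b\<bar> \<le> B" "\<bar>a - a'\<bar> \<le> e" "\<bar>b - b'\<bar> \<le> e" "e \<le> 1" "B \<ge> 0"
  shows "\<bar>a * b - a' * b'\<bar> \<le> (2 * B + 1) * e"
proof -
  have "a * b - a' * b' = a * (b - b') + (a - a') * b'" by (simp add: algebra_simps)
  also have "\<bar>\<dots>\<bar> \<le> \<bar>a\<bar> * \<bar>b - b'\<bar> + \<bar>a - a'\<bar> * \<bar>b'\<bar>"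
    by (metis abs_mult abs_triangle_ineq)
  also have "\<dots> \<le> B * e + e * (B + 1)"
    using assms by (intro add_mono mult_mono) auto
  finally show ?thesis by (simp add: algebra_simps)
qed

lemma abs_diff_le_add_diff:
  fixes x y a b k e :: real
  assumes "\<bar>x - y\<bar> \<le> k" "\<bar>a - b\<bar> \<le> k" "2 * k \<le> e"
  shows "\<bar>x - a\<bar> \<le> \<bar>y - b\<bar> + e"
  using assms by linarith

lemma equidistributed_symmetric:
  assumes f: "continuous_on {0..1} f" "\<And>x. x \<in> {0..1} \<Longrightarrow> f (1 - x) = f x"
    and g: "continuous_on {0..1} g" "\<And>x. x \<in> {0..1} \<Longrightarrow> g (1 - x) = g x"
  shows "equidistributed f g"
  unfolding equidistributed_def
proof (rule mean_null_approx)
  fix e :: real assume e: "e > 0"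
  have "bounded (f ` {0..1})" "bounded (g ` {0..1})"
    using f g by (auto intro!: compact_imp_bounded compact_continuous_image)
  then obtain B1 B2 where "\<forall>x\<in>{0..1}. \<bar>f x\<bar> \<le> B1" "\<forall>x\<in>{0..1}. \<bar>g x\<bar> \<le> B2"
    unfolding bounded_iff by (auto simp del: atLeastAtMost_iff)
  then have bd: "\<bar>f x\<bar> \<le> max B1 B2" "\<bar>g x\<bar> \<le> max B1 B2" if "x \<in> {0..1}" for x
    using that by (auto simp: le_max_iff_disj)
  define B where "B = max B1 B2"
  have B: "B \<ge> 0" using bd(1)[of 0] by (simp add: B_def)
  \<comment> \<open>Replacing f and g by p and q costs (2 B + 1) d once in \<open>pair_mean\<close>
    and once in the main term, together at most e. The cap 1 keeps p and q bounded by B + 1.\<close>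
  define d where "d = min 1 (e / (2 * (2 * B + 1)))"
  have d: "d > 0" "d \<le> 1" using e B by (auto simp: d_def)
  have "(2 * B + 1) * d \<le> (2 * B + 1) * (e / (2 * (2 * B + 1)))"
    using B by (intro mult_left_mono) (auto simp: d_def)
  moreover have "(2 * B + 1) * (e / (2 * (2 * B + 1))) = e / 2"
  proof -
    have "2 * B + 1 \<noteq> 0" using B by linarith
    then show ?thesis by (simp add: field_simps)
  qed
  ultimately have d2: "2 * ((2 * B + 1) * d) \<le> e" by linarith
  obtain p where p: "cospoly p" "\<And>x. x \<in> {0..1} \<Longrightarrow> \<bar>f x - p x\<bar> < d"
    using cospoly_approx[OF f d(1)] by blast
  obtain q where q: "cospoly q" "\<And>x. x \<in> {0..1} \<Longrightarrow> \<bar>g x - q x\<bar> < d"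
    using cospoly_approx[OF g d(1)] by blast
  have int: "f integrable_on {0..1}" "g integrable_on {0..1}" "p integrable_on {0..1}" "q integrable_on {0..1}"
    using f g p q by (auto intro: integrable_continuous_real cospoly_integrable)
  have Ibd: "\<bar>integral {0..1} h\<bar> \<le> K" if "h integrable_on {0..1}" "\<And>x. x \<in> {0..1} \<Longrightarrow> \<bar>h x\<bar> \<le> K" for h :: "real \<Rightarrow> real" and K
  proof -
    have "norm (integral {0..1} h) \<le> integral {0..1} (\<lambda>_::real. K)"
      using that by (intro integral_norm_bound_integral) auto
    then show ?thesis by simp
  qed
  have I: "\<bar>integral {0..1} f * integral {0..1} g - integral {0..1} p * integral {0..1} q\<bar> \<le> (2 * B + 1) * d"
  proof (rule abs_mult_diff_le)
    show "\<bar>integral {0..1} f\<bar> \<le> B" "\<bar>integral {0..1} g\<bar> \<le> B" using int bd by (auto intro!: Ibd simp: B_def)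
    have "\<bar>integral {0..1} (\<lambda>x. f x - p x)\<bar> \<le> d"
      using int p(2) by (intro Ibd integrable_diff) (auto intro: less_imp_le)
    then show "\<bar>integral {0..1} f - integral {0..1} p\<bar> \<le> d"
      using int by (simp add: Henstock_Kurzweil_Integration.integral_diff)
    have "\<bar>integral {0..1} (\<lambda>x. g x - q x)\<bar> \<le> d"
      using int q(2) by (intro Ibd integrable_diff) (auto intro: less_imp_le)
    then show "\<bar>integral {0..1} g - integral {0..1} q\<bar> \<le> d"
      using int by (simp add: Henstock_Kurzweil_Integration.integral_diff)
  qed (use d B in auto)
  define t where "t c = pair_mean p q c - real (totient c) / real c * (integral {0..1} p * integral {0..1} q)" for c
  have "mean_null t" unfolding t_def[abs_def] using equidistributed_cospoly[OF p(1) q(1)] unfolding equidistributed_def .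
  moreover have "\<bar>pair_mean f g c - real (totient c) / real c * (integral {0..1} f * integral {0..1} g)\<bar> \<le> \<bar>t c\<bar> + e" if c: "c \<ge> 1" for c
  proof -
    have "\<bar>pair_mean f g c - pair_mean p q c\<bar> \<le> (2 * B + 1) * d"
    proof -
      have "pair_mean f g c - pair_mean p q c = (\<Sum>z\<in>unit_pairs c. f (of_int (fst z) / real c) * g (of_int (snd z) / real c)
          - p (of_int (fst z) / real c) * q (of_int (snd z) / real c)) / real c"
        by (simp add: pair_mean_def sum_subtractf diff_divide_distrib)
      also have "\<bar>\<dots>\<bar> \<le> (\<Sum>z\<in>unit_pairs c. \<bar>f (of_int (fst z) / real c) * g (of_int (snd z) / real c)
          - p (of_int (fst z) / real c) * q (of_int (snd z) / real c)\<bar>) / real c"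
        unfolding abs_divide by (simp add: divide_right_mono)
      also have "\<dots> \<le> (\<Sum>z\<in>unit_pairs c. (2 * B + 1) * d) / real c"
      proof (intro divide_right_mono sum_mono)
        fix z assume "z \<in> unit_pairs c"
        note z = unit_pairs_frac[OF this]
        show "\<bar>f (of_int (fst z) / real c) * g (of_int (snd z) / real c)
          - p (of_int (fst z) / real c) * q (of_int (snd z) / real c)\<bar> \<le> (2 * B + 1) * d"
          by (rule abs_mult_diff_le) (use bd z p(2)[OF z(1)] q(2)[OF z(2)] d B in \<open>auto simp: B_def[symmetric]\<close>)
      qed simp
      also have "\<dots> = (real (card (unit_pairs c)) / real c) * ((2 * B + 1) * d)" by simp
      also have "\<dots> \<le> 1 * ((2 * B + 1) * d)"
        using card_unit_pairs_le[of c] c d B by (intro mult_right_mono) (auto simp: divide_le_eq_1)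
      finally show ?thesis by simp
    qed
    moreover have "\<bar>real (totient c) / real c * (integral {0..1} f * integral {0..1} g) -
        real (totient c) / real c * (integral {0..1} p * integral {0..1} q)\<bar> \<le> (2 * B + 1) * d"
    proof -
      have "\<bar>real (totient c) / real c * (integral {0..1} f * integral {0..1} g) -
          real (totient c) / real c * (integral {0..1} p * integral {0..1} q)\<bar> =
          real (totient c) / real c * \<bar>integral {0..1} f * integral {0..1} g - integral {0..1} p * integral {0..1} q\<bar>"
        by (simp only: right_diff_distrib[symmetric] abs_mult abs_of_nonneg[OF totient_ratio_01(1)])
      also have "\<dots> \<le> 1 * ((2 * B + 1) * d)"
        using I totient_ratio_01 by (intro mult_mono) auto
      finally show ?thesis by simp
    qed
    ultimately show ?thesis using d2 unfolding t_def
      by (rule abs_diff_le_add_diff)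
  qed
  ultimately show "\<exists>t. mean_null t \<and> (\<forall>c\<ge>1. \<bar>pair_mean f g c -
      real (totient c) / real c * (integral {0..1} f * integral {0..1} g)\<bar> \<le> \<bar>t c\<bar> + e)" by blast
qed

lemma integral_reflect_01:
  fixes f :: "real \<Rightarrow> real"
  assumes "f integrable_on {0..1}"
  shows "((\<lambda>x. f (1 - x)) has_integral integral {0..1} f) {0..1}"
proof -
  have "((\<lambda>x. f ((-1) *\<^sub>R x + 1)) has_integral (1 / \<bar>-1\<bar> ^ DIM(real)) *\<^sub>R integral {0..1} f)
      ((\<lambda>x. (1 / (-1)) *\<^sub>R x + - ((1 / (-1)) *\<^sub>R 1)) ` cbox 0 1)"
    by (rule has_integral_affinity) (use assms in \<open>auto intro: integrable_integral\<close>)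
  moreover have "(\<lambda>x. (1 / (-1)) *\<^sub>R x + - ((1 / (-1)) *\<^sub>R 1)) ` cbox 0 1 = {0..1 :: real}"
    by (auto simp: image_iff)
  ultimately show ?thesis by simp
qed

text \<open>For c >= 2 the map from (d, p) to (c - d, c - p) permutes the unit pairs. As g is
  symmetric, f may therefore be replaced by the average of f(x) and f(1 - x), which is symmetric as
  well.\<close>

lemma equidistributed_continuous:
  assumes f: "continuous_on {0..1} f"
    and g: "continuous_on {0..1} g" "\<And>x. x \<in> {0..1} \<Longrightarrow> g (1 - x) = g x"
  shows "equidistributed f g"
proof -
  define F where "F x = 1/2 * f x + 1/2 * f (1 - x)" for x
  have contr: "continuous_on {0..1} (\<lambda>x. f (1 - x))"
    by (rule continuous_on_compose2[OF f]) (auto intro!: continuous_intros)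
  have "equidistributed F g"
    using f g contr by (intro equidistributed_symmetric) (auto simp: F_def intro!: continuous_intros)
  moreover have "integral {0..1} F = integral {0..1} f"
  proof (rule integral_unique)
    have fi: "f integrable_on {0..1}" using f by (rule integrable_continuous_real)
    have "(F has_integral (1/2 * integral {0..1} f + 1/2 * integral {0..1} f)) {0..1}"
      unfolding F_def
      by (intro has_integral_add has_integral_mult_right integrable_integral fi integral_reflect_01)
    then show "(F has_integral integral {0..1} f) {0..1}" by simp
  qed
  moreover have "\<forall>\<^sub>F c in sequentially. pair_mean f g c - pair_mean F g c = 0"
    using eventually_ge_at_top[of 2]
  proof eventually_elim
    case (elim c)
    have "pair_mean (\<lambda>x. f (1 - x)) g c = pair_mean f g c"
    proof -
      have mem: "(int c - fst z, int c - snd z) \<in> unit_pairs c" if z: "z \<in> unit_pairs c" for z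
      proof -
        have "0 < fst z \<and> 0 < snd z"
          using z elim by (cases "fst z = 0"; cases "snd z = 0") (auto simp: unit_pairs_def cong_def)
        moreover have "[(int c - fst z) * (int c - snd z) = (0 - fst z) * (0 - snd z)] (mod int c)"
          by (intro cong_mult cong_diff) (auto simp: cong_def)
        then have "[(int c - fst z) * (int c - snd z) = 1] (mod int c)"
          using z by (auto simp: unit_pairs_def intro: cong_trans)
        ultimately show ?thesis using z by (auto simp: unit_pairs_def)
      qed
      have "(\<Sum>z\<in>unit_pairs c. f (1 - of_int (fst z) / real c) * g (of_int (snd z) / real c)) =
          (\<Sum>z\<in>unit_pairs c. f (of_int (fst z) / real c) * g (of_int (snd z) / real c))"
      proof (rule sum.reindex_bij_witness[of _ "\<lambda>z. (int c - fst z, int c - snd z)" "\<lambda>z. (int c - fst z, int c - snd z)"])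
        fix z assume z: "z \<in> unit_pairs c"
        have "of_int (int c - snd z) / real c = 1 - of_int (snd z) / real c"
          "of_int (int c - fst z) / real c = 1 - of_int (fst z) / real c"
          using elim by (simp_all add: field_simps)
        then show "f (of_int (fst (int c - fst z, int c - snd z)) / real c) * g (of_int (snd (int c - fst z, int c - snd z)) / real c) =
           f (1 - of_int (fst z) / real c) * g (of_int (snd z) / real c)"
          using g(2)[OF unit_pairs_frac(2)[OF z]] by simp
      qed (auto intro: mem)
      then show ?thesis by (simp add: pair_mean_def)
    qed
    moreover have "pair_mean F g c = 1/2 * pair_mean f g c + 1/2 * pair_mean (\<lambda>x. f (1 - x)) g c"
    proof -
      have "(\<Sum>z\<in>unit_pairs c. F (of_int (fst z) / real c) * g (of_int (snd z) / real c)) =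
          1/2 * (\<Sum>z\<in>unit_pairs c. f (of_int (fst z) / real c) * g (of_int (snd z) / real c)) +
          1/2 * (\<Sum>z\<in>unit_pairs c. f (1 - of_int (fst z) / real c) * g (of_int (snd z) / real c))"
        by (simp only: F_def distrib_right sum.distrib sum_distrib_left mult.assoc)
      then show ?thesis by (simp only: pair_mean_def add_divide_distrib times_divide_eq_right)
    qed
    ultimately show ?case by simp
  qed
  then have "mean_null (\<lambda>c. pair_mean f g c - pair_mean F g c)"
    by (intro mean_null_tendsto_0 tendsto_eventually)
  ultimately show ?thesis
    using mean_null_add[of "\<lambda>c. pair_mean f g c - pair_mean F g c"
        "\<lambda>c. pair_mean F g c - real (totient c) / real c * (integral {0..1} F * integral {0..1} g)"]
    by (simp add: equidistributed_def)
qed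

text \<open>As g is nonnegative, \<open>pair_mean\<close> is monotone in its first function. Hence
  the error for f is at most the errors for l and u plus the gap between their integrals times the
  integral of g.\<close>

lemma equidistributed_sandwich:
  assumes f: "f integrable_on {0..1}"
    and sand: "\<And>e. e > 0 \<Longrightarrow> \<exists>l u. equidistributed l g \<and> equidistributed u g \<and> l integrable_on {0..1} \<and> u integrable_on {0..1} \<and>
      (\<forall>x\<in>{0..1}. l x \<le> f x \<and> f x \<le> u x) \<and> integral {0..1} u - integral {0..1} l \<le> e"
    and g: "\<And>x. x \<in> {0..1} \<Longrightarrow> g x \<ge> 0" "g integrable_on {0..1}"
  shows "equidistributed f g"
  unfolding equidistributed_def
proof (rule mean_null_approx)
  fix e :: real assume e: "e > 0"
  define I where "I = integral {0..1} g"
  have I: "I \<ge> 0" unfolding I_def by (rule Henstock_Kurzweil_Integration.integral_nonneg) (use g in auto)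
  \<comment> \<open>The integral I of g may vanish, so the gap is taken as e / (I + 1) rather than e
    / I.\<close>
  have "e / (I + 1) > 0" using e I by auto
  then obtain l u where lu: "equidistributed l g" "equidistributed u g" "l integrable_on {0..1}" "u integrable_on {0..1}"
    "\<And>x. x \<in> {0..1} \<Longrightarrow> l x \<le> f x" "\<And>x. x \<in> {0..1} \<Longrightarrow> f x \<le> u x" "integral {0..1} u - integral {0..1} l \<le> e / (I + 1)"
    using sand by meson
  define L U M where "L = integral {0..1} l" and "U = integral {0..1} u" and "M = integral {0..1} f"
  have LMU: "L \<le> M" "M \<le> U"
    using lu f unfolding L_def U_def M_def by (auto intro!: integral_le)
  have UL: "(U - L) * I \<le> e"
  proof -
    have "(U - L) * I \<le> e / (I + 1) * I" using lu(7) I by (intro mult_right_mono) (auto simp: U_def L_def)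
    also have "\<dots> \<le> e" using I e by (simp add: field_simps)
    finally show ?thesis .
  qed
  define tl tu where "tl c = pair_mean l g c - real (totient c) / real c * (L * I)"
    and "tu c = pair_mean u g c - real (totient c) / real c * (U * I)" for c
  have "mean_null tl" unfolding tl_def[abs_def] L_def I_def using lu(1) unfolding equidistributed_def .
  moreover have "mean_null tu" unfolding tu_def[abs_def] U_def I_def using lu(2) unfolding equidistributed_def .
  ultimately have "mean_null (\<lambda>c. \<bar>tl c\<bar> + \<bar>tu c\<bar>)" by (intro mean_null_add) (simp_all add: mean_null_def)
  moreover have "\<bar>pair_mean f g c - real (totient c) / real c * (M * I)\<bar> \<le> \<bar>\<bar>tl c\<bar> + \<bar>tu c\<bar>\<bar> + e" if "c \<ge> 1" for c
  proof -
    have mono: "pair_mean h1 g c \<le> pair_mean h2 g c" if "\<And>x. x \<in> {0..1} \<Longrightarrow> h1 x \<le> h2 x" for h1 h2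
      unfolding pair_mean_def using that g(1) unit_pairs_frac
      by (intro divide_right_mono sum_mono mult_right_mono) auto
    have m: "pair_mean l g c \<le> pair_mean f g c" "pair_mean f g c \<le> pair_mean u g c" using lu mono by auto
    define r where "r = real (totient c) / real c"
    have r: "0 \<le> r" "r \<le> 1" using totient_ratio_01 by (auto simp: r_def)
    have "r * (U * I) - r * (M * I) = r * ((U - M) * I)" "r * (M * I) - r * (L * I) = r * ((M - L) * I)"
      by (simp_all add: algebra_simps)
    moreover have "r * ((U - M) * I) \<le> 1 * ((U - L) * I)" "r * ((M - L) * I) \<le> 1 * ((U - L) * I)"
      using r LMU I by (intro mult_mono mult_right_mono; simp)+
    ultimately show ?thesis using m UL unfolding tl_def tu_def r_def[symmetric] by linarith
  qed
  ultimately show "\<exists>t. mean_null t \<and> (\<forall>c\<ge>1. \<bar>pair_mean f g c -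
      real (totient c) / real c * (integral {0..1} f * integral {0..1} g)\<bar> \<le> \<bar>t c\<bar> + e)"
    unfolding M_def I_def by blast
qed

lemma integral_indicator_Icc_le:
  fixes a b :: real
  assumes "a \<le> b"
  shows "(\<lambda>x. indicator {a..b} x :: real) integrable_on {0..1}" "integral {0..1} (\<lambda>x. indicator {a..b} x :: real) \<le> b - a"
proof -
  have eq: "{0..1} \<inter> {a..b} = {max 0 a..min 1 b}" by auto
  have "((\<lambda>_. 1 :: real) has_integral (measure lborel {max 0 a..min 1 b} *\<^sub>R 1)) {max 0 a..min 1 b}"
    using has_integral_const_real[of "1 :: real" "max 0 a" "min 1 b"] by simp
  then have "((\<lambda>x. if x \<in> {a..b} then 1 else 0) has_integral (measure lborel {max 0 a..min 1 b})) {0..1}"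
    by (subst has_integral_restrict_Int) (simp add: eq Int_commute)
  then have h: "((\<lambda>x. indicator {a..b} x :: real) has_integral (measure lborel {max 0 a..min 1 b})) {0..1}"
    by (simp add: indicator_def of_bool_def)
  then show "(\<lambda>x. indicator {a..b} x :: real) integrable_on {0..1}" by blast
  show "integral {0..1} (\<lambda>x. indicator {a..b} x :: real) \<le> b - a"
    unfolding integral_unique[OF h] using assms by (auto simp: content_real_if min_def max_def)
qed

text \<open>The two inclusions for J admit every choice of endpoints. The indicator of J lies
  between two trapezoids that differ only within d of u or v; multiplied by w they are
  continuous.\<close>

lemma equidistributed_interval:
  assumes uv: "0 \<le> u" "u \<le> v" "v \<le> 1" and J: "{u<..<v} \<subseteq> J" "J \<subseteq> {u..v}"
    and w: "continuous_on {0..1} w" "\<And>x. x \<in> {0..1} \<Longrightarrow> w x \<ge> 0"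
    and g: "continuous_on {0..1} g" "\<And>x. x \<in> {0..1} \<Longrightarrow> g (1 - x) = g x" "\<And>x. x \<in> {0..1} \<Longrightarrow> g x \<ge> 0"
  shows "mean_null (\<lambda>c. pair_mean (\<lambda>x. indicator J x * w x) g c -
     real (totient c) / real c * (integral {u..v} w * integral {0..1} g))"
proof -
  define f where "f x = indicator J x * w x" for x
  have fint: "(f has_integral integral {u..v} w) {0..1}"
  proof (rule has_integral_spike_finite[of "{u, v}"])
    show "f x = (if x \<in> {u..v} then w x else 0)" if "x \<in> {0..1} - {u, v}" for x
    proof -
      have "x \<in> {u..v} \<Longrightarrow> x \<in> {u<..<v}" using that by auto
      with J have "x \<in> J \<longleftrightarrow> x \<in> {u..v}" by blast
      then show ?thesis by (simp add: f_def indicator_def)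
    qed
    have "(w has_integral integral {u..v} w) {u..v}"
    proof (rule integrable_integral)
      show "w integrable_on {u..v}"
        by (rule integrable_continuous_real, rule continuous_on_subset[OF w(1)]) (use uv in auto)
    qed
    moreover have "{u..v} \<inter> {0..1} = {u..v}" using uv by auto
    ultimately show "((\<lambda>x. if x \<in> {u..v} then w x else 0) has_integral integral {u..v} w) {0..1}"
      by (subst has_integral_restrict_Int) (simp only: )
  qed simp
  obtain B where B: "\<And>x. x \<in> {0..1} \<Longrightarrow> w x \<le> B" "B > 0"
  proof -
    have "bounded (w ` {0..1})" using w by (auto intro!: compact_imp_bounded compact_continuous_image)
    then obtain B where B: "\<forall>x\<in>{0..1}. \<bar>w x\<bar> \<le> B" unfolding bounded_iff by (auto simp del: atLeastAtMost_iff)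
    have "w x \<le> max B 1" if "x \<in> {0..1}" for x using B[rule_format, OF that] by linarith
    then show ?thesis using that[of "max B 1"] by simp
  qed
  have "equidistributed f g"
  proof (rule equidistributed_sandwich)
    show "f integrable_on {0..1}" using fint by blast
    show "g integrable_on {0..1}" using g(1) by (rule integrable_continuous_real)
    fix e :: real assume e: "e > 0"
    \<comment> \<open>Two windows of length 2 d, on which the trapezoids differ by at most 1 and w
      is at most B, leave a gap of 4 B d = e.\<close>
    define d where "d = e / (4 * B)"
    have d: "d > 0" "B * (2 * d + 2 * d) = e" using e B by (auto simp: d_def field_simps)
    define tu tl where "tu x = max 0 (min 1 (min ((x - u) / d + 1) ((v - x) / d + 1)))"
      and "tl x = max 0 (min 1 (min ((x - u) / d) ((v - x) / d)))" for x
    define lo hi where "lo x = tl x * w x" and "hi x = tu x * w x" for x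
    have cont: "continuous_on {0..1} lo" "continuous_on {0..1} hi"
      unfolding lo_def hi_def tl_def tu_def using d by (auto intro!: continuous_intros w)
    have int: "lo integrable_on {0..1}" "hi integrable_on {0..1}"
      using cont by (auto intro: integrable_continuous_real)
    have t: "tl x \<le> indicator J x" "indicator J x \<le> tu x" for x
    proof -
      show "tl x \<le> indicator J x"
      proof (cases "x \<in> J")
        case False
        then have "\<not> (u < x \<and> x < v)" using J(1) by auto
        then have "(x - u) / d \<le> 0 \<or> (v - x) / d \<le> 0" using d by (auto simp: divide_le_0_iff)
        then show ?thesis using False by (auto simp: tl_def)
      qed (simp add: tl_def)
      show "indicator J x \<le> tu x"
      proof (cases "x \<in> J")
        case True
        then have "u \<le> x" "x \<le> v" using J(2) by auto
        then have "0 \<le> (x - u) / d" "0 \<le> (v - x) / d" using d by auto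
        then show ?thesis by (simp add: tu_def)
      qed (simp add: tu_def)
    qed
    have tdiff: "tu x - tl x \<le> indicator {u - d..u + d} x + indicator {v - d..v + d} x" for x
    proof -
      have "0 \<le> tl x" "tu x \<le> 1" by (auto simp: tl_def tu_def)
      moreover have "tu x = 0" if "x < u - d \<or> v + d < x"
      proof -
        have "(x - u) / d \<le> -1 \<or> (v - x) / d \<le> -1" using that d by (auto simp: pos_divide_le_eq)
        then show ?thesis by (auto simp: tu_def)
      qed
      moreover have "tl x = 1" if "u + d < x" "x < v - d"
      proof -
        have "1 \<le> (x - u) / d" "1 \<le> (v - x) / d" using that d by (auto simp: pos_le_divide_eq)
        then show ?thesis by (auto simp: tl_def)
      qed
      moreover have "tl x \<ge> 0" by (simp add: tl_def)
      ultimately show ?thesis by (force simp: indicator_def)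
    qed
    have "integral {0..1} hi - integral {0..1} lo = integral {0..1} (\<lambda>x. hi x - lo x)"
      using int by (simp add: Henstock_Kurzweil_Integration.integral_diff)
    also have "\<dots> \<le> integral {0..1} (\<lambda>x. B * (indicator {u - d..u + d} x + indicator {v - d..v + d} x))"
    proof (rule integral_le)
      fix x :: real assume x: "x \<in> {0..1}"
      have "hi x - lo x = (tu x - tl x) * w x" by (simp add: hi_def lo_def left_diff_distrib)
      also have "\<dots> \<le> (indicator {u - d..u + d} x + indicator {v - d..v + d} x) * w x"
        using tdiff w(2)[OF x] by (intro mult_right_mono)
      also have "\<dots> \<le> (indicator {u - d..u + d} x + indicator {v - d..v + d} x) * B"
        using B(1)[OF x] by (intro mult_left_mono) auto
      finally show "hi x - lo x \<le> B * (indicator {u - d..u + d} x + indicator {v - d..v + d} x)"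
        by (simp add: mult.commute)
    qed (use int d in \<open>auto intro!: integrable_diff integrable_add integrable_on_mult_right integral_indicator_Icc_le\<close>)
    also have "\<dots> = B * (integral {0..1} (indicator {u - d..u + d} :: real \<Rightarrow> real) + integral {0..1} (indicator {v - d..v + d} :: real \<Rightarrow> real))"
      using d by (simp add: Henstock_Kurzweil_Integration.integral_add integral_indicator_Icc_le)
    also have "\<dots> \<le> B * (2 * d + 2 * d)"
      using integral_indicator_Icc_le(2)[of "u - d" "u + d"] integral_indicator_Icc_le(2)[of "v - d" "v + d"] d B
      by (intro mult_left_mono add_mono) auto
    finally have "integral {0..1} hi - integral {0..1} lo \<le> e" using d by simp
    moreover have "equidistributed lo g" "equidistributed hi g" using cont g by (auto intro: equidistributed_continuous)
    moreover have "lo x \<le> f x \<and> f x \<le> hi x" if "x \<in> {0..1}" for x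
      using t[of x] w(2)[OF that] by (auto simp: lo_def hi_def f_def intro: mult_right_mono)
    ultimately show "\<exists>l u. equidistributed l g \<and> equidistributed u g \<and> l integrable_on {0..1} \<and> u integrable_on {0..1} \<and>
      (\<forall>x\<in>{0..1}. l x \<le> f x \<and> f x \<le> u x) \<and> integral {0..1} u - integral {0..1} l \<le> e"
      using int by blast
  qed (use g in auto)
  then show ?thesis using integral_unique[OF fint] unfolding equidistributed_def f_def by simp
qed

section \<open>Consecutive denominators\<close>

definition irr01 :: "real set" where "irr01 = {0<..<1} - \<rat>"

lemma irr01D: "\<alpha> \<in> irr01 \<Longrightarrow> \<alpha> \<in> {0<..<1}" "\<alpha> \<in> irr01 \<Longrightarrow> \<alpha> \<notin> \<rat>"
  by (auto simp: irr01_def)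

lemma cf_q_mono: "\<alpha> \<in> irr01 \<Longrightarrow> m \<le> n \<Longrightarrow> cf_q \<alpha> m \<le> cf_q \<alpha> n"
proof (rule lift_Suc_mono_le[of "cf_q \<alpha>"])
  fix n assume \<alpha>: "\<alpha> \<in> irr01"
  show "cf_q \<alpha> n \<le> cf_q \<alpha> (Suc n)"
  proof (cases n)
    case 0
    then show ?thesis using cf_q_ge[OF irr01D[OF \<alpha>], of 1] by simp
  next
    case (Suc k)
    have "1 * cf_q \<alpha> (Suc k) \<le> cf_entry \<alpha> (Suc (Suc k)) * cf_q \<alpha> (Suc k)"
      by (intro mult_le_mono1 cf_entry_ge_1 irr01D \<alpha>)
    then show ?thesis unfolding Suc cf_q.simps by linarith
  qed
qed

text \<open>Since q_0 = 1 <= R, the index n_R is positive and a preceding denominator exists; q_n >=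
  n provides an index beyond R.\<close>

lemma cf_n_props:
  assumes \<alpha>: "\<alpha> \<in> irr01" and R: "R \<ge> 1"
  obtains n where "cf_n R \<alpha> = Suc n" "real (cf_q \<alpha> n) \<le> R" "R < real (cf_q \<alpha> (Suc n))"
proof -
  have ex: "real (cf_q \<alpha> (nat \<lceil>R\<rceil> + 1)) > R"
  proof -
    have "nat \<lceil>R\<rceil> + 1 \<le> cf_q \<alpha> (nat \<lceil>R\<rceil> + 1)" using cf_q_ge[OF irr01D[OF \<alpha>]] by blast
    then show ?thesis by linarith
  qed
  have L: "real (cf_q \<alpha> (cf_n R \<alpha>)) > R" 
    unfolding cf_n_def using LeastI[of "\<lambda>n. real (cf_q \<alpha> n) > R", OF ex] .
  then have "cf_n R \<alpha> \<noteq> 0" using R by (metis cf_q.simps(1) not_le of_nat_1)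
  then obtain n where n: "cf_n R \<alpha> = Suc n" by (cases "cf_n R \<alpha>") auto
  moreover have "\<not> real (cf_q \<alpha> n) > R"
    by (rule not_less_Least) (use n in \<open>simp add: cf_n_def[symmetric]\<close>)
  ultimately show ?thesis using that[of n] L by simp
qed

lemma cf_n_eqI:
  assumes \<alpha>: "\<alpha> \<in> irr01" and "real (cf_q \<alpha> n) \<le> R" "R < real (cf_q \<alpha> (Suc n))"
  shows "cf_n R \<alpha> = Suc n"
  unfolding cf_n_def
proof (rule Least_equality)
  fix m assume "real (cf_q \<alpha> m) > R"
  then have "\<not> m \<le> n" using cf_q_mono[OF \<alpha>, of m n] assms by (meson le_less_trans not_less of_nat_le_iff order_trans)
  then show "Suc n \<le> m" by simp
qed (use assms in simp)

lemma cf_p_le_cf_q: "\<alpha> \<in> irr01 \<Longrightarrow> cf_p \<alpha> n \<le> cf_q \<alpha> n"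
proof (induction n rule: less_induct)
  case (less n)
  consider "n = 0" | "n = 1" | k where "n = Suc (Suc k)"
    by (metis One_nat_def not0_implies_Suc)
  then show ?case
  proof cases
    case 2
    then show ?thesis using cf_entry_ge_1[OF irr01D[OF less.prems], of 1] by simp
  next
    case 3
    then show ?thesis using less by (simp add: add_mono)
  qed simp
qed

text \<open>Here d and c are consecutive denominators. The parity of their position is recorded
  because it decides on which side of the convergent with denominator c the number \<alpha> lies.
  For d a unit modulo c >= 2, either parity gives one interval without its rationals
  (\<open>cf_pair_set_interval_eq\<close>).\<close>

definition cf_pair_set :: "int \<Rightarrow> nat \<Rightarrow> int \<Rightarrow> real set" where
  "cf_pair_set \<epsilon> c d = {\<alpha> \<in> irr01. \<exists>n. cf_q \<alpha> (Suc n) = c \<and> int (cf_q \<alpha> n) = d \<and> (-1) ^ n = \<epsilon>}"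

lemma cf_tail_decomposition:
  assumes "\<alpha> \<in> irr01"
  obtains t where "0 < t" "t < 1"
    "\<alpha> = (real (cf_p \<alpha> (Suc n)) + t * real (cf_p \<alpha> n)) / (real (cf_q \<alpha> (Suc n)) + t * real (cf_q \<alpha> n))"
proof (rule that[of "(gauss_map ^^ Suc n) \<alpha>"])
  note \<alpha> = irr01D[OF assms]
  have t: "0 < (gauss_map ^^ Suc n) \<alpha>" "(gauss_map ^^ Suc n) \<alpha> < 1"
    using gauss_map_iterate[OF \<alpha>, of "Suc n"] by auto
  then show "0 < (gauss_map ^^ Suc n) \<alpha>" "(gauss_map ^^ Suc n) \<alpha> < 1" .
  show "\<alpha> = (real (cf_p \<alpha> (Suc n)) + (gauss_map ^^ Suc n) \<alpha> * real (cf_p \<alpha> n)) /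
      (real (cf_q \<alpha> (Suc n)) + (gauss_map ^^ Suc n) \<alpha> * real (cf_q \<alpha> n))"
    unfolding cf_eval_convergents[OF \<alpha> less_imp_le[OF t(1)], symmetric]
    by (rule cf_eval_tail[OF \<alpha>, symmetric])
qed

text \<open>With t the remaining Gauss iterate, the signed distance equals t/(q' (q' + t q)). This
  grows with t and stays below its value 1/(q' (q' + q)) at t = 1.\<close>

lemma cf_pair_set_interval:
  assumes "\<alpha> \<in> irr01" "cf_q \<alpha> (Suc n) = c" "int (cf_q \<alpha> n) = d"
  shows "0 < (-1) ^ n * (real (cf_p \<alpha> (Suc n)) / real c - \<alpha>)"
    "(-1) ^ n * (real (cf_p \<alpha> (Suc n)) / real c - \<alpha>) < 1 / (real c * (real c + of_int d))"
proof -
  note \<alpha> = irr01D[OF assms(1)]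
  obtain t where t: "0 < t" "t < 1" and \<alpha>_eq:
    "\<alpha> = (real (cf_p \<alpha> (Suc n)) + t * real (cf_p \<alpha> n)) / (real (cf_q \<alpha> (Suc n)) + t * real (cf_q \<alpha> n))"
    using cf_tail_decomposition[OF assms(1)] .
  define p p' q q' where "p = real (cf_p \<alpha> n)" and "p' = real (cf_p \<alpha> (Suc n))"
    and "q = real (cf_q \<alpha> n)" and "q' = real (cf_q \<alpha> (Suc n))"
  have q: "1 \<le> q" "1 \<le> q'"
    using cf_q_ge[OF \<alpha>, of n] cf_q_ge[OF \<alpha>, of "Suc n"]
    by (auto simp: q_def q'_def simp del: cf_q.simps)
  have eq: "\<alpha> = (p' + t * p) / (q' + t * q)"
    using \<alpha>_eq by (simp only: p_def p'_def q_def q'_def)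
  have pos: "q' + t * q > 0" "q' > 0" using t q by (auto intro: add_pos_pos)
  have "p' / q' - \<alpha> = p' / q' - (p' + t * p) / (q' + t * q)" using eq by simp
  also have "\<dots> = (p' * (q' + t * q) - (p' + t * p) * q') / (q' * (q' + t * q))"
    using pos by (subst diff_frac_eq) auto
  also have "p' * (q' + t * q) - (p' + t * p) * q' = t * (p' * q - p * q')"
    by (simp add: algebra_simps)
  also have "p' * q - p * q' = (-1) ^ n"
    using arg_cong[OF cf_det[of \<alpha> n], of real_of_int] by (simp add: p_def p'_def q_def q'_def)
  finally have "(-1) ^ n * (p' / q' - \<alpha>) = (-1) ^ n * (-1) ^ n * (t / (q' * (q' + t * q)))" by simp
  also have "(-1) ^ n * (-1) ^ n = (1 :: real)" by (simp flip: power_mult_distrib)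
  finally have *: "(-1) ^ n * (p' / q' - \<alpha>) = t / (q' * (q' + t * q))" by simp
  have cd: "real c = q'" "real_of_int d = q" using assms(2,3) by (auto simp: q_def q'_def simp del: cf_q.simps)
  show "0 < (-1) ^ n * (real (cf_p \<alpha> (Suc n)) / real c - \<alpha>)"
    using * t pos by (simp add: cd p'_def[symmetric])
  have "t * (q' + q) < q' + t * q" using t pos by (simp add: distrib_left)
  then have "q' * (t * (q' + q)) < q' * (q' + t * q)" using pos(2) by (rule mult_strict_left_mono)
  then have "t * (q' * (q' + q)) < q' * (q' + t * q)" by (simp add: mult.left_commute)
  then have "t / (q' * (q' + t * q)) < 1 / (q' * (q' + q))"
    using pos q by (intro mult_imp_div_pos_less mult_pos_pos) (auto simp: pos_less_divide_eq)
  then show "(-1) ^ n * (real (cf_p \<alpha> (Suc n)) / real c - \<alpha>) < 1 / (real c * (real c + of_int d))"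
    using * by (simp add: cd p'_def[symmetric])
qed

lemma gauss_map_funpow_Suc: "(gauss_map ^^ Suc n) \<alpha> = gauss_map ((gauss_map ^^ n) \<alpha>)"
  by simp

text \<open>The Euclidean algorithm run on (c, d): with c = a d + e, the pair (d, e) and the tail
  1/(a + t) describe the same \<alpha> with the opposite sign, and a is the next entry. At d = 1 the
  sign selects between an expansion that starts with c and one that starts with 1, c - 1; their
  lengths have opposite parity.\<close>

lemma cf_pair_exists:
  fixes c d p p' \<epsilon> :: int and t \<alpha> :: real
  assumes "1 \<le> d" "d < c" "0 \<le> p" "p \<le> c" "0 \<le> p'" "p' \<le> d" "\<epsilon> = 1 \<or> \<epsilon> = -1" "p * d - p' * c = \<epsilon>"
    and "0 < t" "t < 1" "\<alpha> = (of_int p + t * of_int p') / (of_int c + t * of_int d)"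
  shows "\<exists>n. int (cf_q \<alpha> (Suc n)) = c \<and> int (cf_q \<alpha> n) = d \<and> (gauss_map ^^ Suc n) \<alpha> = t \<and> (-1) ^ n = \<epsilon>"
  using assms
proof (induction "nat d" arbitrary: c d p p' \<epsilon> t rule: less_induct)
  case less
  have fl: "\<lfloor>of_int a + t\<rfloor> = a" for a using less.prems by (simp add: floor_eq_iff)
  have gm: "gauss_map (1 / (of_int a + t)) = t" for a
    unfolding gauss_map_def frac_def using fl[of a] by simp
  show ?case
  proof (cases "d = 1")
    case d1: True
    show ?thesis
    proof (cases "p' = 0")
      case True
      then have "p = 1" "\<epsilon> = 1" using less.prems d1 by auto
      then have \<alpha>: "\<alpha> = 1 / (of_int c + t)" using less.prems d1 True by simp
      then have "cf_entry \<alpha> 1 = nat c" using fl[of c] by (simp add: cf_entry_def)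
      moreover have "gauss_map \<alpha> = t" using \<alpha> gm by simp
      ultimately show ?thesis using less.prems \<open>\<epsilon> = 1\<close> d1 by (intro exI[of _ 0]) auto
    next
      case False
      then have p': "p' = 1" using less.prems d1 by auto
      then have \<epsilon>: "\<epsilon> = -1" "p = c - 1" using less.prems d1 by auto
      have c: "of_int c + t > 0" "of_int c - 1 + t > 1" using less.prems d1 by linarith+
      have \<alpha>: "\<alpha> = (of_int c - 1 + t) / (of_int c + t)" using less.prems d1 p' \<epsilon> by simp
      then have "1 / \<alpha> = (of_int c + t) / (of_int c - 1 + t)" by simp
      also have "\<dots> = ((of_int c - 1 + t) + 1) / (of_int c - 1 + t)" by simp
      also have "\<dots> = of_int 1 + 1 / (of_int (c - 1) + t)"
        using c by (subst add_divide_distrib) simp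
      finally have inv: "1 / \<alpha> = of_int 1 + 1 / (of_int (c - 1) + t)" .
      have s: "0 < 1 / (of_int (c - 1) + t)" "1 / (of_int (c - 1) + t) < 1" using c by auto
      have fl1: "\<lfloor>1 / \<alpha>\<rfloor> = 1" unfolding inv using s by (simp add: floor_eq_iff)
      have g: "gauss_map \<alpha> = 1 / (of_int (c - 1) + t)"
        unfolding gauss_map_def frac_def fl1 using inv by simp
      have e1: "cf_entry \<alpha> 1 = 1" using fl1 by (simp add: cf_entry_def)
      have e2: "cf_entry \<alpha> (Suc (Suc 0)) = nat (c - 1)" using fl[of "c - 1"] by (simp add: cf_entry_def g)
      have "gauss_map (gauss_map \<alpha>) = t" unfolding g by (rule gm)
      then show ?thesis using less.prems \<epsilon> d1 e1 e2 by (intro exI[of _ 1]) auto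
    qed
  next
    case False
    then have d: "d \<ge> 2" using less.prems by simp
    define a e where "a = c div d" and "e = c mod d"
    have c: "c = a * d + e" by (simp add: a_def e_def)
    have e: "0 \<le> e" "e < d" using d by (auto simp: e_def)
    have a: "a \<ge> 1" using less.prems d by (simp add: a_def pos_imp_zdiv_pos_iff) (simp add: Suc_le_eq int_one_le_iff_zero_less pos_imp_zdiv_pos_iff)
    \<comment> \<open>The numerator before p' in the recursion p = a p' + p''. Its bounds 0 and e
      follow from p'' d = \<epsilon> + p' e, because d >= 2 exceeds the absolute value of
      \<epsilon>.\<close>
    define p'' where "p'' = p - a * p'"
    have det: "p'' * d - p' * e = \<epsilon>" using less.prems by (simp add: p''_def c algebra_simps)
    have "e \<noteq> 0"
    proof
      assume "e = 0"
      then have "p'' * d = \<epsilon>" using det by simp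
      then have "\<bar>d\<bar> = 1" using less.prems(7) by (metis abs_minus_cancel abs_mult abs_zmult_eq_1 abs_1 mult.commute)
      then show False using d by simp
    qed
    then have e1: "1 \<le> e" using e by simp
    have p''0: "0 \<le> p''"
    proof (rule ccontr)
      assume "\<not> 0 \<le> p''"
      then have "p'' * d \<le> (-1) * d" using d by (intro mult_right_mono) auto
      moreover have "p' * e \<ge> 0" using less.prems e by simp
      ultimately show False using det d less.prems(7) by linarith
    qed
    have p''e: "p'' \<le> e"
    proof (rule ccontr)
      assume "\<not> p'' \<le> e"
      then have "(e + 1) * d \<le> p'' * d" using d by (intro mult_right_mono) auto
      moreover have "p' * e \<le> d * e" using less.prems e by (intro mult_right_mono) auto
      ultimately show False using det d less.prems(7) by (auto simp: algebra_simps)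
    qed
    define t' where "t' = 1 / (of_int a + t)"
    have at: "of_int a + t > 1" using a less.prems(9) by linarith
    have att: "(of_int a + t) * t' = 1" using at by (simp add: t'_def)
    have t': "0 < t'" "t' < 1" using at by (auto simp: t'_def)
    have "\<alpha> = (of_int p' + t' * of_int p'') / (of_int d + t' * of_int e)"
    proof -
      have "(of_int p' + t' * of_int p'') / (of_int d + t' * of_int e) =
          ((of_int a + t) * (of_int p' + t' * of_int p'')) / ((of_int a + t) * (of_int d + t' * of_int e))"
        using at by simp
      also have "(of_int a + t) * (of_int p' + t' * of_int p'') = of_int p + t * of_int p'"
      proof -
        have "(of_int a + t) * (of_int p' + t' * of_int p'') = (of_int a + t) * of_int p' + ((of_int a + t) * t') * of_int p''"
          by (simp only: distrib_left mult.assoc)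
        then show ?thesis unfolding att by (simp add: p''_def algebra_simps)
      qed
      also have "(of_int a + t) * (of_int d + t' * of_int e) = of_int c + t * of_int d"
      proof -
        have "(of_int a + t) * (of_int d + t' * of_int e) = (of_int a + t) * of_int d + ((of_int a + t) * t') * of_int e"
          by (simp only: distrib_left mult.assoc)
        then show ?thesis unfolding att by (simp add: c algebra_simps)
      qed
      finally show ?thesis using less.prems by simp
    qed
    then have "\<exists>n. int (cf_q \<alpha> (Suc n)) = d \<and> int (cf_q \<alpha> n) = e \<and> (gauss_map ^^ Suc n) \<alpha> = t' \<and> (-1) ^ n = - \<epsilon>"
      using less.prems e e1 p''0 p''e t' det d
      by (intro less.hyps[of e d p' p'' "-\<epsilon>" t']) auto
    then obtain n where n: "int (cf_q \<alpha> (Suc n)) = d" "int (cf_q \<alpha> n) = e" "(gauss_map ^^ Suc n) \<alpha> = t'" "(-1) ^ n = - \<epsilon>"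
      by blast
    have "cf_entry \<alpha> (Suc (Suc n)) = nat a"
      unfolding cf_entry_def using n(3) fl[of a] by (simp add: t'_def)
    then have "int (cf_q \<alpha> (Suc (Suc n))) = c" using n a by (simp add: c)
    moreover have "(gauss_map ^^ Suc (Suc n)) \<alpha> = t"
      unfolding gauss_map_funpow_Suc[of "Suc n"] n(3) t'_def by (rule gm)
    ultimately show ?thesis using n by (intro exI[of _ "Suc n"]) (auto simp del: funpow.simps)
  qed
qed

lemma cf_pair_exists_interval:
  fixes c d p p' \<epsilon> :: int and \<alpha> :: real
  assumes "1 \<le> d" "d < c" "0 \<le> p" "p \<le> c" "0 \<le> p'" "p' \<le> d" "\<epsilon> = 1 \<or> \<epsilon> = -1" "p * d - p' * c = \<epsilon>"
    and s: "0 < of_int \<epsilon> * (of_int p / of_int c - \<alpha>)"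
      "of_int \<epsilon> * (of_int p / of_int c - \<alpha>) < 1 / (of_int c * (of_int c + of_int d))"
  shows "\<exists>n. int (cf_q \<alpha> (Suc n)) = c \<and> int (cf_q \<alpha> n) = d \<and> (-1) ^ n = \<epsilon>"
proof -
  define C D P P' E where "C = real_of_int c" "D = real_of_int d" "P = real_of_int p" "P' = real_of_int p'" "E = real_of_int \<epsilon>"
  note defs = this
  have CD: "C > 0" "D > 0" using assms by (auto simp: defs)
  have E: "E * E = 1" using assms(7) by (auto simp: defs)
  have det: "P * D - P' * C = E" using arg_cong[OF assms(8), of real_of_int] by (simp add: defs)
  define x where "x = E * (P / C - \<alpha>)"
  have x: "0 < x" "x < 1 / (C * (C + D))" using s by (auto simp: x_def defs)
  have x2: "x * C * (C + D) < 1"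
    using x CD pos_less_divide_eq[of "C * (C + D)" x 1] by (simp add: mult.assoc)
  \<comment> \<open>Solves x = t/(C (C + t D)) for t, which inverts the distance formula behind
    \<open>cf_pair_set_interval\<close>. The bound x < 1/(C (C + D)) becomes t < 1.\<close>
  define t where "t = x * C\<^sup>2 / (1 - x * C * D)"
  have den: "1 - x * C * D > 0" using x2 CD x by (simp add: algebra_simps) (smt (verit) mult_pos_pos)
  have t: "0 < t" "t < 1" using x CD den x2 by (auto simp: t_def power2_eq_square algebra_simps divide_less_eq_1)
  have t_eq: "t = x * C * (C + t * D)"
    using den by (simp add: t_def field_simps power2_eq_square)
  have pos: "C + t * D > 0" using CD t by (intro add_pos_pos) auto
  have "\<alpha> = P / C - E * x" using E by (simp add: x_def mult.assoc[symmetric])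
  also have "\<dots> = (P * (C + t * D) - E * (x * C * (C + t * D))) / (C * (C + t * D))"
    using pos CD by (simp add: diff_divide_distrib)
  also have "P * (C + t * D) - E * (x * C * (C + t * D)) = C * (P + t * P')"
    unfolding t_eq[symmetric] det[symmetric] by (simp add: algebra_simps)
  also have "C * (P + t * P') / (C * (C + t * D)) = (P + t * P') / (C + t * D)" using CD by simp
  finally have "\<alpha> = (of_int p + t * of_int p') / (of_int c + t * of_int d)" by (simp add: defs)
  from cf_pair_exists[OF assms(1-8) t this] show ?thesis by blast
qed

lemma unit_pairs_pos:
  assumes "z \<in> unit_pairs c" "c \<ge> 2"
  shows "1 \<le> fst z" "1 \<le> snd z"
proof -
  have "fst z \<noteq> 0 \<and> snd z \<noteq> 0"
    using assms by (auto simp: unit_pairs_def cong_def)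
  then show "1 \<le> fst z" "1 \<le> snd z" using assms by (auto simp: unit_pairs_def)
qed

text \<open>The quotient p' is the numerator that goes with d in the determinant relation p d - p' c
  = 1, as required by \<open>cf_pair_exists\<close>.\<close>

lemma unit_pairs_quotient:
  assumes "(d, p) \<in> unit_pairs c" "1 \<le> d" "1 \<le> p"
  obtains p' where "d * p = 1 + int c * p'" "0 \<le> p'" "p' \<le> d"
proof -
  have dp: "d < int c" "p < int c" "[d * p = 1] (mod int c)" using assms(1) by (auto simp: unit_pairs_def)
  obtain p' where p': "d * p = 1 + int c * p'"
    using cong_sym[OF dp(3)] unfolding cong_iff_lin by blast
  have "0 \<le> p'"
  proof (rule ccontr)
    assume "\<not> 0 \<le> p'"
    then have "int c * p' \<le> int c * (-1)" by (intro mult_left_mono) auto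
    moreover have "d * p > 0" using assms by simp
    ultimately show False using p' dp assms by linarith
  qed
  moreover have "p' \<le> d"
  proof (rule ccontr)
    assume "\<not> p' \<le> d"
    then have "int c * d \<le> int c * p'" by (intro mult_left_mono) auto
    moreover have "d * p \<le> d * int c" using dp assms by (intro mult_left_mono) auto
    ultimately show False using p' by (simp add: mult.commute)
  qed
  ultimately show ?thesis using that p' by blast
qed

text \<open>The determinant relation gives p q_n = (-1)^n modulo c, so the inverse of q_n is p or -p
  according to parity. The strict inequality excludes q_0 = q_1 = 1.\<close>

lemma cf_p_unit_pairs:
  assumes \<alpha>: "\<alpha> \<in> irr01" and "cf_q \<alpha> n < cf_q \<alpha> (Suc n)"
  defines "c \<equiv> cf_q \<alpha> (Suc n)" and "p \<equiv> int (cf_p \<alpha> (Suc n))"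
  shows "(int (cf_q \<alpha> n), if even n then p else int c - p) \<in> unit_pairs c"
proof -
  have c2: "c \<ge> 2" using assms cf_q_ge[OF irr01D[OF \<alpha>], of n] by linarith
  have cop: "coprime p (int c)" using coprime_cf_p_cf_q[of \<alpha> "Suc n"] by (simp add: p_def c_def del: cf_p.simps cf_q.simps)
  have p: "0 < p" "p < int c"
  proof -
    have "p \<noteq> 0" "p \<noteq> int c" using cop c2 by auto
    moreover have "0 \<le> p" "p \<le> int c" using cf_p_le_cf_q[OF \<alpha>, of "Suc n"] by (auto simp: p_def c_def simp del: cf_p.simps cf_q.simps)
    ultimately show "0 < p" "p < int c" by auto
  qed
  have det: "p * int (cf_q \<alpha> n) = (-1) ^ n + int (cf_p \<alpha> n) * int c"
    using cf_det[of \<alpha> n] by (simp add: p_def c_def del: cf_p.simps cf_q.simps)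
  show ?thesis
  proof (cases "even n")
    case True
    then have "int (cf_q \<alpha> n) * p = 1 + int (cf_p \<alpha> n) * int c" using det by (simp add: mult.commute)
    then have "[int (cf_q \<alpha> n) * p = 1] (mod int c)" by (simp add: cong_def)
    then show ?thesis using p assms True by (simp add: unit_pairs_def del: cf_p.simps cf_q.simps)
  next
    case False
    then have "int (cf_q \<alpha> n) * (int c - p) = 1 + (int (cf_q \<alpha> n) - int (cf_p \<alpha> n)) * int c"
      using det by (simp add: algebra_simps)
    then have "[int (cf_q \<alpha> n) * (int c - p) = 1] (mod int c)" by (metis cong_def mod_mult_self1)
    then show ?thesis using p assms False by (simp add: unit_pairs_def del: cf_p.simps cf_q.simps)
  qed
qed

lemma cf_pair_set_eq:
  assumes z: "z \<in> unit_pairs c" and c: "c \<ge> 2" and \<epsilon>: "\<epsilon> = 1 \<or> \<epsilon> = -1"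
  shows "cf_pair_set \<epsilon> c (fst z) = {\<alpha> \<in> irr01.
    of_int \<epsilon> * (of_int (if \<epsilon> = 1 then snd z else int c - snd z) / real c - \<alpha>)
      \<in> {0<..<1 / (real c * (real c + of_int (fst z)))}}"
proof -
  obtain d p where [simp]: "z = (d, p)" by (cases z)
  have dp: "1 \<le> d" "d < int c" "1 \<le> p" "p < int c"
    using z unit_pairs_pos[OF z c] by (auto simp: unit_pairs_def)
  show ?thesis
  proof (intro subset_antisym subsetI)
    fix \<alpha> assume "\<alpha> \<in> cf_pair_set \<epsilon> c (fst z)"
    then obtain n where n: "\<alpha> \<in> irr01" "cf_q \<alpha> (Suc n) = c" "int (cf_q \<alpha> n) = d" "(-1) ^ n = \<epsilon>"
      by (auto simp: cf_pair_set_def)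
    have ev: "even n \<longleftrightarrow> \<epsilon> = 1" using n(4) by (cases "even n") auto
    have "cf_q \<alpha> n < cf_q \<alpha> (Suc n)" using n(2,3) dp(2) by (simp del: cf_q.simps)
    then have "(d, if even n then int (cf_p \<alpha> (Suc n)) else int c - int (cf_p \<alpha> (Suc n))) \<in> unit_pairs c"
      using cf_p_unit_pairs[OF n(1), of n] unfolding n(2,3) by blast
    then have "(if even n then int (cf_p \<alpha> (Suc n)) else int c - int (cf_p \<alpha> (Suc n))) = p"
      using z unit_pairs_unique by simp
    then have p_eq: "(if \<epsilon> = 1 then snd z else int c - snd z) = int (cf_p \<alpha> (Suc n))"
      using ev by (auto split: if_splits)
    have \<epsilon>_eq: "of_int \<epsilon> = (-1 :: real) ^ n" using n(4) by auto
    show "\<alpha> \<in> {\<alpha> \<in> irr01. of_int \<epsilon> * (of_int (if \<epsilon> = 1 then snd z else int c - snd z) / real c - \<alpha>)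
        \<in> {0<..<1 / (real c * (real c + of_int (fst z)))}}"
      unfolding mem_Collect_eq p_eq \<epsilon>_eq using cf_pair_set_interval[OF n(1-3)] n(1) by (simp del: cf_p.simps)
  next
    fix \<alpha> assume \<alpha>: "\<alpha> \<in> {\<alpha> \<in> irr01. of_int \<epsilon> * (of_int (if \<epsilon> = 1 then snd z else int c - snd z) / real c - \<alpha>)
        \<in> {0<..<1 / (real c * (real c + of_int (fst z)))}}"
    obtain p' where p': "d * p = 1 + int c * p'" "0 \<le> p'" "p' \<le> d"
      using unit_pairs_quotient[of d p c] z dp by auto
    \<comment> \<open>For \<epsilon> = -1 the fractions p/c and p'/d are reflected to (c - p)/c and
      (d - p')/d, which changes the sign of the determinant.\<close>
    have "\<exists>n. int (cf_q \<alpha> (Suc n)) = int c \<and> int (cf_q \<alpha> n) = d \<and> (-1) ^ n = \<epsilon>"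
      by (rule cf_pair_exists_interval[of d "int c" "if \<epsilon> = 1 then p else int c - p" "if \<epsilon> = 1 then p' else d - p'"])
         (use dp p' \<epsilon> \<alpha> in \<open>auto simp: algebra_simps\<close>)
    then show "\<alpha> \<in> cf_pair_set \<epsilon> c (fst z)" using \<alpha> by (auto simp: cf_pair_set_def simp del: cf_q.simps)
  qed
qed

text \<open>Both intervals stay inside [0, 1] because l <= 1/c <= x.\<close>

lemma cf_pair_set_interval_eq:
  assumes z: "z \<in> unit_pairs c" and c: "c \<ge> 2"
  defines "x \<equiv> of_int (snd z) / real c" and "l \<equiv> 1 / (real c * (real c + of_int (fst z)))"
  shows "cf_pair_set 1 c (fst z) = {x - l<..<x} - \<rat>" "cf_pair_set (-1) c (fst z) = {1 - x<..<1 - x + l} - \<rat>"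
    "0 \<le> x - l" "x \<le> 1"
proof -
  note zp = unit_pairs_pos[OF z c]
  have "1 / (real c * (real c + of_int (fst z))) \<le> 1 / (real c * 1)"
    using zp c by (intro divide_left_mono mult_left_mono mult_pos_pos) auto
  also have "\<dots> \<le> of_int (snd z) / real c" using zp by (simp add: divide_right_mono)
  finally show *: "0 \<le> x - l" by (simp add: x_def l_def)
  show x1: "x \<le> 1" using unit_pairs_frac[OF z] by (simp add: x_def)
  have y: "of_int (int c - snd z) / real c = 1 - x" using c by (simp add: x_def diff_divide_distrib)
  have "cf_pair_set 1 c (fst z) = {\<alpha> \<in> irr01. 1 * (x - \<alpha>) \<in> {0<..<l}}"
    unfolding cf_pair_set_eq[OF z c disjI1[OF refl]] x_def l_def by (simp only: if_True of_int_1 simp_thms)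
  also have "\<dots> = {x - l<..<x} - \<rat>"
    unfolding irr01_def
  proof (intro subset_antisym subsetI)
    fix \<alpha> assume "\<alpha> \<in> {x - l<..<x} - \<rat>"
    then have "\<alpha> \<notin> \<rat>" "x - l < \<alpha>" "\<alpha> < x" by auto
    moreover from this * x1 have "0 < \<alpha>" "\<alpha> < 1" by linarith+
    ultimately show "\<alpha> \<in> {\<alpha> \<in> {0<..<1} - \<rat>. 1 * (x - \<alpha>) \<in> {0<..<l}}" by simp
  qed auto
  finally show "cf_pair_set 1 c (fst z) = {x - l<..<x} - \<rat>" .
  have "cf_pair_set (-1) c (fst z) = {\<alpha> \<in> irr01. (-1) * (1 - x - \<alpha>) \<in> {0<..<l}}"
    unfolding cf_pair_set_eq[OF z c disjI2[OF refl]] l_def y[symmetric] by simp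
  also have "\<dots> = {1 - x<..<1 - x + l} - \<rat>"
    unfolding irr01_def
  proof (intro subset_antisym subsetI)
    fix \<alpha> assume "\<alpha> \<in> {1 - x<..<1 - x + l} - \<rat>"
    then have "\<alpha> \<notin> \<rat>" "1 - x < \<alpha>" "\<alpha> < 1 - x + l" by auto
    moreover from this * x1 have "0 < \<alpha>" "\<alpha> < 1" by linarith+
    ultimately show "\<alpha> \<in> {\<alpha> \<in> {0<..<1} - \<rat>. (-1) * (1 - x - \<alpha>) \<in> {0<..<l}}" by simp
  qed auto
  finally show "cf_pair_set (-1) c (fst z) = {1 - x<..<1 - x + l} - \<rat>" .
qed

section \<open>Gauss measure of the intervals and of the event\<close>

lemma Rats_borel [measurable]: "(\<rat> :: real set) \<in> sets borel"
  by (rule sets.countable[OF _ countable_rat]) simp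

lemma measure_gauss_interval:
  assumes ab: "0 \<le> a" "a \<le> b" "b \<le> 1"
  shows "measure gauss_measure ({a<..<b} - \<rat>) = (ln (1 + b) - ln (1 + a)) / ln 2"
proof -
  have m: "(\<lambda>x. ennreal (1 / (ln 2 * (1 + x)))) \<in> borel_measurable (restrict_space lborel {0<..<1})"
    by (intro measurable_restrict_space1) measurable
  have S: "{a<..<b} - \<rat> \<in> sets (restrict_space lborel {0<..<1 :: real})"
    using ab by (auto simp: sets_restrict_space_iff)
  have "AE x in lborel. x \<notin> (\<rat> :: real set)"
    by (rule AE_not_in) (intro null_setsI countable_imp_null_set_lborel[THEN null_setsD1] countable_rat; simp add: countable_rat)
  then have rat: "AE x in lborel. x \<notin> (\<rat> :: real set)" .
  have "emeasure gauss_measure ({a<..<b} - \<rat>) =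
      (\<integral>\<^sup>+ x. ennreal (1 / (ln 2 * (1 + x))) * indicator ({a<..<b} - \<rat>) x \<partial>restrict_space lborel {0<..<1})"
    unfolding gauss_measure_def by (rule emeasure_density[OF m S])
  also have "\<dots> = (\<integral>\<^sup>+ x. ennreal (1 / (ln 2 * (1 + x))) * indicator ({a<..<b} - \<rat>) x * indicator {0<..<1} x \<partial>lborel)"
    by (rule nn_integral_restrict_space) simp
  also have "\<dots> = (\<integral>\<^sup>+ x. ennreal (1 / (ln 2 * (1 + x))) * indicator {a..b} x \<partial>lborel)"
    by (rule nn_integral_cong_AE)
       (use rat AE_lborel_singleton[of a] AE_lborel_singleton[of b] in eventually_elim,
        use ab in \<open>auto split: split_indicator\<close>)
  also have "\<dots> = ennreal (ln (1 + b) / ln 2 - ln (1 + a) / ln 2)"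
  proof (rule nn_integral_FTC_Icc[where F = "\<lambda>x. ln (1 + x) / ln 2"])
    fix x :: real assume x: "x \<in> {a..b}"
    have "((\<lambda>x. ln (1 + x)) has_real_derivative 1 / (1 + x)) (at x)"
      using x ab by (auto intro!: derivative_eq_intros)
    then show "((\<lambda>x. ln (1 + x) / ln 2) has_real_derivative 1 / (ln 2 * (1 + x))) (at x)"
      using DERIV_cdivide[of "\<lambda>x. ln (1 + x)" "1 / (1 + x)" x UNIV "ln 2"] by (simp add: mult.commute)
    show "0 \<le> 1 / (ln 2 * (1 + x))" using x ab by simp
  qed (use ab in auto)
  finally show ?thesis using ab
    by (simp add: measure_def diff_divide_distrib[symmetric] enn2real_ennreal)
qed

definition gauss_density :: "real \<Rightarrow> real" where "gauss_density x = 1 / (ln 2 * (1 + x))"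

lemma gauss_interval_approx:
  assumes ab: "0 \<le> a" "a \<le> b" "b \<le> 1" and x: "x \<in> {a..b}"
  shows "\<bar>measure gauss_measure ({a<..<b} - \<rat>) - gauss_density x * (b - a)\<bar> \<le> (b - a)\<^sup>2 / ln 2"
proof (cases "a = b")
  case True
  then show ?thesis using measure_gauss_interval[OF ab] by simp
next
  case False
  have "\<exists>\<xi>. a < \<xi> \<and> \<xi> < b \<and> ln (1 + b) - ln (1 + a) = (b - a) * (1 / (1 + \<xi>))"
    using ab False by (intro MVT2) (auto intro!: derivative_eq_intros)
  then obtain \<xi> where \<xi>: "a < \<xi>" "\<xi> < b" "ln (1 + b) - ln (1 + a) = (b - a) * (1 / (1 + \<xi>))" by blast
  have "1 / (1 + \<xi>) - 1 / (1 + x) = (x - \<xi>) / ((1 + \<xi>) * (1 + x))"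
    using \<xi> x ab by (simp add: field_simps)
  also have "\<bar>\<dots>\<bar> \<le> (b - a) / 1"
    unfolding abs_divide using \<xi> x ab
    by (intro frac_le) (use mult_mono[of 1 "1 + \<xi>" 1 "1 + x"] in \<open>auto simp: abs_mult\<close>)
  finally have le: "\<bar>1 / (1 + \<xi>) - 1 / (1 + x)\<bar> \<le> b - a" by simp
  have "measure gauss_measure ({a<..<b} - \<rat>) - gauss_density x * (b - a) =
      (b - a) * (1 / (1 + \<xi>) - 1 / (1 + x)) / ln 2"
    unfolding measure_gauss_interval[OF ab] \<xi>(3) gauss_density_def
    by (simp add: diff_divide_distrib right_diff_distrib mult.commute)
  also have "\<bar>\<dots>\<bar> = (b - a) * \<bar>1 / (1 + \<xi>) - 1 / (1 + x)\<bar> / ln 2"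
    using ab by (simp add: abs_mult)
  also have "\<dots> \<le> (b - a) * (b - a) / ln 2"
    using le ab by (intro divide_right_mono mult_left_mono) auto
  finally show ?thesis by (simp add: power2_eq_square)
qed

text \<open>The interval of sign 1 ends at x and that of sign -1 begins at 1 - x. Their lengths
  agree, so their measures add up to this weight times the length, up to an error quadratic in the
  length.\<close>

definition gauss_density_sym :: "real \<Rightarrow> real"
  where "gauss_density_sym x = gauss_density x + gauss_density (1 - x)"

lemma measure_cf_pair_sets_approx:
  assumes z: "z \<in> unit_pairs c" and c: "c \<ge> 2"
  shows "\<bar>measure gauss_measure (cf_pair_set 1 c (fst z)) + measure gauss_measure (cf_pair_set (-1) c (fst z)) -
    gauss_density_sym (of_int (snd z) / real c) / (real c * (real c + of_int (fst z)))\<bar> \<le> 3 / real c ^ 4"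
proof -
  define x where "x = of_int (snd z) / real c"
  define l where "l = 1 / (real c * (real c + of_int (fst z)))"
  have d: "fst z \<ge> 1" using unit_pairs_pos[OF z c] by simp
  have l: "0 \<le> l" "l \<le> 1 / real c ^ 2"
  proof -
    show "0 \<le> l" using d by (simp add: l_def)
    show "l \<le> 1 / real c ^ 2" unfolding l_def power2_eq_square
      using c d by (intro divide_left_mono mult_left_mono mult_pos_pos) auto
  qed
  note p = cf_pair_set_interval_eq[OF z c, folded x_def l_def]
  have "l\<^sup>2 \<le> (1 / real c ^ 2)\<^sup>2" using l by (intro power_mono)
  then have l2: "l\<^sup>2 \<le> 1 / real c ^ 4" by (simp add: power_divide flip: power_mult)
  \<comment> \<open>Each of the two intervals contributes an error l^2/ln 2, where l <=
    1/c^2.\<close>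
  have ln2: "2 / ln 2 \<le> (3 :: real)" using ln2_ge_two_thirds by (simp add: divide_le_eq)
  have "\<bar>measure gauss_measure ({x - l<..<x} - \<rat>) - gauss_density x * (x - (x - l))\<bar> \<le> (x - (x - l))\<^sup>2 / ln 2"
    by (rule gauss_interval_approx) (use p l in auto)
  moreover have "\<bar>measure gauss_measure ({1 - x<..<1 - x + l} - \<rat>) - gauss_density (1 - x) * (1 - x + l - (1 - x))\<bar> \<le> (1 - x + l - (1 - x))\<^sup>2 / ln 2"
    by (rule gauss_interval_approx) (use p l in auto)
  ultimately have "\<bar>measure gauss_measure ({x - l<..<x} - \<rat>) + measure gauss_measure ({1 - x<..<1 - x + l} - \<rat>)
      - gauss_density_sym x * l\<bar> \<le> l\<^sup>2 / ln 2 + l\<^sup>2 / ln 2"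
    by (simp add: gauss_density_sym_def distrib_right)
  also have "\<dots> = (2 / ln 2) * l\<^sup>2" by simp
  also have "\<dots> \<le> 3 * (1 / real c ^ 4)" using ln2 l2 by (intro mult_mono) auto
  finally show ?thesis unfolding p(1,2) by (simp add: x_def l_def)
qed

lemma sets_cf_pair_set:
  assumes "z \<in> unit_pairs c" "c \<ge> 2" "\<epsilon> = 1 \<or> \<epsilon> = -1"
  shows "cf_pair_set \<epsilon> c (fst z) \<in> sets gauss_measure"
proof (rule sets_gauss_measure)
  show "cf_pair_set \<epsilon> c (fst z) \<in> sets borel"
    using assms(3) cf_pair_set_interval_eq(1,2)[OF assms(1,2)] by auto
  show "cf_pair_set \<epsilon> c (fst z) \<subseteq> {0<..<1}" by (auto simp: cf_pair_set_def irr01_def)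
qed

text \<open>Prescribing the entries a_{n_R - k} confines, up to endpoints, the ratio of the
  denominators on either side of R to an interval; J stands for that interval.\<close>

definition ratio_event :: "real \<Rightarrow> real \<Rightarrow> real set \<Rightarrow> real \<Rightarrow> real set" where
  "ratio_event a b J R = {\<alpha> \<in> irr01. \<exists>n. cf_n R \<alpha> = Suc n \<and> a * R < real (cf_q \<alpha> (Suc n)) \<and> real (cf_q \<alpha> (Suc n)) < b * R \<and>
     real (cf_q \<alpha> n) / real (cf_q \<alpha> (Suc n)) \<in> J}"

text \<open>The event is the disjoint union of \<open>cf_pair_set\<close> over c in C, over the
  units d <= R with d/c in J, and over both signs: \<alpha> determines n_R and thereby all three.
  The condition d <= R appears as the cut d/c <= R/c, and 1/(c (c + d)) is 1/c^2 times 1/(1 +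
  d/c).\<close>

lemma ratio_event_approx:
  fixes a b R :: real
  assumes a: "a \<ge> 1" and b: "b \<ge> 0" and R: "R \<ge> 1"
  defines "C \<equiv> {c :: nat. a * R < c \<and> c < b * R}"
  shows "ratio_event a b J R \<in> sets gauss_measure"
    and "\<bar>measure gauss_measure (ratio_event a b J R) -
      (\<Sum>c\<in>C. pair_mean (\<lambda>y. indicator (J \<inter> {..R / c}) y * (1 / (1 + y))) gauss_density_sym c / c)\<bar> \<le> 3 * b / R\<^sup>2"
proof -
  interpret prob_space gauss_measure by (rule prob_space_gauss_measure)
  define V where "V c = {z \<in> unit_pairs c. of_int (fst z) \<le> R \<and> of_int (fst z) / real c \<in> J}" for c
  define K where "K = Sigma C (\<lambda>c. V c \<times> {1, -1 :: int})"
  define B where "B = (\<lambda>(c, z, \<epsilon>). cf_pair_set \<epsilon> c (fst (z :: int_pair)))"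
  have aR: "a * R \<ge> R" using a R by simp
  have C: "R < real c" "c \<ge> 2" if "c \<in> C" for c
  proof -
    have "a * R < real c" using that by (simp add: C_def)
    with aR show "R < real c" by linarith
    then have "1 < real c" using R by linarith
    then show "c \<ge> 2" by simp
  qed
  have Csub: "C \<subseteq> {1..nat \<lfloor>b * R\<rfloor>}" using C by (force simp: C_def le_nat_iff le_floor_iff)
  have finC: "finite C" using Csub by (rule finite_subset) simp
  have finV: "finite (V c)" for c by (simp add: V_def)
  have finK: "finite K" using finC finV by (auto simp: K_def)
  have Bsets: "B k \<in> sets gauss_measure" if "k \<in> K" for k
    using that C by (auto simp: K_def B_def V_def intro!: sets_cf_pair_set)
  have nR: "cf_n R \<alpha> = Suc n"
    if "\<alpha> \<in> irr01" "cf_q \<alpha> (Suc n) = c" "int (cf_q \<alpha> n) = fst z" "c \<in> C" "z \<in> V c" for \<alpha> n c z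
  proof (rule cf_n_eqI[OF that(1)])
    have "real (cf_q \<alpha> n) = of_int (fst z)" using that(3) by (metis of_int_of_nat_eq)
    then show "real (cf_q \<alpha> n) \<le> R" using that(5) by (simp add: V_def)
  qed (use that C in \<open>simp del: cf_q.simps\<close>)
  have disj: "disjoint_family_on B K"
  proof (unfold disjoint_family_on_def, intro ballI impI equals0I)
    fix k k' \<alpha> assume k: "k \<in> K" "k' \<in> K" "k \<noteq> k'" and \<alpha>: "\<alpha> \<in> B k \<inter> B k'"
    obtain c z \<epsilon> c' z' \<epsilon>' where kk: "k = (c, z, \<epsilon>)" "k' = (c', z', \<epsilon>')" by (metis surj_pair)
    have cz: "c \<in> C" "z \<in> V c" "c' \<in> C" "z' \<in> V c'" using k by (auto simp: kk K_def)
    obtain n where n: "\<alpha> \<in> irr01" "cf_q \<alpha> (Suc n) = c" "int (cf_q \<alpha> n) = fst z" "(-1) ^ n = \<epsilon>"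
      using \<alpha> by (auto simp: kk B_def cf_pair_set_def)
    obtain n' where n': "cf_q \<alpha> (Suc n') = c'" "int (cf_q \<alpha> n') = fst z'" "(-1) ^ n' = \<epsilon>'"
      using \<alpha> by (auto simp: kk B_def cf_pair_set_def)
    have "n = n'" using nR[OF n(1-3) cz(1,2)] nR[OF n(1) n'(1,2) cz(3,4)] by simp
    then have "c = c'" "\<epsilon> = \<epsilon>'" "fst z = fst z'" using n n' by auto
    moreover from this have "z = z'" using cz unit_pairs_unique by (auto simp: V_def prod_eq_iff) (metis prod.collapse)
    ultimately show False using k kk by simp
  qed
  have un: "ratio_event a b J R = (\<Union>k\<in>K. B k)"
  proof (intro Set.set_eqI iffI)
    fix \<alpha> assume "\<alpha> \<in> ratio_event a b J R"
    then obtain n where n: "\<alpha> \<in> irr01" "cf_n R \<alpha> = Suc n" "a * R < cf_q \<alpha> (Suc n)" "cf_q \<alpha> (Suc n) < b * R"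
      "cf_q \<alpha> n / cf_q \<alpha> (Suc n) \<in> J" unfolding ratio_event_def by blast
    obtain n' where n': "cf_n R \<alpha> = Suc n'" "real (cf_q \<alpha> n') \<le> R" "R < real (cf_q \<alpha> (Suc n'))"
      using cf_n_props[OF n(1) R] .
    then have qn: "real (cf_q \<alpha> n) \<le> R" using n(2) by simp
    define c where "c = cf_q \<alpha> (Suc n)"
    have cC: "c \<in> C" using n by (simp add: C_def c_def del: cf_q.simps)
    have "cf_q \<alpha> n < c" using qn C(1)[OF cC] by simp
    then obtain p where p: "(int (cf_q \<alpha> n), p) \<in> unit_pairs c"
      using cf_p_unit_pairs[OF n(1), of n] unfolding c_def by blast
    define \<epsilon> where "\<epsilon> = ((-1) ^ n :: int)"
    have "\<epsilon> \<in> {1, -1}" by (cases "even n") (auto simp: \<epsilon>_def)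
    then have "(c, (int (cf_q \<alpha> n), p), \<epsilon>) \<in> K" using cC p qn n by (auto simp: K_def V_def c_def simp del: cf_q.simps)
    moreover have "\<alpha> \<in> B (c, (int (cf_q \<alpha> n), p), \<epsilon>)" using n(1) by (auto simp: B_def cf_pair_set_def c_def \<epsilon>_def)
    ultimately show "\<alpha> \<in> (\<Union>k\<in>K. B k)" by blast
  next
    fix \<alpha> assume "\<alpha> \<in> (\<Union>k\<in>K. B k)"
    then obtain c z \<epsilon> where k: "(c, z, \<epsilon>) \<in> K" "\<alpha> \<in> B (c, z, \<epsilon>)" by auto
    then have cz: "c \<in> C" "z \<in> V c" by (auto simp: K_def)
    obtain n where n: "\<alpha> \<in> irr01" "cf_q \<alpha> (Suc n) = c" "int (cf_q \<alpha> n) = fst z"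
      using k by (auto simp: B_def cf_pair_set_def)
    have qz: "real (cf_q \<alpha> n) = of_int (fst z)" using n(3) by (metis of_int_of_nat_eq)
    have "cf_n R \<alpha> = Suc n" by (rule nR[OF n cz])
    then show "\<alpha> \<in> ratio_event a b J R" unfolding ratio_event_def
      using n cz qz by (auto simp: V_def C_def simp del: cf_q.simps)
  qed
  show "ratio_event a b J R \<in> sets gauss_measure"
    unfolding un using finK Bsets by (intro sets.finite_UN)
  define M where "M c z = measure gauss_measure (cf_pair_set 1 c (fst z)) + measure gauss_measure (cf_pair_set (-1) c (fst z))" for c and z :: int_pair
  define A where "A c z = gauss_density_sym (of_int (snd z) / real c) / (real c * (real c + of_int (fst z)))" for c and z :: int_pair
  have meas: "measure gauss_measure (ratio_event a b J R) = (\<Sum>c\<in>C. \<Sum>z\<in>V c. M c z)"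
  proof -
    have "measure gauss_measure (ratio_event a b J R) = (\<Sum>k\<in>K. measure gauss_measure (B k))"
      unfolding un by (rule finite_measure_finite_Union) (use finK Bsets disj in auto)
    also have "\<dots> = (\<Sum>c\<in>C. \<Sum>q\<in>V c \<times> {1, -1}. measure gauss_measure (B (c, q)))"
      unfolding K_def using finC finV by (subst sum.Sigma) auto
    also have "\<dots> = (\<Sum>c\<in>C. \<Sum>z\<in>V c. \<Sum>\<epsilon>\<in>{1, -1}. measure gauss_measure (B (c, z, \<epsilon>)))"
      by (simp only: sum.cartesian_product case_prod_unfold prod.collapse)
    finally show ?thesis by (simp add: M_def B_def)
  qed
  have pm: "pair_mean (\<lambda>y. indicator (J \<inter> {..R / c}) y * (1 / (1 + y))) gauss_density_sym c / c = (\<Sum>z\<in>V c. A c z)"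
    if c: "c \<in> C" for c
  proof -
    have "(\<Sum>z\<in>V c. A c z) = (\<Sum>z\<in>unit_pairs c. if of_int (fst z) \<le> R \<and> of_int (fst z) / real c \<in> J then A c z else 0)"
      unfolding V_def by (rule sum.inter_filter) simp
    also have "\<dots> = (\<Sum>z\<in>unit_pairs c. indicator (J \<inter> {..R / c}) (of_int (fst z) / real c) * (1 / (1 + of_int (fst z) / real c)) *
        gauss_density_sym (of_int (snd z) / real c) / real c / real c)"
    proof (intro sum.cong refl)
      fix z assume z: "z \<in> unit_pairs c"
      have c0: "real c > 0" "real c + of_int (fst z) > 0" using C[OF c] z by (auto simp: unit_pairs_def)
      have "1 / (1 + of_int (fst z) / real c) / real c / real c = 1 / (real c * (real c + of_int (fst z)))"
      proof -
        have "1 + of_int (fst z) / real c = (real c + of_int (fst z)) / real c"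
          using c0 by (simp add: add_divide_distrib)
        then show ?thesis using c0 by (simp add: mult.commute)
      qed
      moreover have "of_int (fst z) / real c \<le> R / real c \<longleftrightarrow> of_int (fst z) \<le> R"
        using c0 by (simp add: divide_le_cancel)
      ultimately show "(if of_int (fst z) \<le> R \<and> of_int (fst z) / real c \<in> J then A c z else 0) =
        indicator (J \<inter> {..R / c}) (of_int (fst z) / real c) * (1 / (1 + of_int (fst z) / real c)) *
        gauss_density_sym (of_int (snd z) / real c) / real c / real c"
        by (auto simp: A_def indicator_def)
    qed
    finally show ?thesis by (simp add: pair_mean_def sum_divide_distrib)
  qed
  have "measure gauss_measure (ratio_event a b J R) -
      (\<Sum>c\<in>C. pair_mean (\<lambda>y. indicator (J \<inter> {..R / c}) y * (1 / (1 + y))) gauss_density_sym c / c) =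
      (\<Sum>c\<in>C. \<Sum>z\<in>V c. M c z - A c z)"
    unfolding meas using pm by (simp add: sum_subtractf)
  also have "\<bar>\<dots>\<bar> \<le> (\<Sum>c\<in>C. \<Sum>z\<in>V c. \<bar>M c z - A c z\<bar>)"
    by (rule order_trans[OF sum_abs]) (intro sum_mono sum_abs)
  \<comment> \<open>Each pair costs 3/c^4, each c > R has at most c pairs, and there are at most b R
    values of c.\<close>
  also have "\<dots> \<le> (\<Sum>c\<in>C. \<Sum>z\<in>V c. 3 / real c ^ 4)"
    unfolding M_def A_def using C by (intro sum_mono measure_cf_pair_sets_approx) (auto simp: V_def)
  also have "\<dots> \<le> (\<Sum>c\<in>C. 3 / R ^ 3)"
  proof (rule sum_mono)
    fix c assume c: "c \<in> C"
    have "card (V c) \<le> card (unit_pairs c)" by (rule card_mono) (auto simp: V_def)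
    then have "real (card (V c)) \<le> real c" using card_unit_pairs_le[of c] by simp
    then have "(\<Sum>z\<in>V c. 3 / real c ^ 4) \<le> real c * (3 / real c ^ 4)" by (simp add: divide_right_mono)
    also have "\<dots> = 3 / real c ^ 3" using C[OF c] by (simp add: power4_eq_xxxx power3_eq_cube)
    also have "\<dots> \<le> 3 / R ^ 3" using C[OF c] R by (intro divide_left_mono power_mono mult_pos_pos) auto
    finally show "(\<Sum>z\<in>V c. 3 / real c ^ 4) \<le> 3 / R ^ 3" .
  qed
  also have "\<dots> \<le> (b * R) * (3 / R ^ 3)"
  proof -
    have "card C \<le> nat \<lfloor>b * R\<rfloor>" using card_mono[OF _ Csub] by simp
    then have "real (card C) \<le> b * R" using b R by (simp add: le_nat_iff le_floor_iff)
    then show ?thesis using R by (simp add: divide_right_mono)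
  qed
  also have "\<dots> = 3 * b / R\<^sup>2" using R by (simp add: power2_eq_square power3_eq_cube)
  finally show "\<bar>measure gauss_measure (ratio_event a b J R) -
      (\<Sum>c\<in>C. pair_mean (\<lambda>y. indicator (J \<inter> {..R / c}) y * (1 / (1 + y))) gauss_density_sym c / c)\<bar> \<le> 3 * b / R\<^sup>2" .
qed

section \<open>The limit for intervals\<close>

lemma has_mean_interval:
  assumes L: "has_mean s L" and t: "t > 0"
  shows "((\<lambda>R. (\<Sum>c=1..nat \<lfloor>t * R\<rfloor>. s c) / R) \<longlongrightarrow> t * L) at_top"
proof -
  have lim: "filterlim (\<lambda>R. nat \<lfloor>t * R\<rfloor>) sequentially at_top"
    using t by real_asymp
  have 1: "((\<lambda>R. (\<Sum>c=1..nat \<lfloor>t * R\<rfloor>. s c) / real (nat \<lfloor>t * R\<rfloor>)) \<longlongrightarrow> L) at_top"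
    using filterlim_compose[OF L[unfolded has_mean_def] lim] .
  have 2: "((\<lambda>R. real (nat \<lfloor>t * R\<rfloor>) / R) \<longlongrightarrow> t) at_top"
    using t by real_asymp
  have "((\<lambda>R. (real (nat \<lfloor>t * R\<rfloor>) / R) * ((\<Sum>c=1..nat \<lfloor>t * R\<rfloor>. s c) / real (nat \<lfloor>t * R\<rfloor>))) \<longlongrightarrow> t * L) at_top"
    by (intro tendsto_mult 1 2)
  moreover have "\<forall>\<^sub>F R in at_top. (real (nat \<lfloor>t * R\<rfloor>) / R) * ((\<Sum>c=1..nat \<lfloor>t * R\<rfloor>. s c) / real (nat \<lfloor>t * R\<rfloor>)) =
      (\<Sum>c=1..nat \<lfloor>t * R\<rfloor>. s c) / R"
    by (intro always_eventually allI) (auto simp: field_simps)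
  ultimately show ?thesis by (rule Lim_transform_eventually)
qed

lemma has_mean_between:
  assumes L: "has_mean s L" and t: "0 < r" "r \<le> t"
  shows "((\<lambda>R. (\<Sum>c | r * R < real c \<and> real c \<le> t * R. s c) / R) \<longlongrightarrow> (t - r) * L) at_top"
proof -
  have "((\<lambda>R. (\<Sum>c=1..nat \<lfloor>t * R\<rfloor>. s c) / R - (\<Sum>c=1..nat \<lfloor>r * R\<rfloor>. s c) / R) \<longlongrightarrow> t * L - r * L) at_top"
    using t by (intro tendsto_diff has_mean_interval L) auto
  moreover have "\<forall>\<^sub>F R in at_top. (\<Sum>c=1..nat \<lfloor>t * R\<rfloor>. s c) / R - (\<Sum>c=1..nat \<lfloor>r * R\<rfloor>. s c) / R =
      (\<Sum>c | r * R < real c \<and> real c \<le> t * R. s c) / R"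
    using eventually_gt_at_top[of 0]
  proof eventually_elim
    case (elim R)
    have rt: "r * R \<le> t * R" "0 < r * R" using t elim by (auto intro: mult_right_mono)
    have mem: "c \<in> {1..nat \<lfloor>x\<rfloor>} \<longleftrightarrow> 1 \<le> c \<and> real c \<le> x" if "x > 0" for x c
      using that by (auto simp: le_nat_iff le_floor_iff)
    have set: "{c. r * R < real c \<and> real c \<le> t * R} = {1..nat \<lfloor>t * R\<rfloor>} - {1..nat \<lfloor>r * R\<rfloor>}"
    proof (rule Set.set_eqI)
      fix c
      have "1 \<le> c" if "r * R < real c" using that rt by (cases c) auto
      then show "c \<in> {c. r * R < real c \<and> real c \<le> t * R} \<longleftrightarrow> c \<in> {1..nat \<lfloor>t * R\<rfloor>} - {1..nat \<lfloor>r * R\<rfloor>}"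
        unfolding Diff_iff using mem[of "t * R" c] mem[of "r * R" c] rt by auto
    qed
    have "{1..nat \<lfloor>r * R\<rfloor>} \<subseteq> {1..nat \<lfloor>t * R\<rfloor>}" using rt by (auto intro: order_trans nat_mono floor_mono)
    then show ?case unfolding set by (subst sum_diff) (auto simp: diff_divide_distrib)
  qed
  ultimately have "((\<lambda>R. (\<Sum>c | r * R < real c \<and> real c \<le> t * R. s c) / R) \<longlongrightarrow> t * L - r * L) at_top"
    by (rule Lim_transform_eventually)
  then show ?thesis by (simp add: left_diff_distrib)
qed

lemma finite_nat_real_le: "finite {c :: nat. P c \<and> real c \<le> x}"
  by (rule finite_subset[of _ "{..nat \<lfloor>x\<rfloor>}"]) (auto simp: le_nat_iff le_floor_iff)

text \<open>A Riemann sum argument for additive interval functions F. Cutting [a, b] into K equal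
  pieces bounds F asymptotically by lower and upper sums of the decreasing \<theta>, whose
  difference telescopes to (b - a) (\<theta> a - \<theta> b)/K.\<close>

lemma tendsto_integral_antimono:
  fixes \<theta> :: "real \<Rightarrow> real" and F :: "real \<Rightarrow> real \<Rightarrow> real \<Rightarrow> real"
  assumes ab: "a < b" and anti: "\<And>x y. a \<le> x \<Longrightarrow> x \<le> y \<Longrightarrow> y \<le> b \<Longrightarrow> \<theta> y \<le> \<theta> x"
    and int: "\<theta> integrable_on {a..b}"
    and add: "\<And>R s t. R > 0 \<Longrightarrow> a \<le> s \<Longrightarrow> s \<le> t \<Longrightarrow> F R a t = F R a s + F R s t"
    and zero: "\<And>R. F R a a = 0"
    and sand: "\<And>s t. a \<le> s \<Longrightarrow> s < t \<Longrightarrow> t \<le> b \<Longrightarrow> \<exists>lo up.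
      (lo \<longlongrightarrow> (t - s) * \<theta> t) at_top \<and> (up \<longlongrightarrow> (t - s) * \<theta> s) at_top \<and>
      (\<forall>\<^sub>F R in at_top. lo R \<le> F R s t \<and> F R s t \<le> up R)"
  shows "((\<lambda>R. F R a b) \<longlongrightarrow> integral {a..b} \<theta>) at_top"
proof (rule tendstoI)
  fix e :: real assume e: "e > 0"
  obtain K :: nat where K: "K > 0" "(b - a) * (\<theta> a - \<theta> b) / real K < e / 2"
  proof -
    obtain K :: nat where "(b - a) * (\<theta> a - \<theta> b) / (e / 2) < real K" using reals_Archimedean2 by blast
    then have "(b - a) * (\<theta> a - \<theta> b) < real K * (e / 2)" using e by (simp add: pos_divide_less_eq)
    also have "\<dots> < real (Suc K) * (e / 2)" using e by (intro mult_strict_right_mono) auto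
    finally have "(b - a) * (\<theta> a - \<theta> b) / real (Suc K) < e / 2" by (simp add: pos_divide_less_eq mult.commute)
    then show ?thesis using that[of "Suc K"] by blast
  qed
  define h where "h = (b - a) / real K"
  define x where "x i = a + real i * h" for i :: nat
  have h: "h > 0" "real K * h = b - a" using K ab by (auto simp: h_def)
  have x: "x 0 = a" "x K = b" "x (Suc i) = x i + h" "a \<le> x i" for i
    using h by (auto simp: x_def algebra_simps)
  have xb: "x i \<le> b" if "i \<le> K" for i
  proof -
    have "real i * h \<le> real K * h" using that h by (intro mult_right_mono) auto
    then show ?thesis using h by (simp add: x_def)
  qed
  define Lo Up where "Lo i = (\<Sum>j<i. h * \<theta> (x (Suc j)))" and "Up i = (\<Sum>j<i. h * \<theta> (x j))" for i
  have UL: "Up i - Lo i = h * (\<theta> (x 0) - \<theta> (x i))" for i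
    by (induction i) (auto simp: Up_def Lo_def algebra_simps)
  have intx: "\<theta> integrable_on {s..t}" if "a \<le> s" "t \<le> b" for s t
    using int by (rule integrable_on_subinterval) (use that in auto)
  have I: "Lo i \<le> integral {a..x i} \<theta> \<and> integral {a..x i} \<theta> \<le> Up i" if "i \<le> K" for i
    using that
  proof (induction i)
    case (Suc i)
    have i: "x (Suc i) \<le> b" "x i \<le> b" "x i \<le> x (Suc i)" using Suc xb[of "Suc i"] xb[of i] x(3)[of i] h by auto
    have "integral {a..x i} \<theta> + integral {x i..x (Suc i)} \<theta> = integral {a..x (Suc i)} \<theta>"
      by (rule Henstock_Kurzweil_Integration.integral_combine) (use x i intx in auto)
    moreover have "integral {x i..x (Suc i)} \<theta> \<le> integral {x i..x (Suc i)} (\<lambda>_. \<theta> (x i))"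
      by (rule integral_le) (use i x(4)[of i] intx in \<open>auto intro!: anti\<close>)
    moreover have "integral {x i..x (Suc i)} (\<lambda>_. \<theta> (x (Suc i))) \<le> integral {x i..x (Suc i)} \<theta>"
      by (rule integral_le) (use i x(4)[of i] intx in \<open>auto intro!: anti\<close>)
    ultimately show ?case using Suc x(3)[of i] h by (auto simp: Lo_def Up_def)
  qed (simp add: Lo_def Up_def x)
  have FI: "\<exists>lo up. (lo \<longlongrightarrow> Lo i) at_top \<and> (up \<longlongrightarrow> Up i) at_top \<and>
      (\<forall>\<^sub>F R in at_top. lo R \<le> F R a (x i) \<and> F R a (x i) \<le> up R)" if "i \<le> K" for i
    using that
  proof (induction i)
    case 0
    show ?case by (intro exI[of _ "\<lambda>_. 0"]) (auto simp: Lo_def Up_def x zero)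
  next
    case (Suc i)
    have i: "x (Suc i) \<le> b" "x i < x (Suc i)" using Suc xb[of "Suc i"] x(3)[of i] h by auto
    obtain lo up where lu: "(lo \<longlongrightarrow> Lo i) at_top" "(up \<longlongrightarrow> Up i) at_top"
      "\<forall>\<^sub>F R in at_top. lo R \<le> F R a (x i) \<and> F R a (x i) \<le> up R" using Suc by auto
    obtain lo' up' where lu': "(lo' \<longlongrightarrow> (x (Suc i) - x i) * \<theta> (x (Suc i))) at_top" "(up' \<longlongrightarrow> (x (Suc i) - x i) * \<theta> (x i)) at_top"
      "\<forall>\<^sub>F R in at_top. lo' R \<le> F R (x i) (x (Suc i)) \<and> F R (x i) (x (Suc i)) \<le> up' R"
      using sand[of "x i" "x (Suc i)"] i x(4)[of i] by blast
    have "((\<lambda>R. lo R + lo' R) \<longlongrightarrow> Lo (Suc i)) at_top" "((\<lambda>R. up R + up' R) \<longlongrightarrow> Up (Suc i)) at_top"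
      using tendsto_add[OF lu(1) lu'(1)] tendsto_add[OF lu(2) lu'(2)] x(3)[of i] by (simp_all add: Lo_def Up_def)
    moreover have "\<forall>\<^sub>F R in at_top. lo R + lo' R \<le> F R a (x (Suc i)) \<and> F R a (x (Suc i)) \<le> up R + up' R"
      using lu(3) lu'(3) eventually_gt_at_top[of 0]
    proof eventually_elim
      case (elim R)
      then show ?case using add[of R "x i" "x (Suc i)"] i x(4)[of i] by auto
    qed
    ultimately show ?case by blast
  qed
  obtain lo up where lu: "(lo \<longlongrightarrow> Lo K) at_top" "(up \<longlongrightarrow> Up K) at_top"
    "\<forall>\<^sub>F R in at_top. lo R \<le> F R a b \<and> F R a b \<le> up R" using FI[of K] x by auto
  have gap: "Up K - Lo K < e / 2" using UL[of K] K x by (simp add: h_def)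
  have "\<forall>\<^sub>F R in at_top. Lo K - e / 2 < lo R" "\<forall>\<^sub>F R in at_top. up R < Up K + e / 2"
    using e lu(1,2) by (auto intro!: order_tendstoD)
  with lu(3) show "\<forall>\<^sub>F R in at_top. dist (F R a b) (integral {a..b} \<theta>) < e"
  proof eventually_elim
    case (elim R)
    then show ?case using I[of K] gap x(2) unfolding dist_real_def by auto
  qed
qed

text \<open>For u <= v, the integral of 1/(x (1 + y)) over u < y < min v (1/x). The outer
  \<open>max u\<close> makes it 0 when 1/x is below u.\<close>

definition ratio_theta :: "real \<Rightarrow> real \<Rightarrow> real \<Rightarrow> real" where
  "ratio_theta u v x = (ln (1 + max u (min v (1 / x))) - ln (1 + u)) / x"

lemma integral_inverse_1_plus:
  assumes "0 \<le> u" "u \<le> v"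
  shows "((\<lambda>y::real. 1 / (1 + y)) has_integral (ln (1 + v) - ln (1 + u))) {u..v}"
proof (rule fundamental_theorem_of_calculus)
  fix x :: real assume "x \<in> {u..v}"
  then have "((\<lambda>x. ln (1 + x)) has_real_derivative 1 / (1 + x)) (at x within {u..v})"
    using assms by (auto intro!: derivative_eq_intros)
  then show "((\<lambda>x. ln (1 + x)) has_vector_derivative 1 / (1 + x)) (at x within {u..v})"
    by (simp add: has_real_derivative_iff_has_vector_derivative)
qed (use assms in simp)

lemma ratio_theta_nonneg: "0 \<le> u \<Longrightarrow> 0 < x \<Longrightarrow> 0 \<le> ratio_theta u v x"
  by (auto simp: ratio_theta_def intro!: divide_nonneg_nonneg)

lemma ratio_theta_antimono:
  assumes "0 \<le> u" "0 < x" "x \<le> y"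
  shows "ratio_theta u v y \<le> ratio_theta u v x"
proof -
  have "1 / y \<le> 1 / x" using assms by (simp add: frac_le)
  then have "max u (min v (1 / y)) \<le> max u (min v (1 / x))" by (auto simp: max_def min_def)
  then have "ln (1 + max u (min v (1 / y))) \<le> ln (1 + max u (min v (1 / x)))"
    using assms by (subst ln_le_cancel_iff) (auto intro: add_pos_nonneg simp: le_max_iff_disj)
  then show ?thesis unfolding ratio_theta_def
    using assms by (intro frac_le) (auto simp: le_max_iff_disj)
qed

lemma continuous_on_ratio_theta: "0 \<le> u \<Longrightarrow> 0 < a \<Longrightarrow> continuous_on {a..b} (ratio_theta u v)"
  unfolding ratio_theta_def
  by (intro continuous_intros) (auto simp: add_pos_nonneg le_max_iff_disj less_eq_real_def[symmetric] intro!: add_pos_nonneg[THEN less_imp_neq, symmetric])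

lemma gauss_density_sym_nonneg: "x \<in> {0..1} \<Longrightarrow> 0 \<le> gauss_density_sym x"
  by (auto simp: gauss_density_sym_def gauss_density_def)

lemma gauss_density_sym_le: "x \<in> {0..1} \<Longrightarrow> gauss_density_sym x \<le> 3"
proof -
  assume x: "x \<in> {0..1}"
  have "gauss_density t \<le> 3/2" if "t \<in> {0..1}" for t
  proof -
    have "gauss_density t \<le> 1 / ln 2" using that by (auto simp: gauss_density_def intro!: divide_left_mono mult_pos_pos)
    also have "\<dots> \<le> 3/2" using ln2_ge_two_thirds by (simp add: divide_le_eq)
    finally show ?thesis .
  qed
  from this[of x] this[of "1 - x"] x show ?thesis by (simp add: gauss_density_sym_def)
qed

lemma gauss_density_sym_reflect: "gauss_density_sym (1 - x) = gauss_density_sym x"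
  by (simp add: gauss_density_sym_def)

lemma continuous_on_gauss_density_sym: "continuous_on {0..1} gauss_density_sym"
  unfolding gauss_density_sym_def gauss_density_def by (intro continuous_intros) auto

text \<open>In the sum of \<open>ratio_event_approx\<close> the cut y is R/c. It is a separate
  parameter because \<open>has_mean\<close> speaks of one fixed function of c: the cut is frozen on
  short ranges of c/R and then compared by monotonicity in y.\<close>

definition cut_mean :: "real set \<Rightarrow> real \<Rightarrow> nat \<Rightarrow> real" where
  "cut_mean J y c = pair_mean (\<lambda>t. indicator (J \<inter> {..y}) t * (1 / (1 + t))) gauss_density_sym c"

lemma cut_mean_mono: "y \<le> y' \<Longrightarrow> cut_mean J y c \<le> cut_mean J y' c"
  unfolding cut_mean_def pair_mean_def
  using unit_pairs_frac gauss_density_sym_nonneg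
  by (intro divide_right_mono sum_mono mult_right_mono) (auto simp: indicator_def)

lemma cut_mean_nonneg: "0 \<le> cut_mean J y c"
  unfolding cut_mean_def pair_mean_def
  using unit_pairs_frac gauss_density_sym_nonneg
  by (intro divide_nonneg_nonneg sum_nonneg mult_nonneg_nonneg) (auto simp: indicator_def)

lemma cut_mean_le: "cut_mean J y c \<le> 3"
proof (cases "c = 0")
  case False
  have "(\<Sum>z\<in>unit_pairs c. indicator (J \<inter> {..y}) (of_int (fst z) / real c) * (1 / (1 + of_int (fst z) / real c)) *
      gauss_density_sym (of_int (snd z) / real c)) \<le> (\<Sum>z\<in>unit_pairs c. 1 * 3)"
  proof (rule sum_mono)
    fix z assume "z \<in> unit_pairs c"
    note z = unit_pairs_frac[OF this]
    show "indicator (J \<inter> {..y}) (of_int (fst z) / real c) * (1 / (1 + of_int (fst z) / real c)) *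
      gauss_density_sym (of_int (snd z) / real c) \<le> 1 * 3"
      using z gauss_density_sym_nonneg[OF z(2)] gauss_density_sym_le[OF z(2)]
      by (intro mult_mono) (auto simp: indicator_def)
  qed
  also have "\<dots> \<le> real c * 3" using card_unit_pairs_le[of c] by simp
  finally show ?thesis using False by (simp add: cut_mean_def pair_mean_def pos_divide_le_eq mult.commute)
qed (simp add: cut_mean_def pair_mean_def)

text \<open>The mean is 6/pi^2. It is a parameter because \<open>totient_ratio_has_mean\<close>
  provides it without its value.\<close>

locale totient_mean =
  fixes \<kappa> :: real
  assumes \<kappa>: "has_mean (\<lambda>c. real (totient c) / real c) \<kappa>"
begin

text \<open>The constant of the limit density. The integral is 2, so this is 12/pi^2, the reciprocal
  of the integral of ln(1 + 1/x)/x over x > 1.\<close>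

definition limit_const :: real where "limit_const = \<kappa> * integral {0..1} gauss_density_sym"

lemma limit_const_nonneg: "limit_const \<ge> 0"
proof -
  have "\<kappa> \<ge> 0"
    by (rule LIMSEQ_le_const[OF \<kappa>[unfolded has_mean_def]]) (auto intro!: exI[of _ 0] divide_nonneg_nonneg sum_nonneg)
  moreover have "integral {0..1} gauss_density_sym \<ge> 0"
    by (rule Henstock_Kurzweil_Integration.integral_nonneg)
       (auto intro: integrable_continuous_real continuous_on_gauss_density_sym gauss_density_sym_nonneg)
  ultimately show ?thesis by (simp add: limit_const_def)
qed

lemma cut_mean_has_mean:
  assumes uv: "0 \<le> u" "u \<le> v" "v \<le> 1" and J: "{u<..<v} \<subseteq> J" "J \<subseteq> {u..v}"
  shows "has_mean (cut_mean J y) (limit_const * (ln (1 + max u (min v y)) - ln (1 + u)))"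
proof -
  define v' where "v' = max u (min v y)"
  have v': "u \<le> v'" "v' \<le> 1" using uv by (auto simp: v'_def)
  have "mean_null (\<lambda>c. pair_mean (\<lambda>t. indicator (J \<inter> {..y}) t * (1 / (1 + t))) gauss_density_sym c -
     real (totient c) / real c * (integral {u..v'} (\<lambda>t. 1 / (1 + t)) * integral {0..1} gauss_density_sym))"
  proof (rule equidistributed_interval)
    have "{u<..<v'} \<subseteq> {u<..<v} \<inter> {..y}" by (auto simp: v'_def max_def min_def split: if_splits)
    then show "{u<..<v'} \<subseteq> J \<inter> {..y}" using J(1) by blast
    show "J \<inter> {..y} \<subseteq> {u..v'}" using J(2) by (auto simp: v'_def)
    show "continuous_on {0..1} (\<lambda>t::real. 1 / (1 + t))" by (intro continuous_intros) auto
  qed (use uv v' in \<open>auto simp: gauss_density_sym_reflect gauss_density_sym_nonneg intro: continuous_on_gauss_density_sym\<close>)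
  moreover have "integral {u..v'} (\<lambda>t. 1 / (1 + t)) = ln (1 + v') - ln (1 + u)"
    by (rule integral_unique[OF integral_inverse_1_plus]) (use uv v' in auto)
  ultimately have mn: "mean_null (\<lambda>c. cut_mean J y c -
     ((ln (1 + v') - ln (1 + u)) * integral {0..1} gauss_density_sym) * (real (totient c) / real c))"
    by (simp add: cut_mean_def mult.commute)
  have "has_mean (cut_mean J y) (((ln (1 + v') - ln (1 + u)) * integral {0..1} gauss_density_sym) * \<kappa>)"
    by (rule has_mean_mean_null[OF has_mean_cmult[OF \<kappa>] mn])
  then show ?thesis by (simp add: limit_const_def v'_def mult_ac)
qed

text \<open>On a block s R < c <= t R the cut R/c lies between 1/t and 1/s, and the factor 1/c
  between 1/(t R) and 1/(s R). The block sum thus lies between averages with fixed cuts, whose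
  limits are (t - s) \<theta> t and (t - s) \<theta> s.\<close>

lemma ratio_event_sum_tendsto:
  assumes uv: "0 \<le> u" "u \<le> v" "v \<le> 1" and J: "{u<..<v} \<subseteq> J" "J \<subseteq> {u..v}" and ab: "1 \<le> a" "a < b"
  shows "((\<lambda>R. \<Sum>c | a * R < real c \<and> real c < b * R. cut_mean J (R / real c) c / real c) \<longlongrightarrow>
    limit_const * integral {a..b} (ratio_theta u v)) at_top"
proof -
  define F where "F R s t = (\<Sum>c | s * R < real c \<and> real c \<le> t * R. cut_mean J (R / real c) c / real c)" for R s t
  define \<theta> where "\<theta> x = limit_const * ratio_theta u v x" for x
  have "((\<lambda>R. F R a b) \<longlongrightarrow> integral {a..b} \<theta>) at_top"
  proof (rule tendsto_integral_antimono)
    show "\<theta> integrable_on {a..b}" unfolding \<theta>_def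
      using uv ab by (intro integrable_continuous_real continuous_intros continuous_on_ratio_theta) auto
    show "\<theta> y \<le> \<theta> x" if "a \<le> x" "x \<le> y" "y \<le> b" for x y
      unfolding \<theta>_def using that uv ab limit_const_nonneg by (intro mult_left_mono ratio_theta_antimono) auto
    show "F R a t = F R a s + F R s t" if st: "R > 0" "a \<le> s" "s \<le> t" for R s t
    proof -
      have "a * R \<le> s * R" "s * R \<le> t * R" using st by (auto intro: mult_right_mono)
      then have "{c. a * R < real c \<and> real c \<le> t * R} =
          {c. a * R < real c \<and> real c \<le> s * R} \<union> {c. s * R < real c \<and> real c \<le> t * R}" by auto
      then show ?thesis unfolding F_def by (simp only:) (rule sum.union_disjoint, auto intro: finite_nat_real_le)
    qed
    show "F R a a = 0" for R by (simp add: F_def) (rule sum.neutral, auto)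
    fix s t assume st: "a \<le> s" "s < t" "t \<le> b"
    have s: "s \<ge> 1" "s > 0" "t > 0" using st ab by auto
    define S where "S y R = (\<Sum>c | s * R < real c \<and> real c \<le> t * R. cut_mean J y c) / R" for y R
    have S: "(S y \<longlongrightarrow> (t - s) * (limit_const * (ln (1 + max u (min v y)) - ln (1 + u)))) at_top" for y
      unfolding S_def using s st by (intro has_mean_between cut_mean_has_mean uv J) auto
    have "((\<lambda>R. S (1 / t) R / t) \<longlongrightarrow> (t - s) * \<theta> t) at_top"
      using tendsto_divide[OF S[of "1 / t"] tendsto_const[of t]] s by (simp add: \<theta>_def ratio_theta_def)
    moreover have "((\<lambda>R. S (1 / s) R / s) \<longlongrightarrow> (t - s) * \<theta> s) at_top"
      using tendsto_divide[OF S[of "1 / s"] tendsto_const[of s]] s by (simp add: \<theta>_def ratio_theta_def)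
    moreover have "\<forall>\<^sub>F R in at_top. S (1 / t) R / t \<le> F R s t \<and> F R s t \<le> S (1 / s) R / s"
      using eventually_gt_at_top[of 0]
    proof eventually_elim
      case (elim R)
      have "cut_mean J (1 / t) c / (t * R) \<le> cut_mean J (R / real c) c / real c \<and>
          cut_mean J (R / real c) c / real c \<le> cut_mean J (1 / s) c / (s * R)"
        if c: "s * R < real c" "real c \<le> t * R" for c
      proof -
        have c0: "0 < real c" using c(1) s elim by (smt (verit) mult_pos_pos)
        have "cut_mean J (1 / t) c \<le> cut_mean J (R / real c) c" "cut_mean J (R / real c) c \<le> cut_mean J (1 / s) c"
          using c c0 s by (intro cut_mean_mono; simp add: field_simps)+
        then show ?thesis using c c0 s elim cut_mean_nonneg by (auto intro!: frac_le)
      qed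
      then have "(\<Sum>c | s * R < real c \<and> real c \<le> t * R. cut_mean J (1 / t) c / (t * R)) \<le> F R s t"
        "F R s t \<le> (\<Sum>c | s * R < real c \<and> real c \<le> t * R. cut_mean J (1 / s) c / (s * R))"
        unfolding F_def by (auto intro!: sum_mono)
      then show ?case by (simp add: S_def sum_divide_distrib mult.commute)
    qed
    ultimately show "\<exists>lo up. (lo \<longlongrightarrow> (t - s) * \<theta> t) at_top \<and> (up \<longlongrightarrow> (t - s) * \<theta> s) at_top \<and>
      (\<forall>\<^sub>F R in at_top. lo R \<le> F R s t \<and> F R s t \<le> up R)" by blast
  qed (use ab in auto)
  moreover have "integral {a..b} \<theta> = limit_const * integral {a..b} (ratio_theta u v)" unfolding \<theta>_def[abs_def] by simp
  ultimately have 1: "((\<lambda>R. F R a b) \<longlongrightarrow> limit_const * integral {a..b} (ratio_theta u v)) at_top" by simp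
  \<comment> \<open>Blocks are half-open to make F additive, while the event is open at b. The two
    sums differ by at most the single term c = b R, which is bounded by 3/R.\<close>
  define E where "E R = (\<Sum>c | a * R < real c \<and> real c < b * R. cut_mean J (R / real c) c / real c)" for R
  have "((\<lambda>R. E R - F R a b) \<longlongrightarrow> 0) at_top"
  proof (rule Lim_null_comparison)
    show "((\<lambda>R::real. 3 / R) \<longlongrightarrow> 0) at_top" by real_asymp
    show "\<forall>\<^sub>F R in at_top. norm (E R - F R a b) \<le> 3 / R"
      using eventually_gt_at_top[of 0]
    proof eventually_elim
      case (elim R)
      define G where "G c = cut_mean J (R / real c) c / real c" for c
      have G: "0 \<le> G c" for c by (simp add: G_def cut_mean_nonneg)
      have FE: "F R a b = E R + sum G {c. a * R < real c \<and> real c = b * R}"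
      proof -
        have "a * R < b * R" using ab elim by simp
        then have eq: "{c. a * R < real c \<and> real c \<le> b * R} =
          {c. a * R < real c \<and> real c < b * R} \<union> {c. a * R < real c \<and> real c = b * R}" by auto
        have fin: "finite {c. a * R < real c \<and> real c < b * R}" "finite {c. a * R < real c \<and> real c = b * R}"
          by (rule finite_subset[OF _ finite_nat_real_le[of "\<lambda>_. True" "b * R"]]; force)+
        show ?thesis unfolding F_def E_def eq using elim fin by (subst sum.union_disjoint) (auto simp: G_def)
      qed
      have "sum G {c. a * R < real c \<and> real c = b * R} \<le> 3 / R"
      proof -
        have "{c. a * R < real c \<and> real c = b * R} \<subseteq> {nat \<lfloor>b * R\<rfloor>}" by auto (metis floor_of_nat nat_int)
        then have "{c. a * R < real c \<and> real c = b * R} = {} \<or>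
            {c. a * R < real c \<and> real c = b * R} = {nat \<lfloor>b * R\<rfloor>}" by (rule subset_singletonD)
        moreover have "G c \<le> 3 / R" if "a * R < real c" for c
        proof -
          have "R \<le> a * R" using ab elim by simp
          then have "R \<le> real c" using that by linarith
          then show ?thesis unfolding G_def using elim cut_mean_le cut_mean_nonneg by (intro frac_le) auto
        qed
        moreover have "0 \<le> 3 / R" using elim by simp
        ultimately show ?thesis
        proof (elim disjE)
          assume eq: "{c. a * R < real c \<and> real c = b * R} = {nat \<lfloor>b * R\<rfloor>}"
            and le: "\<And>c. a * R < real c \<Longrightarrow> G c \<le> 3 / R"
          have "a * R < real (nat \<lfloor>b * R\<rfloor>)" using eq by blast
          then show ?thesis unfolding eq using le by simp
        next
          assume eq: "{c. a * R < real c \<and> real c = b * R} = {}" and "0 \<le> 3 / R"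
          then show ?thesis unfolding eq by simp
        qed
      qed
      moreover have "0 \<le> sum G {c. a * R < real c \<and> real c = b * R}" by (intro sum_nonneg G)
      ultimately show ?case using FE by simp
    qed
  qed
  from tendsto_add[OF this 1] show ?thesis unfolding E_def by simp
qed

lemma ratio_event_tendsto:
  assumes uv: "0 \<le> u" "u \<le> v" "v \<le> 1" and J: "{u<..<v} \<subseteq> J" "J \<subseteq> {u..v}" and ab: "1 \<le> a" "a < b"
  shows "((\<lambda>R. measure gauss_measure (ratio_event a b J R)) \<longlongrightarrow> limit_const * integral {a..b} (ratio_theta u v)) at_top"
proof -
  define E where "E R = (\<Sum>c | a * R < real c \<and> real c < b * R. cut_mean J (R / real c) c / real c)" for R
  have 1: "(E \<longlongrightarrow> limit_const * integral {a..b} (ratio_theta u v)) at_top"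
    unfolding E_def by (rule ratio_event_sum_tendsto[OF assms])
  have "((\<lambda>R. measure gauss_measure (ratio_event a b J R) - E R) \<longlongrightarrow> 0) at_top"
  proof (rule Lim_null_comparison)
    show "((\<lambda>R::real. 3 * b / R\<^sup>2) \<longlongrightarrow> 0) at_top" by real_asymp
    show "\<forall>\<^sub>F R in at_top. norm (measure gauss_measure (ratio_event a b J R) - E R) \<le> 3 * b / R\<^sup>2"
      using eventually_ge_at_top[of 1]
    proof eventually_elim
      case (elim R)
      then show ?case using ratio_event_approx(2)[of a b R J] ab by (simp add: E_def cut_mean_def)
    qed
  qed
  from tendsto_add[OF this 1] show ?thesis by simp
qed

end

section \<open>The limit measure\<close>

lemma cf_eval_Cons: "cf_eval (a # as) t = 1 / (real a + cf_eval as t)"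
  by (simp add: cf_eval_def)

lemma image_inverse_add:
  fixes a u v :: real
  assumes "a > 0" "0 \<le> u" and uv: "u < v"
  shows "(\<lambda>r. 1 / (a + r)) ` {u<..<v} = {1 / (a + v)<..<1 / (a + u)}"
    and "(\<lambda>r. 1 / (a + r)) ` {u..v} = {1 / (a + v)..1 / (a + u)}"
proof -
  show "(\<lambda>r. 1 / (a + r)) ` {u<..<v} = {1 / (a + v)<..<1 / (a + u)}"
  proof (rule subset_antisym)
    show "(\<lambda>r. 1 / (a + r)) ` {u<..<v} \<subseteq> {1 / (a + v)<..<1 / (a + u)}"
      using assms uv by (auto intro!: divide_strict_left_mono mult_pos_pos)
    show "{1 / (a + v)<..<1 / (a + u)} \<subseteq> (\<lambda>r. 1 / (a + r)) ` {u<..<v}"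
    proof
      fix y assume y: "y \<in> {1 / (a + v)<..<1 / (a + u)}"
      moreover have "0 < 1 / (a + v)" using assms uv by simp
      moreover from y have "1 / (a + v) \<le> y" by simp
      ultimately have y0: "y > 0" by linarith
      have "1 / y - a \<in> {u<..<v}" using y y0 assms uv by (auto simp: field_simps)
      then show "y \<in> (\<lambda>r. 1 / (a + r)) ` {u<..<v}" by (intro image_eqI[where x = "1 / y - a"]) simp_all
    qed
  qed
  show "(\<lambda>r. 1 / (a + r)) ` {u..v} = {1 / (a + v)..1 / (a + u)}"
  proof (rule subset_antisym)
    show "(\<lambda>r. 1 / (a + r)) ` {u..v} \<subseteq> {1 / (a + v)..1 / (a + u)}"
      using assms uv by (auto intro!: divide_left_mono mult_pos_pos)
    show "{1 / (a + v)..1 / (a + u)} \<subseteq> (\<lambda>r. 1 / (a + r)) ` {u..v}"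
    proof
      fix y assume y: "y \<in> {1 / (a + v)..1 / (a + u)}"
      moreover have "0 < 1 / (a + v)" using assms uv by simp
      moreover from y have "1 / (a + v) \<le> y" by simp
      ultimately have y0: "y > 0" by linarith
      have "1 / y - a \<in> {u..v}" using y y0 assms uv by (auto simp: field_simps)
      then show "y \<in> (\<lambda>r. 1 / (a + r)) ` {u..v}" by (intro image_eqI[where x = "1 / y - a"]) simp_all
    qed
  qed
qed

text \<open>A composition of the decreasing maps from r to 1/(a + r). The open image belongs to
  irrational numbers; the closed one serves ratios of denominators, whose rational remainders may be
  0 or 1.\<close>

lemma cf_eval_interval:
  assumes "\<forall>a\<in>set as. a \<ge> 1"
  shows "\<exists>u v. 0 \<le> u \<and> u < v \<and> v \<le> 1 \<and> cf_eval as ` {0<..<1} = {u<..<v} \<and> cf_eval as ` {0..1} = {u..v}"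
  using assms
proof (induction as)
  case Nil
  have "cf_eval [] = id" by (auto simp: cf_eval_def)
  then show ?case by (intro exI[of _ 0] exI[of _ 1]) simp
next
  case (Cons a as)
  then obtain u v where uv: "0 \<le> u" "u < v" "v \<le> 1" "cf_eval as ` {0<..<1} = {u<..<v}" "cf_eval as ` {0..1} = {u..v}" by auto
  have a: "real a \<ge> 1" using Cons.prems by simp
  have "cf_eval (a # as) ` S = (\<lambda>r. 1 / (real a + r)) ` (cf_eval as ` S)" for S
    by (simp add: image_image cf_eval_Cons)
  then have "cf_eval (a # as) ` {0<..<1} = {1 / (real a + v)<..<1 / (real a + u)}"
    "cf_eval (a # as) ` {0..1} = {1 / (real a + v)..1 / (real a + u)}"
    using image_inverse_add[of "real a" u v] uv a by auto
  moreover have "0 \<le> 1 / (real a + v)" "1 / (real a + v) < 1 / (real a + u)" "1 / (real a + u) \<le> 1"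
    using uv a by (auto simp: frac_less2 divide_le_eq)
  ultimately show ?case by blast
qed

text \<open>\<open>cf_ratio \<alpha> n\<close> is \<open>q\<^bsub>n-1\<^esub>/q\<^sub>n\<close>, with \<open>q\<^bsub>-1\<^esub> = 0\<close>.\<close>
definition cf_ratio :: "real \<Rightarrow> nat \<Rightarrow> real" where
  "cf_ratio \<alpha> n = (case n of 0 \<Rightarrow> 0 | Suc m \<Rightarrow> real (cf_q \<alpha> m) / real (cf_q \<alpha> (Suc m)))"

lemma cf_ratio_Suc:
  assumes "\<alpha> \<in> irr01"
  shows "cf_ratio \<alpha> (Suc n) = 1 / (real (cf_entry \<alpha> (Suc n)) + cf_ratio \<alpha> n)"
proof (cases n)
  case (Suc m)
  have q: "real (cf_q \<alpha> (Suc m)) > 0" using cf_q_ge[OF irr01D[OF assms], of "Suc m"] by (simp del: cf_q.simps)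
  have "real (cf_q \<alpha> (Suc (Suc m))) = real (cf_q \<alpha> (Suc m)) * (real (cf_entry \<alpha> (Suc (Suc m))) + real (cf_q \<alpha> m) / real (cf_q \<alpha> (Suc m)))"
    using q by (simp add: distrib_left mult.commute)
  then show ?thesis using q by (simp add: cf_ratio_def Suc del: cf_q.simps)
qed (simp add: cf_ratio_def)

lemma cf_ratio_01:
  assumes "\<alpha> \<in> irr01"
  shows "cf_ratio \<alpha> n \<in> {0..1}"
  using cf_q_mono[OF assms, of "n - 1" n] by (cases n) (auto simp: cf_ratio_def divide_le_eq_1 simp del: cf_q.simps)

text \<open>After N steps the remainder is an earlier ratio. It can be 0, when no entries are left,
  or 1, when the only entry left is 1; so the closed interval appears.\<close>

lemma cf_ratio_entries_imp:
  assumes "\<alpha> \<in> irr01" "\<And>k. k < N \<Longrightarrow> k < m \<and> cf_entry \<alpha> (m - k) = c k"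
  shows "cf_ratio \<alpha> m \<in> cf_eval (map c [0..<N]) ` {0..1}"
  using assms(2)
proof (induction N arbitrary: m c)
  case 0
  then show ?case using cf_ratio_01[OF assms(1)] by (simp add: cf_eval_def)
next
  case (Suc N)
  obtain n where n: "m = Suc n" using Suc.prems[of 0] by (cases m) auto
  have "k < n \<and> cf_entry \<alpha> (n - k) = c (Suc k)" if "k < N" for k
    using Suc.prems[of "Suc k"] that by (simp add: n)
  from Suc.IH[of n "\<lambda>k. c (Suc k)", OF this] obtain t where t: "t \<in> {0..1}" "cf_ratio \<alpha> n = cf_eval (map (\<lambda>k. c (Suc k)) [0..<N]) t"
    by auto
  have "cf_entry \<alpha> (Suc n) = c 0" using Suc.prems[of 0] by (simp add: n)
  then have "cf_ratio \<alpha> m = cf_eval (c 0 # map (\<lambda>k. c (Suc k)) [0..<N]) t"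
    using cf_ratio_Suc[OF assms(1), of n] t(2) by (simp add: n cf_eval_Cons)
  then have "cf_ratio \<alpha> m = cf_eval (map c [0..<Suc N]) t" by (simp only: map_upt_Suc)
  then show ?case using t(1) by blast
qed

lemma cf_eval_open_01:
  assumes "\<forall>a\<in>set as. a \<ge> 1" "t \<in> {0<..<1}"
  shows "cf_eval as t \<in> {0<..<1}"
proof -
  obtain u v where uv: "0 \<le> u" "v \<le> 1" "cf_eval as ` {0<..<1} = {u<..<v}"
    using cf_eval_interval[OF assms(1)] by blast
  have "cf_eval as t \<in> {u<..<v}" unfolding uv(3)[symmetric] using assms(2) by (rule imageI)
  then show ?thesis using uv by auto
qed

text \<open>At each step the remainder s lies strictly between 0 and 1 and the preceding ratio in
  [0, 1], so the two integer parts differ by less than 1 and agree. A ratio of the form 1/(c 0 + s)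
  is nonzero, which makes m positive and yields k < m.\<close>

lemma cf_ratio_imp_entries:
  assumes "\<alpha> \<in> irr01" "\<And>k. k < N \<Longrightarrow> c k \<ge> 1"
    and "cf_ratio \<alpha> m \<in> cf_eval (map c [0..<N]) ` {0<..<1}" "k < N"
  shows "k < m \<and> cf_entry \<alpha> (m - k) = c k"
  using assms(2-)
proof (induction N arbitrary: m c k)
  case (Suc N)
  obtain t where t: "t \<in> {0<..<1}" "cf_ratio \<alpha> m = cf_eval (map c [0..<Suc N]) t" using Suc.prems(2) by auto
  define s where "s = cf_eval (map (\<lambda>k. c (Suc k)) [0..<N]) t"
  have s: "0 < s" "s < 1"
    using cf_eval_open_01[OF _ t(1), of "map (\<lambda>k. c (Suc k)) [0..<N]"] Suc.prems(1) by (auto simp: s_def)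
  have "cf_ratio \<alpha> m = cf_eval (c 0 # map (\<lambda>k. c (Suc k)) [0..<N]) t" unfolding t(2) map_upt_Suc ..
  then have rm: "cf_ratio \<alpha> m = 1 / (real (c 0) + s)" by (simp add: cf_eval_Cons s_def)
  have pos: "real (c 0) + s > 0" using s by simp
  then have "cf_ratio \<alpha> m \<noteq> 0" using rm by simp
  then obtain n where n: "m = Suc n" by (cases m) (auto simp: cf_ratio_def)
  have "1 / (real (cf_entry \<alpha> (Suc n)) + cf_ratio \<alpha> n) = 1 / (real (c 0) + s)"
    using rm cf_ratio_Suc[OF assms(1), of n] by (simp add: n)
  then have eq: "real (cf_entry \<alpha> (Suc n)) + cf_ratio \<alpha> n = real (c 0) + s" by simp
  have r: "0 \<le> cf_ratio \<alpha> n" "cf_ratio \<alpha> n \<le> 1" using cf_ratio_01[OF assms(1), of n] by auto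
  have "real (cf_entry \<alpha> (Suc n)) < real (c 0) + 1" "real (c 0) < real (cf_entry \<alpha> (Suc n)) + 1"
    using eq r s by linarith+
  then have e0: "cf_entry \<alpha> (Suc n) = c 0" by linarith
  show ?case
  proof (cases k)
    case 0
    then show ?thesis using e0 n by simp
  next
    case (Suc j)
    have "cf_ratio \<alpha> n = s" using eq e0 by simp
    then have "cf_ratio \<alpha> n \<in> cf_eval (map (\<lambda>k. c (Suc k)) [0..<N]) ` {0<..<1}" using t(1) by (auto simp: s_def)
    from Suc.IH[OF _ this, of j] show ?thesis using Suc.prems \<open>k = Suc j\<close> n by simp
  qed
qed simp

lemma cf_entry_gauss_map: "cf_entry \<alpha> (Suc (Suc k)) = cf_entry (gauss_map \<alpha>) (Suc k)"
  by (simp add: cf_entry_def funpow_swap1)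

text \<open>For irrational y the remaining Gauss iterate always lies inside (0, 1), so the open
  image is exact and endpoints do not occur.\<close>

lemma cf_entries_iff:
  assumes y: "y \<in> irr01" and c: "\<And>k. k < N \<Longrightarrow> c k \<ge> 1"
  shows "(\<forall>k<N. cf_entry y (Suc k) = c k) \<longleftrightarrow> y \<in> cf_eval (map c [0..<N]) ` {0<..<1}"
proof
  assume e: "\<forall>k<N. cf_entry y (Suc k) = c k"
  have "map (cf_entry y) [1..<Suc N] = map c [0..<N]"
    using e by (intro nth_equalityI) (auto simp del: upt_Suc)
  then have "y = cf_eval (map c [0..<N]) ((gauss_map ^^ N) y)"
    using cf_eval_tail[OF irr01D[OF y], of N] by simp
  moreover have "(gauss_map ^^ N) y \<in> {0<..<1}" using gauss_map_iterate[OF irr01D[OF y], of N] by auto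
  ultimately show "y \<in> cf_eval (map c [0..<N]) ` {0<..<1}" by blast
next
  assume "y \<in> cf_eval (map c [0..<N]) ` {0<..<1}"
  then show "\<forall>k<N. cf_entry y (Suc k) = c k"
    using y c
  proof (induction N arbitrary: y c)
    case (Suc N)
    obtain t where t: "t \<in> {0<..<1}" "y = cf_eval (map c [0..<Suc N]) t" using Suc.prems(1) by auto
    define s where "s = cf_eval (map (\<lambda>k. c (Suc k)) [0..<N]) t"
    have s: "0 < s" "s < 1"
      using cf_eval_open_01[OF _ t(1), of "map (\<lambda>k. c (Suc k)) [0..<N]"] Suc.prems(3) by (auto simp: s_def)
    have "y = cf_eval (c 0 # map (\<lambda>k. c (Suc k)) [0..<N]) t" unfolding t(2) map_upt_Suc ..
    then have y: "1 / y = real (c 0) + s" by (simp add: cf_eval_Cons s_def)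
    have fl: "\<lfloor>1 / y\<rfloor> = int (c 0)" unfolding y using s by (simp add: floor_eq_iff)
    then have e0: "cf_entry y (Suc 0) = c 0" by (simp add: cf_entry_def)
    have gy: "gauss_map y = s" unfolding gauss_map_def frac_def fl using y by simp
    have "gauss_map y \<in> irr01" using gauss_map_irrational[OF irr01D(2)[OF Suc.prems(2)]] by (auto simp: irr01_def)
    then have "\<forall>k<N. cf_entry (gauss_map y) (Suc k) = c (Suc k)"
      by (rule Suc.IH[rotated]) (use Suc.prems gy t(1) in \<open>auto simp: s_def\<close>)
    then show ?case using e0 by (auto simp: less_Suc_eq_0_disj cf_entry_gauss_map)
  qed simp
qed

section \<open>Tail bound for the ratio of the denominator to R\<close>

lemma measure_gauss_irr01: "measure gauss_measure irr01 = 1" "irr01 \<in> sets gauss_measure"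
  using measure_gauss_interval[of 0 1] by (auto simp: irr01_def intro!: sets_gauss_measure)

text \<open>The density is at most 1/ln 2 <= 3/2 and the length at most 2 \<delta>.\<close>

lemma measure_gauss_interval_le:
  assumes "x \<in> {0..1}" "\<delta> > 0"
  shows "measure gauss_measure ({max 0 (x - \<delta>)<..<min 1 (x + \<delta>)} - \<rat>) \<le> 3 * \<delta>"
    and "{max 0 (x - \<delta>)<..<min 1 (x + \<delta>)} - \<rat> \<in> sets gauss_measure"
proof -
  define lo hi where "lo = max 0 (x - \<delta>)" and "hi = min 1 (x + \<delta>)"
  have lh: "0 \<le> lo" "lo \<le> hi" "hi \<le> 1" "hi - lo \<le> 2 * \<delta>" using assms by (auto simp: lo_def hi_def)
  have "measure gauss_measure ({lo<..<hi} - \<rat>) = (ln (1 + hi) - ln (1 + lo)) / ln 2"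
    by (rule measure_gauss_interval) (use lh in auto)
  also have "\<dots> \<le> (2 * \<delta>) / ln 2"
  proof (rule divide_right_mono)
    have "ln (1 + hi) - ln (1 + lo) \<le> ((1 + hi) - (1 + lo)) / (1 + lo)"
      by (rule ln_diff_le) (use lh in auto)
    also have "\<dots> \<le> (hi - lo) / 1" using lh by (intro frac_le) auto
    finally show "ln (1 + hi) - ln (1 + lo) \<le> 2 * \<delta>" using lh by simp
  qed simp
  also have "\<dots> \<le> 3 * \<delta>" using ln2_ge_two_thirds assms(2) by (simp add: divide_le_eq)
  finally show "measure gauss_measure ({max 0 (x - \<delta>)<..<min 1 (x + \<delta>)} - \<rat>) \<le> 3 * \<delta>"
    by (simp add: lo_def hi_def)
  show "{max 0 (x - \<delta>)<..<min 1 (x + \<delta>)} - \<rat> \<in> sets gauss_measure"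
    by (rule sets_gauss_measure) auto
qed

lemma cf_convergent_dist:
  assumes "\<alpha> \<in> irr01"
  shows "\<bar>\<alpha> - real (cf_p \<alpha> n) / real (cf_q \<alpha> n)\<bar> < 1 / (real (cf_q \<alpha> n) * real (cf_q \<alpha> (Suc n)))"
proof -
  note \<alpha> = irr01D[OF assms(1)]
  obtain t where t: "0 < t" "t < 1" and \<alpha>_eq:
    "\<alpha> = (real (cf_p \<alpha> (Suc n)) + t * real (cf_p \<alpha> n)) / (real (cf_q \<alpha> (Suc n)) + t * real (cf_q \<alpha> n))"
    using cf_tail_decomposition[OF assms(1)] .
  define p p' q q' where "p = real (cf_p \<alpha> n)" and "p' = real (cf_p \<alpha> (Suc n))"
    and "q = real (cf_q \<alpha> n)" and "q' = real (cf_q \<alpha> (Suc n))"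
  have q: "1 \<le> q" "1 \<le> q'"
    using cf_q_ge[OF \<alpha>, of n] cf_q_ge[OF \<alpha>, of "Suc n"]
    by (auto simp: q_def q'_def simp del: cf_q.simps)
  have eq: "\<alpha> = (p' + t * p) / (q' + t * q)"
    using \<alpha>_eq by (simp only: p_def p'_def q_def q'_def)
  have pos: "q' + t * q > 0" "q > 0" using t q by (auto intro: add_pos_pos)
  have "\<alpha> - p / q = (p' + t * p) / (q' + t * q) - p / q" using eq by simp
  also have "\<dots> = ((p' + t * p) * q - p * (q' + t * q)) / ((q' + t * q) * q)"
    using pos by (subst diff_frac_eq) auto
  also have "(p' + t * p) * q - p * (q' + t * q) = p' * q - p * q'"
    by (simp add: algebra_simps)
  also have "p' * q - p * q' = (-1) ^ n"
    using arg_cong[OF cf_det[of \<alpha> n], of real_of_int] by (simp add: p_def p'_def q_def q'_def)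
  finally have "\<bar>\<alpha> - p / q\<bar> = 1 / (q * (q' + t * q))" using pos by (simp add: abs_mult mult.commute)
  also have "\<dots> < 1 / (q * q')"
    using pos q t by (intro divide_strict_left_mono mult_strict_left_mono mult_pos_pos) auto
  finally show ?thesis by (simp add: p_def q_def q'_def)
qed

text \<open>If q_{n+1} >= b R and d = q_n <= R, then \<alpha> is within 1/(d b R) of a fraction with
  denominator d. There are d + 1 <= 2 d numerators, each costing 3/(d b R); summed over d <= R this
  is at most 6/b. The bound is uniform in R, so no mass escapes to infinity.\<close>

lemma measure_ratio_event_ge:
  assumes b: "b > 0" and R: "R \<ge> 1"
  shows "1 - 6 / b \<le> measure gauss_measure (ratio_event 1 b {0..1} R)"
proof -
  interpret prob_space gauss_measure by (rule prob_space_gauss_measure)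
  define m where "m = nat \<lfloor>R\<rfloor>"
  have m: "real m \<le> R" using R by (simp add: m_def)
  define W where "W d p = {max 0 (real p / real d - 1 / (real d * (b * R)))<..<min 1 (real p / real d + 1 / (real d * (b * R)))} - \<rat>" for d p :: nat
  have bR: "b * R > 0" using b R by simp
  have W: "measure gauss_measure (W d p) \<le> 3 * (1 / (real d * (b * R)))" "W d p \<in> sets gauss_measure"
    if "d \<in> {1..m}" "p \<in> {0..d}" for d p
    unfolding W_def using that bR by (intro measure_gauss_interval_le; auto simp: divide_le_eq_1)+
  have cover: "irr01 \<subseteq> ratio_event 1 b {0..1} R \<union> (\<Union>d\<in>{1..m}. \<Union>p\<in>{0..d}. W d p)"
  proof
    fix \<alpha> assume \<alpha>: "\<alpha> \<in> irr01"
    obtain n where n: "cf_n R \<alpha> = Suc n" "real (cf_q \<alpha> n) \<le> R" "R < real (cf_q \<alpha> (Suc n))"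
      using cf_n_props[OF \<alpha> R] .
    show "\<alpha> \<in> ratio_event 1 b {0..1} R \<union> (\<Union>d\<in>{1..m}. \<Union>p\<in>{0..d}. W d p)"
    proof (cases "real (cf_q \<alpha> (Suc n)) < b * R")
      case True
      have "cf_ratio \<alpha> (Suc n) \<in> {0..1}" by (rule cf_ratio_01[OF \<alpha>])
      then have "real (cf_q \<alpha> n) / real (cf_q \<alpha> (Suc n)) \<in> {0..1}" by (simp only: cf_ratio_def nat.case)
      then show ?thesis using \<alpha> n True by (simp add: ratio_event_def del: cf_q.simps)
    next
      case False
      define d where "d = cf_q \<alpha> n"
      have d: "1 \<le> d" "d \<le> m" using cf_q_ge[OF irr01D[OF \<alpha>], of n] n(2) by (auto simp: d_def m_def le_nat_iff le_floor_iff)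
      have "1 / (real d * real (cf_q \<alpha> (Suc n))) \<le> 1 / (real d * (b * R))"
        using False d b R n(3) by (intro divide_left_mono mult_left_mono mult_pos_pos) auto
      then have "\<bar>\<alpha> - real (cf_p \<alpha> n) / real d\<bar> < 1 / (real d * (b * R))"
        using cf_convergent_dist[OF \<alpha>, of n] by (simp add: d_def del: cf_q.simps cf_p.simps)
      then have "\<alpha> \<in> W d (cf_p \<alpha> n)" using \<alpha> by (auto simp: W_def irr01_def abs_less_iff)
      moreover have "cf_p \<alpha> n \<in> {0..d}" using cf_p_le_cf_q[OF \<alpha>, of n] by (simp add: d_def)
      ultimately show ?thesis using d by auto
    qed
  qed
  have sets: "ratio_event 1 b {0..1} R \<in> sets gauss_measure" by (rule ratio_event_approx(1)) (use b R in auto)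
  have "1 = measure gauss_measure irr01" by (simp add: measure_gauss_irr01)
  also have "\<dots> \<le> measure gauss_measure (ratio_event 1 b {0..1} R \<union> (\<Union>d\<in>{1..m}. \<Union>p\<in>{0..d}. W d p))"
    by (intro finite_measure_mono cover sets.Un sets.finite_UN sets W) auto
  also have "\<dots> \<le> measure gauss_measure (ratio_event 1 b {0..1} R) + measure gauss_measure (\<Union>d\<in>{1..m}. \<Union>p\<in>{0..d}. W d p)"
    by (intro measure_Un_le sets.finite_UN sets W) auto
  also have "measure gauss_measure (\<Union>d\<in>{1..m}. \<Union>p\<in>{0..d}. W d p) \<le> (\<Sum>d\<in>{1..m}. measure gauss_measure (\<Union>p\<in>{0..d}. W d p))"
    using W by (intro finite_measure_subadditive_finite image_subsetI sets.finite_UN) auto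
  also have "\<dots> \<le> (\<Sum>d\<in>{1..m}. \<Sum>p\<in>{0..d}. measure gauss_measure (W d p))"
    using W by (intro sum_mono finite_measure_subadditive_finite image_subsetI) auto
  also have "\<dots> \<le> (\<Sum>d\<in>{1..m}. \<Sum>p\<in>{0..d}. 3 * (1 / (real d * (b * R))))"
    by (intro sum_mono W)
  also have "\<dots> \<le> (\<Sum>d\<in>{1..m}. 6 / (b * R))"
  proof (rule sum_mono)
    fix d assume "d \<in> {1..m}"
    then have d: "real d \<ge> 1" by simp
    have "(\<Sum>p\<in>{0..d}. 3 * (1 / (real d * (b * R)))) = (real d + 1) * (3 * (1 / (real d * (b * R))))" by simp
    also have "\<dots> \<le> (2 * real d) * (3 * (1 / (real d * (b * R))))"
      using d bR by (intro mult_right_mono) auto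
    also have "\<dots> = 6 / (b * R)" using d by simp
    finally show "(\<Sum>p\<in>{0..d}. 3 * (1 / (real d * (b * R)))) \<le> 6 / (b * R)" .
  qed
  also have "\<dots> = real m * (6 / (b * R))" by simp
  also have "\<dots> \<le> R * (6 / (b * R))" using m bR by (intro mult_right_mono) auto
  also have "\<dots> = 6 / b" using R by simp
  finally show ?thesis by simp
qed

section \<open>Construction of the limit measure\<close>

context totient_mean
begin

definition limit_density :: "real \<times> real \<Rightarrow> real" where
  "limit_density z = (if 1 < fst z \<and> 0 < snd z \<and> snd z < 1 \<and> snd z < 1 / fst z then limit_const / (fst z * (1 + snd z)) else 0)"

definition limit_measure :: "(real \<times> real) measure" where
  "limit_measure = density (lborel \<Otimes>\<^sub>M lborel) (\<lambda>z. ennreal (limit_density z))"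

lemma limit_density_measurable [measurable]: "limit_density \<in> borel_measurable (lborel \<Otimes>\<^sub>M lborel)"
  unfolding limit_density_def by measurable

lemma sets_limit_measure [simp, measurable_cong]: "sets limit_measure = sets (borel \<Otimes>\<^sub>M borel)"
  unfolding limit_measure_def sets_density by (intro sets_pair_measure_cong) auto

lemma space_limit_measure [simp]: "space limit_measure = UNIV"
  by (simp add: limit_measure_def space_pair_measure)

text \<open>By Fubini: integrating the density over y gives \<open>limit_const\<close> times
  \<open>ratio_theta\<close>, the integrand of \<open>ratio_event_tendsto\<close>. Boundary lines
  are null sets.\<close>

lemma emeasure_limit_measure_box:
  assumes uv: "0 \<le> u" "u \<le> v" "v \<le> 1" and ab: "1 \<le> a" "a \<le> b"
  shows "emeasure limit_measure ({a<..<b} \<times> {u<..<v}) = ennreal (limit_const * integral {a..b} (ratio_theta u v))"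
proof -
  have S: "{a<..<b} \<times> {u<..<v} \<in> sets (lborel \<Otimes>\<^sub>M lborel :: (real \<times> real) measure)" by measurable
  have "emeasure limit_measure ({a<..<b} \<times> {u<..<v}) =
      (\<integral>\<^sup>+ z. ennreal (limit_density z) * indicator ({a<..<b} \<times> {u<..<v}) z \<partial>(lborel \<Otimes>\<^sub>M lborel))"
    unfolding limit_measure_def using S by (intro emeasure_density) auto
  also have "\<dots> = (\<integral>\<^sup>+ x. \<integral>\<^sup>+ y. ennreal (limit_density (x, y)) * indicator ({a<..<b} \<times> {u<..<v}) (x, y) \<partial>lborel \<partial>lborel)"
    using S by (intro lborel.nn_integral_fst[symmetric]) measurable
  also have "\<dots> = (\<integral>\<^sup>+ x. ennreal (limit_const * ratio_theta u v x) * indicator {a<..<b} x \<partial>lborel)"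
  proof (rule nn_integral_cong)
    fix x :: real
    show "(\<integral>\<^sup>+ y. ennreal (limit_density (x, y)) * indicator ({a<..<b} \<times> {u<..<v}) (x, y) \<partial>lborel) =
        ennreal (limit_const * ratio_theta u v x) * indicator {a<..<b} x"
    proof (cases "x \<in> {a<..<b}")
      case True
      then have x: "x > 1" "a < x" "x < b" using ab by auto
      define v' where "v' = max u (min v (1 / x))"
      have v': "u \<le> v'" by (simp add: v'_def)
      have "(\<integral>\<^sup>+ y. ennreal (limit_density (x, y)) * indicator ({a<..<b} \<times> {u<..<v}) (x, y) \<partial>lborel) =
          (\<integral>\<^sup>+ y. ennreal (limit_const / x * (1 / (1 + y))) * indicator {u..v'} y \<partial>lborel)"
      proof (rule nn_integral_cong_AE)
        show "AE y in lborel. ennreal (limit_density (x, y)) * indicator ({a<..<b} \<times> {u<..<v}) (x, y) =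
          ennreal (limit_const / x * (1 / (1 + y))) * indicator {u..v'} y"
          using AE_lborel_singleton[of u] AE_lborel_singleton[of v']
        proof eventually_elim
          case (elim y)
          have iff: "y \<in> {u..v'} \<longleftrightarrow> u < y \<and> y < v \<and> y < 1 / x"
          proof -
            have "y \<in> {u..v'} \<longleftrightarrow> u < y \<and> y < v'" using elim by auto
            also have "\<dots> \<longleftrightarrow> u < y \<and> y < v \<and> y < 1 / x" by (auto simp: v'_def less_max_iff_disj)
            finally show ?thesis .
          qed
          show ?case
          proof (cases "u < y \<and> y < v \<and> y < 1 / x")
            case in_set: True
            then have "limit_density (x, y) = limit_const / x * (1 / (1 + y))" using x uv by (simp add: limit_density_def)
            then show ?thesis using in_set True iff by simp
          next
            case False
            have "limit_density (x, y) = 0 \<or> (x, y) \<notin> {a<..<b} \<times> {u<..<v}" using False by (auto simp: limit_density_def)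
            moreover have "y \<notin> {u..v'}" using False iff by blast
            ultimately show ?thesis by (auto simp: indicator_def)
          qed
        qed
      qed
      also have "\<dots> = ennreal (limit_const / x * (ln (1 + v') - ln (1 + u)))"
      proof (rule nn_integral_has_integral_lebesgue')
        show "((\<lambda>y. limit_const / x * (1 / (1 + y))) has_integral limit_const / x * (ln (1 + v') - ln (1 + u))) {u..v'}"
          by (intro has_integral_mult_right integral_inverse_1_plus uv v')
      qed (use uv x limit_const_nonneg in auto)
      also have "limit_const / x * (ln (1 + v') - ln (1 + u)) = limit_const * ratio_theta u v x" by (simp add: ratio_theta_def v'_def)
      finally show ?thesis using True by simp
    next
      case False
      then have "indicator ({a<..<b} \<times> {u<..<v}) (x, y) = (0 :: ennreal)" for y by (auto simp: indicator_def)
      then show ?thesis using False by simp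
    qed
  qed
  also have "\<dots> = (\<integral>\<^sup>+ x. ennreal (limit_const * ratio_theta u v x) * indicator {a..b} x \<partial>lborel)"
    by (rule nn_integral_cong_AE)
       (use AE_lborel_singleton[of a] AE_lborel_singleton[of b] in eventually_elim, auto split: split_indicator)
  also have "\<dots> = ennreal (limit_const * integral {a..b} (ratio_theta u v))"
  proof (rule nn_integral_has_integral_lebesgue')
    show "((\<lambda>x. limit_const * ratio_theta u v x) has_integral limit_const * integral {a..b} (ratio_theta u v)) {a..b}"
      using uv ab by (intro has_integral_mult_right integrable_integral integrable_continuous_real continuous_on_ratio_theta) auto
  qed (use uv ab limit_const_nonneg ratio_theta_nonneg in auto)
  finally show ?thesis .
qed

lemma integral_ratio_theta_nonneg:
  assumes "0 \<le> u" "1 \<le> a"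
  shows "0 \<le> limit_const * integral {a..b} (ratio_theta u v)"
proof -
  have "0 \<le> integral {a..b} (ratio_theta u v)"
    using assms by (intro Henstock_Kurzweil_Integration.integral_nonneg integrable_continuous_real
        continuous_on_ratio_theta ratio_theta_nonneg) auto
  then show ?thesis using limit_const_nonneg by simp
qed

lemma prob_space_limit_measure: "prob_space limit_measure"
proof
  define A where "A n = {1<..<real n + 2} \<times> {0<..<1 :: real}" for n :: nat
  define I where "I n = limit_const * integral {1..real n + 2} (ratio_theta 0 1)" for n :: nat
  have emA: "emeasure limit_measure (A n) = ennreal (I n)" for n
    unfolding A_def I_def by (rule emeasure_limit_measure_box) auto
  have I: "1 - 6 / (real n + 2) \<le> I n" "I n \<le> 1" for n
  proof -
    interpret gm: prob_space gauss_measure by (rule prob_space_gauss_measure)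
    have lim: "((\<lambda>R. measure gauss_measure (ratio_event 1 (real n + 2) {0..1} R)) \<longlongrightarrow> I n) at_top"
      unfolding I_def by (rule ratio_event_tendsto) auto
    show "1 - 6 / (real n + 2) \<le> I n"
    proof (rule tendsto_lowerbound[OF lim])
      show "\<forall>\<^sub>F R in at_top. 1 - 6 / (real n + 2) \<le> measure gauss_measure (ratio_event 1 (real n + 2) {0..1} R)"
        using eventually_ge_at_top[of 1] by eventually_elim (rule measure_ratio_event_ge, auto)
    qed simp
    show "I n \<le> 1"
      by (rule tendsto_upperbound[OF lim]) auto
  qed
  have "I \<longlonglongrightarrow> 1"
  proof (rule tendsto_sandwich[OF _ _ _ tendsto_const])
    show "(\<lambda>n. 1 - 6 / (real n + 2)) \<longlonglongrightarrow> 1" by real_asymp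
  qed (use I in auto)
  then have 1: "(\<lambda>n. emeasure limit_measure (A n)) \<longlonglongrightarrow> ennreal 1"
    unfolding emA by (intro tendsto_ennrealI)
  have inc: "incseq A" by (auto simp: A_def incseq_def)
  have "range A \<subseteq> sets limit_measure" unfolding sets_limit_measure by (auto simp: A_def)
  then have 2: "(\<lambda>n. emeasure limit_measure (A n)) \<longlonglongrightarrow> emeasure limit_measure (\<Union>n. A n)"
    using inc by (rule Lim_emeasure_incseq)
  have "emeasure limit_measure (\<Union>n. A n) = emeasure limit_measure UNIV"
  proof (rule emeasure_eq_AE)
    have UN: "(\<Union>n. A n) = {1<..} \<times> {0<..<1}"
    proof -
      have "\<exists>n. x < real n + 2" for x :: real
        using reals_Archimedean2[of x] by (metis add_strict_increasing2 less_eq_real_def of_nat_0_le_iff zero_less_numeral add.commute)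
      then show ?thesis by (auto simp: A_def)
    qed
    show "AE x in limit_measure. (x \<in> (\<Union>n. A n)) = (x \<in> UNIV)"
      unfolding UN limit_measure_def
      by (subst AE_density) (auto simp: limit_density_def intro!: AE_I2)
    show "(\<Union>n. A n) \<in> sets limit_measure" unfolding UN sets_limit_measure by auto
    show "UNIV \<in> sets limit_measure" using sets.top[of limit_measure] by simp
  qed
  then show "emeasure limit_measure (space limit_measure) = 1"
    using LIMSEQ_unique[OF 2 1] by simp
qed

lemma AE_limit_measure: "AE z in limit_measure. 1 < fst z \<and> snd z \<in> irr01"
proof -
  have rat: "AE x in lborel. x \<notin> (\<rat> :: real set)"
    by (rule AE_not_in) (auto intro!: countable_imp_null_set_lborel countable_rat)
  have "AE z in (lborel \<Otimes>\<^sub>M lborel :: (real \<times> real) measure). snd z \<notin> (\<rat> :: real set)"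
  proof (rule lborel_pair.AE_pair_measure)
    show "{z \<in> space (lborel \<Otimes>\<^sub>M lborel :: (real \<times> real) measure). snd z \<notin> (\<rat> :: real set)} \<in> sets (lborel \<Otimes>\<^sub>M lborel)"
      by measurable
  qed (use rat in auto)
  then show ?thesis unfolding limit_measure_def
    by (subst AE_density) (auto simp: limit_density_def irr01_def elim!: eventually_mono)
qed

text \<open>
  The value \<open>2\<close> and the maxima only keep the image inside \<open>(1, \<infinity>) \<times> \<nat>\<^sub>+\<^sup>N\<close>
  on a null set.
\<close>
definition entries_map :: "nat \<Rightarrow> real \<times> real \<Rightarrow> real \<times> (nat \<Rightarrow> nat)" where
  "entries_map N z = (if 1 < fst z then fst z else 2, \<lambda>k\<in>{..<N}. max 1 (cf_entry (snd z) (Suc k)))"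

lemma entries_map_measurable: "entries_map N \<in> measurable limit_measure (ratio_entries_space N)"
  unfolding ratio_entries_space_def entries_map_def
proof (intro measurable_Pair measurable_restrict)
  show "(\<lambda>z. if 1 < fst z then fst z else 2) \<in> limit_measure \<rightarrow>\<^sub>M restrict_space borel {1<..}"
    by (rule measurable_restrict_space2) (auto, measurable)
  fix k
  have m: "(\<lambda>z. max 1 (cf_entry (snd z) (Suc k))) \<in> limit_measure \<rightarrow>\<^sub>M count_space UNIV" by measurable
  show "(\<lambda>z. max 1 (cf_entry (snd z) (Suc k))) \<in> limit_measure \<rightarrow>\<^sub>M count_space {1..}"
    using m by (auto simp: measurable_count_space_eq2_countable)
qed

text \<open>Almost everywhere the default values in \<open>entries_map\<close> are inactive and
  \<open>cf_entries_iff\<close> applies, so the preimage is a box up to a null set.\<close>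

lemma measure_distr_entries_map:
  assumes c: "\<And>k. k < N \<Longrightarrow> c k \<ge> 1" and ab: "1 \<le> a" "a \<le> b"
    and uv: "0 \<le> u" "u \<le> v" "v \<le> 1" "cf_eval (map c [0..<N]) ` {0<..<1} = {u<..<v}"
  shows "measure (distr limit_measure (ratio_entries_space N) (entries_map N)) ({a<..<b} \<times> (\<Pi>\<^sub>E k\<in>{..<N}. {c k})) =
    limit_const * integral {a..b} (ratio_theta u v)"
proof -
  interpret prob_space limit_measure by (rule prob_space_limit_measure)
  let ?S = "{a<..<b} \<times> (\<Pi>\<^sub>E k\<in>{..<N}. {c k})"
  have S: "?S \<in> sets (ratio_entries_space N)"
    unfolding ratio_entries_space_def
  proof (rule pair_measureI)
    show "{a<..<b} \<in> sets (restrict_space borel {1<..})" using ab by (auto simp: sets_restrict_space_iff)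
    show "(\<Pi>\<^sub>E k\<in>{..<N}. {c k}) \<in> sets (\<Pi>\<^sub>M k\<in>{..<N}. count_space {1..})"
      using c by (intro sets_PiM_I_finite) auto
  qed
  have "measure (distr limit_measure (ratio_entries_space N) (entries_map N)) ?S =
      measure limit_measure (entries_map N -` ?S \<inter> space limit_measure)"
    by (rule measure_distr[OF entries_map_measurable S])
  also have "\<dots> = measure limit_measure ({a<..<b} \<times> {u<..<v})"
  proof (rule measure_eq_AE)
    show "entries_map N -` ?S \<inter> space limit_measure \<in> sets limit_measure"
      using entries_map_measurable S by (rule measurable_sets)
    show "{a<..<b} \<times> {u<..<v} \<in> sets limit_measure" by auto
    show "AE z in limit_measure. (z \<in> entries_map N -` ?S \<inter> space limit_measure) = (z \<in> {a<..<b} \<times> {u<..<v})"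
      using AE_limit_measure
    proof eventually_elim
      case (elim z)
      have "max 1 (cf_entry (snd z) (Suc k)) = cf_entry (snd z) (Suc k)" for k
        using cf_entry_ge_1[OF irr01D, of "snd z"] elim by (simp add: max_def)
      then have "(\<lambda>k\<in>{..<N}. max 1 (cf_entry (snd z) (Suc k))) \<in> (\<Pi>\<^sub>E k\<in>{..<N}. {c k}) \<longleftrightarrow>
          (\<forall>k<N. cf_entry (snd z) (Suc k) = c k)"
        by (auto simp: PiE_iff)
      also have "\<dots> \<longleftrightarrow> snd z \<in> {u<..<v}"
        unfolding uv(4)[symmetric] using elim c by (intro cf_entries_iff) auto
      finally show ?case using elim by (cases z) (auto simp: entries_map_def)
    qed
  qed
  also have "\<dots> = limit_const * integral {a..b} (ratio_theta u v)"
    using emeasure_limit_measure_box[OF uv(1-3) ab] integral_ratio_theta_nonneg[of u a b v] uv ab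
    by (simp add: measure_def)
  finally show ?thesis .
qed

end

text \<open>The finite expansion of the rational ratio leaves the endpoints of the cylinder
  undecided. The two inclusions avoid deciding them, as the events for (u, v) and for [u, v] have
  the same limit.\<close>

lemma ratio_entries_event_sandwich:
  fixes a b R :: real and c :: "nat \<Rightarrow> nat"
  assumes c: "\<And>k. k < N \<Longrightarrow> c k \<ge> 1" and R: "R \<ge> 1"
    and u: "cf_eval (map c [0..<N]) ` {0<..<1} = {u<..<v}" "cf_eval (map c [0..<N]) ` {0..1} = {u..v}"
  defines "S \<equiv> {\<alpha> \<in> {0<..<1} - \<rat>.
              a < cf_q \<alpha> (cf_n R \<alpha>) / R \<and> cf_q \<alpha> (cf_n R \<alpha>) / R < b \<and>
              (\<forall>k<N. k < cf_n R \<alpha> \<and> cf_entry \<alpha> (cf_n R \<alpha> - k) = c k)}"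
  shows "ratio_event a b {u<..<v} R \<subseteq> S" "S \<subseteq> ratio_event a b {u..v} R"
proof -
  have R0: "R > 0" using R by simp
  show "ratio_event a b {u<..<v} R \<subseteq> S"
  proof
    fix \<alpha> assume "\<alpha> \<in> ratio_event a b {u<..<v} R"
    then obtain n where n: "\<alpha> \<in> irr01" "cf_n R \<alpha> = Suc n" "a * R < real (cf_q \<alpha> (Suc n))"
      "real (cf_q \<alpha> (Suc n)) < b * R" "real (cf_q \<alpha> n) / real (cf_q \<alpha> (Suc n)) \<in> {u<..<v}"
      by (auto simp: ratio_event_def simp del: cf_q.simps)
    have "cf_ratio \<alpha> (Suc n) \<in> cf_eval (map c [0..<N]) ` {0<..<1}"
      using n(5) by (simp only: u(1) cf_ratio_def nat.case)
    then have "\<forall>k<N. k < Suc n \<and> cf_entry \<alpha> (Suc n - k) = c k"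
      using cf_ratio_imp_entries[OF n(1), of N c "Suc n"] c by blast
    then show "\<alpha> \<in> S" using n R0
      by (simp add: S_def irr01_def pos_less_divide_eq pos_divide_less_eq del: cf_q.simps)
  qed
  show "S \<subseteq> ratio_event a b {u..v} R"
  proof
    fix \<alpha> assume S: "\<alpha> \<in> S"
    then have \<alpha>: "\<alpha> \<in> irr01" by (auto simp: S_def irr01_def)
    obtain n where n: "cf_n R \<alpha> = Suc n" using cf_n_props[OF \<alpha> R] .
    have "cf_ratio \<alpha> (Suc n) \<in> cf_eval (map c [0..<N]) ` {0..1}"
      using S by (intro cf_ratio_entries_imp[OF \<alpha>]) (simp add: S_def n)
    then have "real (cf_q \<alpha> n) / real (cf_q \<alpha> (Suc n)) \<in> {u..v}" by (simp only: u(2) cf_ratio_def nat.case)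
    then show "\<alpha> \<in> ratio_event a b {u..v} R" using S \<alpha> n R0
      by (simp add: ratio_event_def S_def pos_less_divide_eq pos_divide_less_eq del: cf_q.simps)
  qed
qed

theorem theorem1p1:
  fixes N :: nat
  shows "\<exists>P :: (real \<times> (nat \<Rightarrow> nat)) measure.
    prob_space P \<and> sets P = sets (ratio_entries_space N) \<and>
    (\<forall>(a::real) (b::real) (c :: nat \<Rightarrow> nat).
       a > 1 \<longrightarrow> b > 1 \<longrightarrow> (\<forall>k<N. c k \<ge> 1) \<longrightarrow>
       ((\<lambda>R::real. measure gauss_measure
           {\<alpha> \<in> {0<..<1} - \<rat>.
              a < cf_q \<alpha> (cf_n R \<alpha>) / R \<and> cf_q \<alpha> (cf_n R \<alpha>) / R < b \<and>
              (\<forall>k<N. k < cf_n R \<alpha> \<and> cf_entry \<alpha> (cf_n R \<alpha> - k) = c k)})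
         \<longlongrightarrow> measure P ({a<..<b} \<times> (\<Pi>\<^sub>E k\<in>{..<N}. {c k}))) at_top)"
proof -
  obtain \<kappa> where "has_mean (\<lambda>c. real (totient c) / real c) \<kappa>" using totient_ratio_has_mean by blast
  then interpret totient_mean \<kappa> by unfold_locales
  interpret gm: prob_space gauss_measure by (rule prob_space_gauss_measure)
  define E where "E a b c R = {\<alpha> \<in> {0<..<1} - \<rat>.
      a < cf_q \<alpha> (cf_n R \<alpha>) / R \<and> cf_q \<alpha> (cf_n R \<alpha>) / R < b \<and>
      (\<forall>k<N. k < cf_n R \<alpha> \<and> cf_entry \<alpha> (cf_n R \<alpha> - k) = c k)}" for a b R :: real and c
  define P where "P = distr limit_measure (ratio_entries_space N) (entries_map N)"
  have "prob_space P"
    unfolding P_def by (rule prob_space.prob_space_distr[OF prob_space_limit_measure entries_map_measurable])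
  moreover have "sets P = sets (ratio_entries_space N)" by (simp add: P_def)
  moreover have "((\<lambda>R. measure gauss_measure (E a b c R)) \<longlongrightarrow> measure P ({a<..<b} \<times> (\<Pi>\<^sub>E k\<in>{..<N}. {c k}))) at_top"
    if ab: "a > 1" "b > 1" and c: "\<forall>k<N. c k \<ge> 1" for a b :: real and c :: "nat \<Rightarrow> nat"
  proof (cases "a < b")
    case True
    obtain u v where uv: "0 \<le> u" "u < v" "v \<le> 1" "cf_eval (map c [0..<N]) ` {0<..<1} = {u<..<v}"
      "cf_eval (map c [0..<N]) ` {0..1} = {u..v}"
      using cf_eval_interval[of "map c [0..<N]"] c by auto
    have P: "measure P ({a<..<b} \<times> (\<Pi>\<^sub>E k\<in>{..<N}. {c k})) = limit_const * integral {a..b} (ratio_theta u v)"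
      unfolding P_def by (rule measure_distr_entries_map) (use c ab True uv in auto)
    show ?thesis unfolding P
    \<comment> \<open>Both bounds converge to the same value because
      \<open>ratio_event_tendsto\<close> leaves it open which endpoints belong to J.\<close>
    proof (rule tendsto_sandwich)
      show "((\<lambda>R. measure gauss_measure (ratio_event a b {u<..<v} R)) \<longlongrightarrow> limit_const * integral {a..b} (ratio_theta u v)) at_top"
        by (rule ratio_event_tendsto) (use uv ab True in auto)
      show "((\<lambda>R. measure gauss_measure (ratio_event a b {u..v} R)) \<longlongrightarrow> limit_const * integral {a..b} (ratio_theta u v)) at_top"
        by (rule ratio_event_tendsto) (use uv ab True in auto)
      show "\<forall>\<^sub>F R in at_top. measure gauss_measure (ratio_event a b {u<..<v} R) \<le> measure gauss_measure (E a b c R)"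
        using eventually_ge_at_top[of 1]
      proof eventually_elim
        case (elim R)
        show ?case
          unfolding E_def
          by (intro gm.finite_measure_mono ratio_entries_event_sandwich(1)[OF _ elim uv(4,5)] ratio_entries_event_measurable)
             (use c in auto)
      qed
      show "\<forall>\<^sub>F R in at_top. measure gauss_measure (E a b c R) \<le> measure gauss_measure (ratio_event a b {u..v} R)"
        using eventually_ge_at_top[of 1]
      proof eventually_elim
        case (elim R)
        show ?case
          unfolding E_def
          by (intro gm.finite_measure_mono ratio_entries_event_sandwich(2)[OF _ elim uv(4,5)] ratio_event_approx(1))
             (use c ab elim in auto)
      qed
    qed
  next
    case False
    have eq1: "E a b c R = {}" for R using False by (auto simp: E_def)
    have eq2: "{a<..<b} = {}" using False by simp
    show ?thesis unfolding eq1 eq2 by simp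
  qed
  ultimately show ?thesis unfolding E_def by blast
qed

end
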